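(* Suppose that the vector field $V$ satisfies assumptions (A1)--(A2) (stated in the context). Let $\gamma_0:[0,1]\to\overline\Omega$ be a Lipschitz curve satisfying $$D:=d\big(\gamma_0,\{T=+\infty\}\big)>0.$$ For $t\ge0$ let $\gamma_t(\alpha):=\Phi(t)(\gamma_0(\alpha))$, $\alpha\in[0,1]$, and define $$F(\alpha,t):=\begin{cases}|\nabla_{\gamma_0'(\alpha)}\ln T(\gamma_0(\alpha))|\cdot|V(\gamma_t(\alpha))|,& 0<T(\gamma_0(\alpha))<+\infty,\\ 0,&\text{otherwise.}\end{cases}$$ Set $D_*:=\min\{1,D\}>0$. Then there exists a constant $C=C(\Omega,V,D_* )>0$ such that $$\sup_{t\ge0}\left||\gamma_t|-t\int_0^1F(\alpha,t)\,d\alpha\right|\le C|\gamma_0|.$$ Moreover, $$\sup_{t\ge0}\int_0^1F(\alpha,t)\,d\alpha\le C|\gamma_0|.$$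
   Context: $\Omega\subset\mathbb R^2$ is a bounded Lipschitz domain (open, connected) and $V\in C^1(\overline\Omega;\mathbb R^2)$ (meaning $V$ is $C^1$ on some open set containing $\overline\Omega$) is a time-independent vector field with $\operatorname{div}V=0$ in $\Omega$ and $V\cdot\vec n=0$ on $\partial\Omega$ ($\vec n$ the outward unit normal). Assumptions: (A1) There is $H\in C^2(\mathbb R^2)$ with $V=(\partial_2H,-\partial_1H)^\top$ in $\overline\Omega$ and $H=0$ on $\partial\Omega$. (A2) $H$ has finitely many critical points $x_1^*,\dots,x_K^*$ on $\overline\Omega$, and for each $k$ there are a real number $m_k\ge1$ and a symmetric nonsingular $S_k\in\mathbb R^{2\times2}$ such that $H(x_k^*+y)-H(x_k^* )=\frac12|y|^{m_k-1}y^\top S_ky+R_k(y)$ for $y$ near $0$, where $R_k\in C^2(\mathbb R^2)$ and $\|D^jR_k(y)\|=o(|y|^{m_k+1-j})$ as $y\to0$, $j=0,1,2$. Flow: for $x_0\in\overline\Omega$, $x(\cdot;x_0)$ solves $x'(t)=V(x(t))$, $t\in\mathbb R$, $x(0)=x_0$, and $\Phi(t)(x_0):=x(t;x_0)$. Orbit period: $T(x_0):=\inf\{\hat t>0: x(\hat t;x_0)=x_0\}\in[0,+\infty]$ for $x_0\in\overline\Omega$, with $T(x_0)=+\infty$ if the set is empty. $T$ is $C^1$ on the set $\{0<T<+\infty\}$. For a vector $w$, $\nabla_wg:=w\cdot\nabla g$. $|\gamma|$ denotes the length of a Lipschitz curve $\gamma$ and $|\cdot|$ the Euclidean norm on vectors;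 $\gamma_0'(\alpha)$ exists for a.e. $\alpha$. $d(\cdot,\cdot)$ is the Euclidean distance (here between the image of $\gamma_0$ and a set), equal to $+\infty$ by convention if one of the sets is empty. $C(\ldots)$ denotes a constant depending only on the listed parameters. *)

theory Defs
  imports "HOL-Analysis.Analysis" "HOL-Library.Landau_Symbols"
begin

subsection \<open>Functions of class C1 and C2\<close>

definition fderiv :: "('a::real_normed_vector \<Rightarrow> 'b::real_normed_vector) \<Rightarrow> 'a \<Rightarrow> 'a \<Rightarrow>\<^sub>L 'b" where
  "fderiv f x = Blinfun (frechet_derivative f (at x))"

definition C1_on :: "('a::real_normed_vector \<Rightarrow> 'b::real_normed_vector) \<Rightarrow> 'a set \<Rightarrow> bool" where
  "C1_on f U \<longleftrightarrow> (\<forall>x\<in>U. f differentiable (at x)) \<and> continuous_on U (fderiv f)"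

definition C2_on :: "('a::real_normed_vector \<Rightarrow> 'b::real_normed_vector) \<Rightarrow> 'a set \<Rightarrow> bool" where
  "C2_on f U \<longleftrightarrow> C1_on f U \<and> C1_on (fderiv f) U"

definition C1_closure :: "('a::real_normed_vector \<Rightarrow> 'b::real_normed_vector) \<Rightarrow> 'a set \<Rightarrow> bool" where
  "C1_closure f \<Omega> \<longleftrightarrow> (\<exists>U. open U \<and> closure \<Omega> \<subseteq> U \<and> C1_on f U)"

definition partial_deriv :: "2 \<Rightarrow> (real^2 \<Rightarrow> real) \<Rightarrow> real^2 \<Rightarrow> real" where
  "partial_deriv i f x = frechet_derivative f (at x) (axis i 1)"

definition divergence :: "(real^2 \<Rightarrow> real^2) \<Rightarrow> real^2 \<Rightarrow> real" where
  "divergence W x = (\<Sum>i\<in>UNIV. partial_deriv i (\<lambda>y. W y $ i) x)"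

text \<open>The derivative is taken relative to the set \<open>S\<close>; \<open>S\<close> may contain boundary points of the
  domain (for instance when a boundary component is a periodic orbit), where the function has no
  canonical values on the other side.\<close>

definition gradient_within :: "(real^2 \<Rightarrow> real) \<Rightarrow> (real^2) set \<Rightarrow> real^2 \<Rightarrow> real^2" where
  "gradient_within g S x = (THE G. (g has_derivative (\<lambda>h. G \<bullet> h)) (at x within S))"


subsection \<open>Lipschitz domains in the plane\<close>

text \<open>In the orthonormal frame \<open>e1, e2\<close> centred at \<open>x\<close>, the set \<open>\<Omega>\<close> coincides
  near \<open>x\<close> with the epigraph of the Lipschitz function \<open>g\<close>.\<close>

definition lipschitz_chart ::
    "(real^2) set \<Rightarrow> real^2 \<Rightarrow> real^2 \<Rightarrow> real^2 \<Rightarrow> (real \<Rightarrow> real) \<Rightarrow> bool" where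
  "lipschitz_chart \<Omega> x e1 e2 g \<longleftrightarrow>
     norm e1 = 1 \<and> norm e2 = 1 \<and> e1 \<bullet> e2 = 0 \<and>
     (\<exists>L. L-lipschitz_on UNIV g) \<and> g 0 = 0 \<and>
     (\<exists>r>0. \<exists>h>0. \<forall>s \<tau>. \<bar>s\<bar> < r \<and> \<bar>\<tau>\<bar> < h \<longrightarrow>
        (x + s *\<^sub>R e1 + \<tau> *\<^sub>R e2 \<in> \<Omega> \<longleftrightarrow> g s < \<tau>))"

definition bounded_lipschitz_domain :: "(real^2) set \<Rightarrow> bool" where
  "bounded_lipschitz_domain \<Omega> \<longleftrightarrow>
     \<Omega> \<noteq> {} \<and> open \<Omega> \<and> connected \<Omega> \<and> bounded \<Omega> \<and>
     (\<forall>x\<in>frontier \<Omega>. \<exists>e1 e2 g. lipschitz_chart \<Omega> x e1 e2 g)"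

text \<open>The normal exists at those boundary points where a local graph function is differentiable,
  hence at almost every boundary point. Since \<open>\<Omega>\<close> lies above the graph, the normal points
  downwards.\<close>

definition outward_unit_normal :: "(real^2) set \<Rightarrow> real^2 \<Rightarrow> real^2 \<Rightarrow> bool" where
  "outward_unit_normal \<Omega> x n \<longleftrightarrow>
     (\<exists>e1 e2 g a. lipschitz_chart \<Omega> x e1 e2 g \<and> (g has_real_derivative a) (at 0) \<and>
        n = (1 / sqrt (1 + a\<^sup>2)) *\<^sub>R (a *\<^sub>R e1 - e2))"


subsection \<open>The assumptions on the Hamiltonian\<close>

definition assumption_A1 ::
    "(real^2) set \<Rightarrow> (real^2 \<Rightarrow> real^2) \<Rightarrow> (real^2 \<Rightarrow> real) \<Rightarrow> bool" where
  "assumption_A1 \<Omega> V H \<longleftrightarrow>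
     C2_on H UNIV \<and>
     (\<forall>x\<in>closure \<Omega>. V x = vector [partial_deriv 2 H x, - partial_deriv 1 H x]) \<and>
     (\<forall>x\<in>frontier \<Omega>. H x = 0)"

definition critical_points :: "(real^2) set \<Rightarrow> (real^2 \<Rightarrow> real) \<Rightarrow> (real^2) set" where
  "critical_points \<Omega> H = {x \<in> closure \<Omega>. fderiv H x = 0}"

definition homogeneous_expansion_at :: "(real^2 \<Rightarrow> real) \<Rightarrow> real^2 \<Rightarrow> bool" where
  "homogeneous_expansion_at H p \<longleftrightarrow>
     (\<exists>(m::real) (S::real^2^2) (R::real^2 \<Rightarrow> real).
        m \<ge> 1 \<and> transpose S = S \<and> invertible S \<and> C2_on R UNIV \<and>
        (\<forall>\<^sub>F y in nhds 0. H (p + y) - H p = 1/2 * norm y powr (m - 1) * (y \<bullet> (S *v y)) + R y) \<and>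
        (\<lambda>y. norm (R y)) \<in> o[at 0](\<lambda>y. norm y powr (m + 1)) \<and>
        (\<lambda>y. norm (fderiv R y)) \<in> o[at 0](\<lambda>y. norm y powr m) \<and>
        (\<lambda>y. norm (fderiv (fderiv R) y)) \<in> o[at 0](\<lambda>y. norm y powr (m - 1)))"

definition assumption_A2 :: "(real^2) set \<Rightarrow> (real^2 \<Rightarrow> real) \<Rightarrow> bool" where
  "assumption_A2 \<Omega> H \<longleftrightarrow>
     finite (critical_points \<Omega> H) \<and> (\<forall>p\<in>critical_points \<Omega> H. homogeneous_expansion_at H p)"


subsection \<open>Flow and orbit period\<close>

text \<open>\<open>\<Phi> t x\<close> is the position at time \<open>t\<close> of the particle that starts at \<open>x\<close>. As \<open>V\<close> is
  only given on \<open>closure \<Omega>\<close>, solutions take their values there. Values of \<open>\<Phi> t\<close>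
  outside \<open>closure \<Omega>\<close> are irrelevant.\<close>

definition flow_of ::
    "(real^2) set \<Rightarrow> (real^2 \<Rightarrow> real^2) \<Rightarrow> (real \<Rightarrow> real^2 \<Rightarrow> real^2) \<Rightarrow> bool" where
  "flow_of \<Omega> V \<Phi> \<longleftrightarrow>
     (\<forall>x\<in>closure \<Omega>. \<Phi> 0 x = x \<and>
        (\<forall>t. \<Phi> t x \<in> closure \<Omega> \<and>
             ((\<lambda>s. \<Phi> s x) has_vector_derivative V (\<Phi> t x)) (at t)))"

text \<open>In \<open>ereal\<close> the infimum of the empty set is \<open>\<infinity>\<close>.\<close>

definition orbit_period :: "(real \<Rightarrow> real^2 \<Rightarrow> real^2) \<Rightarrow> real^2 \<Rightarrow> ereal" where
  "orbit_period \<Phi> x = Inf (ereal ` {t. t > 0 \<and> \<Phi> t x = x})"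

definition periodic_points :: "(real^2) set \<Rightarrow> (real \<Rightarrow> real^2 \<Rightarrow> real^2) \<Rightarrow> (real^2) set" where
  "periodic_points \<Omega> \<Phi> = {x \<in> closure \<Omega>. 0 < orbit_period \<Phi> x \<and> orbit_period \<Phi> x < \<infinity>}"

definition nonperiodic_points :: "(real^2) set \<Rightarrow> (real \<Rightarrow> real^2 \<Rightarrow> real^2) \<Rightarrow> (real^2) set" where
  "nonperiodic_points \<Omega> \<Phi> = {x \<in> closure \<Omega>. orbit_period \<Phi> x = \<infinity>}"

definition ln_period :: "(real \<Rightarrow> real^2 \<Rightarrow> real^2) \<Rightarrow> real^2 \<Rightarrow> real" where
  "ln_period \<Phi> x = ln (real_of_ereal (orbit_period \<Phi> x))"


subsection \<open>Curves\<close>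

text \<open>Unlike \<open>setdist\<close>, which is 0 if one of the sets is empty, this distance is then \<open>\<infinity>\<close>.\<close>

definition set_edist :: "(real^2) set \<Rightarrow> (real^2) set \<Rightarrow> ereal" where
  "set_edist A B = (INF (a, b)\<in>A \<times> B. ereal (dist a b))"

text \<open>Length of a curve parametrised over \<open>{0..1}\<close>: the supremum of the lengths of inscribed
  polygons.\<close>

definition curve_length :: "(real \<Rightarrow> real^2) \<Rightarrow> ereal" where
  "curve_length \<gamma> =
     (SUP (n, s)\<in>{(n::nat, s::nat \<Rightarrow> real). mono_on {..n} s \<and> s ` {..n} \<subseteq> {0..1}}.
        ereal (\<Sum>i<n. dist (\<gamma> (s i)) (\<gamma> (s (Suc i)))))"

definition transported_curve ::
    "(real \<Rightarrow> real^2 \<Rightarrow> real^2) \<Rightarrow> (real \<Rightarrow> real^2) \<Rightarrow> real \<Rightarrow> real \<Rightarrow> real^2" where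
  "transported_curve \<Phi> \<gamma> t \<alpha> = \<Phi> t (\<gamma> \<alpha>)"

definition growth_density ::
    "(real^2) set \<Rightarrow> (real^2 \<Rightarrow> real^2) \<Rightarrow> (real \<Rightarrow> real^2 \<Rightarrow> real^2) \<Rightarrow> (real \<Rightarrow> real^2) \<Rightarrow>
      real \<Rightarrow> real \<Rightarrow> real" where
  "growth_density \<Omega> V \<Phi> \<gamma> \<alpha> t =
     (if 0 < orbit_period \<Phi> (\<gamma> \<alpha>) \<and> orbit_period \<Phi> (\<gamma> \<alpha>) < \<infinity>
      then \<bar>vector_derivative \<gamma> (at \<alpha> within {0..1}) \<bullet>
             gradient_within (ln_period \<Phi>) (periodic_points \<Omega> \<Phi>) (\<gamma> \<alpha>)\<bar>
           * norm (V (transported_curve \<Phi> \<gamma> t \<alpha>))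
      else 0)"

end

theory Submission
  imports Defs
begin

text \<open>Let \<open>\<Phi>\<close> be the flow and \<open>T\<close> the period of the orbit through a non-critical point \<open>x\<close>.
  Differentiating \<open>\<Phi> T x = x\<close> shows that over one period the derivative of the flow is
  \<open>w \<mapsto> w - (\<nabla>T \<bullet> w) V\<close>. Hence for \<open>t = n T + s\<close> the tangent vector of the transported curve
  differs from \<open>- n (\<nabla>T \<bullet> w) V\<close> only by the derivative of the flow over the time \<open>s < T\<close> applied
  to \<open>w\<close>, and \<open>n = t / T + O(1)\<close>. Everything is therefore controlled by the growth of the derivative of the flow
  during one period, for which by Gronwall it suffices to bound \<open>T\<close> times the maximum of \<open>|DV|\<close> on
  the orbit, locally uniformly in \<open>x\<close>. At non-critical points this is the continuity of \<open>T\<close>. A critical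
  point \<open>p\<close> away from the non-periodic orbits is an interior point and an extremum of \<open>H\<close>, since points
  of the level of \<open>p\<close> near \<open>p\<close> are not periodic; around it \<open>T\<close> is of order \<open>r powr (1 - m)\<close> while \<open>|DV|\<close>
  is of order \<open>r powr (m - 1)\<close>.\<close>


section \<open>Lipschitz curves\<close>

text \<open>As \<open>C\<close> may depend on \<open>\<Omega>\<close>, \<open>V\<close> and
  \<open>Dstar\<close> only, it is fixed before flow and curve: the points at distance at least
  \<open>Dstar\<close> from all non-periodic points form a compact set, on which local bounds become
  a global one, and uniqueness of solutions identifies every flow of \<open>V\<close> with one
  chosen flow for nonnegative times. The flow lives on the closed set
  \<open>closure \<Omega>\<close>, so all derivatives in space are relative to that set; the
  interior cones of a Lipschitz domain make such gradients unique. At non-critical points the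
  derivative of the flow is written down explicitly in the frame formed by \<open>W\<close> and
  \<open>N\<close>; the formula needs a symmetric Hessian, which is read off from the vanishing
  divergence. The curve is only Lipschitz, so lengths become integrals of speeds through
  differentiability almost everywhere. It may also pass through critical points, where no period is
  available; there the transported curve has, at almost every such parameter, the same derivative as
  the initial curve. Finally the density \<open>F\<close> has to be shown measurable before it can
  be integrated.\<close>

lemma le_if_right_steps:
  fixes f :: "real \<Rightarrow> real"
  assumes ab: "a \<le> b" and cont: "continuous_on {a..b} f"
    and step: "\<And>x. a \<le> x \<Longrightarrow> x < b \<Longrightarrow> \<exists>h>0. x + h \<le> b \<and> f x \<le> f (x + h)"
  shows "f a \<le> f b"
proof -
  \<comment> \<open>By continuity \<open>S\<close> has a largest point; if that were below
    \<open>b\<close>, the right step available there would produce a larger one.\<close>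
  define S where "S = {x\<in>{a..b}. f a \<le> f x}"
  have "closed S"
    using continuous_closed_preimage[OF cont _ closed_atLeast[of "f a"]]
    by (simp add: S_def Int_def vimage_def)
  moreover have "a \<in> S" "bdd_above S" using ab by (auto simp: S_def)
  ultimately have s: "Sup S \<in> S" by (intro closed_contains_Sup) auto
  have "Sup S = b"
  proof (rule ccontr)
    assume "Sup S \<noteq> b"
    with s have "a \<le> Sup S" "Sup S < b" by (auto simp: S_def)
    then obtain h where h: "h > 0" "Sup S + h \<le> b" "f (Sup S) \<le> f (Sup S + h)" using step by blast
    then have "Sup S + h \<in> S" using s by (auto simp: S_def)
    then have "Sup S + h \<le> Sup S" using \<open>bdd_above S\<close> by (rule cSup_upper)
    with h show False by simp
  qed
  with s show ?thesis by (simp add: S_def)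
qed

section \<open>Differentiability almost everywhere of Lipschitz functions of one variable\<close>

lemma borel_Int_interval_lmeasurable:
  fixes E :: "real set"
  assumes "E \<in> sets borel"
  shows "E \<inter> {a..b} \<in> lmeasurable"
proof (rule fmeasurableI2[of "{a..b}"])
  show "E \<inter> {a..b} \<in> sets lebesgue" using assms by (intro sets.Int) auto
qed auto

text \<open>From points of \<open>E\<close> there are arbitrarily short right steps of slope below
  \<open>p\<close>, elsewhere slopes are at most \<open>L\<close>, so every unit of measure of
  \<open>E\<close> saves \<open>L - p\<close>. Chaining right steps by
  \<open>le_if_right_steps\<close> takes the place of a covering argument.\<close>

lemma increment_le_right:
  fixes f :: "real \<Rightarrow> real"
  assumes lip: "L-lipschitz_on UNIV f" and "p \<le> L" and ab: "a \<le> b" and E: "E \<in> sets borel"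
    and low: "\<And>x. x \<in> E \<Longrightarrow> \<exists>\<^sub>F h in at_right 0. f (x + h) - f x < p * h"
  shows "f b - f a \<le> L * (b - a) - (L - p) * integral {a..b} (indicat_real E)"
proof -
  define E' where "E' = E \<inter> {a..b}"
  have E': "E' \<in> lmeasurable"
    using E unfolding E'_def by (rule borel_Int_interval_lmeasurable)
  have intE: "integral {a..b} (indicat_real E) = measure lebesgue E'"
    using E' unfolding E'_def by (simp add: integral_indicator)
  have "f b - f a \<le> L * (b - a) - (L - p) * (measure lebesgue E' - e)" if e: "e > 0" for e
  proof -
    \<comment> \<open>The approximating set is closed, so that a point outside it has a right step
      missing it altogether.\<close>
    obtain K where K: "closed K" "K \<subseteq> E'" "E' - K \<in> lmeasurable" "emeasure lebesgue (E' - K) < ennreal e"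
      using sets_lebesgue_inner_closed[OF fmeasurableD[OF E'] e] by blast
    have Km: "K \<in> lmeasurable"
      using K E' by (intro fmeasurableI2[OF E' K(2)]) (auto intro: borel_closed)
    have "measure lebesgue (E' - K) < e"
      using K(3,4) e by (simp add: emeasure_eq_measure2 ennreal_less_iff)
    then have mK: "measure lebesgue E' - e \<le> measure lebesgue K"
      using measurable_measure_Diff[OF E' _ K(2)] Km by (simp add: fmeasurableD)
    define m where "m x = integral {a..x} (indicat_real K)" for x
    have int: "(indicat_real K) integrable_on {c..d}" for c d
    proof -
      have "K \<inter> {c..d} \<in> lmeasurable" using Km by (simp add: fmeasurable_Int_fmeasurable)
      then show ?thesis by (simp add: integrable_on_indicator inf_commute)
    qed
    \<comment> \<open>The slack of the claim on \<open>{a..x}\<close>, with \<open>K\<close> in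
      place of \<open>E\<close>. A low step from a point of \<open>K\<close> pays for at most
      \<open>h\<close> of measure; a step off \<open>K\<close> leaves \<open>m\<close>
      unchanged.\<close>
    define \<phi> where "\<phi> x = L * (x - a) - (L - p) * m x - f x" for x
    have "\<phi> a \<le> \<phi> b"
    proof (rule le_if_right_steps[OF ab])
      have "continuous_on {a..b} m" unfolding m_def using int by (rule indefinite_integral_continuous_1)
      then show "continuous_on {a..b} \<phi>"
        unfolding \<phi>_def using continuous_on_subset[OF lipschitz_on_continuous_on[OF lip], of "{a..b}"]
        by (intro continuous_intros) auto
    next
      fix x assume x: "a \<le> x" "x < b"
      have dm: "m (x + h) - m x = integral {x..x+h} (indicat_real K)" if "h > 0" for h
        unfolding m_def using Henstock_Kurzweil_Integration.integral_combine[of a x "x+h" "indicat_real K"] int x that by auto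
      show "\<exists>h>0. x + h \<le> b \<and> \<phi> x \<le> \<phi> (x + h)"
      proof (cases "x \<in> K")
        case True
        then have "\<exists>\<^sub>F h in at_right 0. f (x + h) - f x < p * h" using low K(2) by (auto simp: E'_def)
        moreover have "\<forall>\<^sub>F h in at_right 0. h < b - x" 
          using x by (auto simp: eventually_at_right_field intro!: exI[of _ "b - x"])
        moreover have "\<forall>\<^sub>F h in at_right (0::real). h > 0" by (rule eventually_at_right_less)
        ultimately have "\<exists>\<^sub>F h in at_right 0. (h < b - x \<and> h > 0) \<and> f (x + h) - f x < p * h"
          by (intro frequently_eventually_conj eventually_conj)
        then obtain h where h: "h > 0" "h < b - x" "f (x + h) - f x < p * h"
          using frequently_ex by blast
        have "integral {x..x+h} (indicat_real K) \<le> integral {x..x+h} (\<lambda>_. 1)"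
          using int by (intro integral_le) (auto simp: indicator_def)
        then have "m (x + h) - m x \<le> h" using dm[OF h(1)] h(1) by simp
        then have "(L - p) * (m (x + h) - m x) \<le> (L - p) * h" using \<open>p \<le> L\<close> by (intro mult_left_mono) auto
        then have "\<phi> x \<le> \<phi> (x + h)" using h by (simp add: \<phi>_def algebra_simps)
        then show ?thesis using h by (intro exI[of _ h]) auto
      next
        case False
        then obtain d where d: "d > 0" "ball x d \<subseteq> - K" using K(1) open_contains_ball[of "-K"] by auto
        define h where "h = min (d/2) (b - x)"
        have h: "h > 0" "h < d" "x + h \<le> b" using d x by (auto simp: h_def min_def)
        have "integral {x..x+h} (indicat_real K) = integral {x..x+h} (\<lambda>_. 0)"
        proof (rule integral_cong)
          fix y assume "y \<in> {x..x+h}"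
          then have "y \<in> ball x d" using h by (auto simp: dist_real_def)
          then show "indicat_real K y = 0" using d by auto
        qed
        then have "m (x + h) - m x = 0" using dm[OF h(1)] by simp
        moreover have "\<bar>f (x + h) - f x\<bar> \<le> L * h"
          using lipschitz_onD[OF lip, of "x + h" x] h by (simp add: dist_real_def)
        ultimately have "\<phi> x \<le> \<phi> (x + h)" by (simp add: \<phi>_def algebra_simps)
        then show ?thesis using h by blast
      qed
    qed
    moreover have "m a = 0" by (simp add: m_def)
    moreover have "m b = measure lebesgue K"
    proof -
      have "K \<inter> {a..b} = K" using K(2) by (auto simp: E'_def)
      then show ?thesis unfolding m_def using Km by (simp add: integral_indicator)
    qed
    ultimately have "f b - f a \<le> L * (b - a) - (L - p) * measure lebesgue K"
      by (simp add: \<phi>_def)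
    also have "\<dots> \<le> L * (b - a) - (L - p) * (measure lebesgue E' - e)"
      using mult_left_mono[OF mK, of "L - p"] \<open>p \<le> L\<close> by simp
    finally show ?thesis .
  qed
  then have "f b - f a - (L * (b - a) - (L - p) * measure lebesgue E') \<le> (L - p) * e" if "e > 0" for e
    using that by (force simp: algebra_simps)
  then have "f b - f a - (L * (b - a) - (L - p) * measure lebesgue E') \<le> 0"
  proof (cases "p = L")
    case False
    then have "L - p > 0" using \<open>p \<le> L\<close> by simp
    show ?thesis
    proof (rule field_le_epsilon)
      fix e :: real assume "e > 0"
      then show "f b - f a - (L * (b - a) - (L - p) * measure lebesgue E') \<le> 0 + e"
        using \<open>\<And>e. e > 0 \<Longrightarrow> _ \<le> (L - p) * e\<close>[of "e / (L - p)"] \<open>L - p > 0\<close> by simp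
    qed
  qed (use \<open>\<And>e. e > 0 \<Longrightarrow> _ \<le> (L - p) * e\<close>[of 1] in simp)
  then show ?thesis by (simp add: intE)
qed

text \<open>The reflection \<open>g x = - f (- x)\<close> keeps the Lipschitz constant and turns
  left steps of \<open>f\<close> into right steps of \<open>g\<close>.\<close>

lemma increment_le_left:
  fixes f :: "real \<Rightarrow> real"
  assumes lip: "L-lipschitz_on UNIV f" and "p \<le> L" and ab: "a \<le> b" and E: "E \<in> sets borel"
    and low: "\<And>x. x \<in> E \<Longrightarrow> \<exists>\<^sub>F h in at_left 0. f (x + h) - f x > p * h"
  shows "f b - f a \<le> L * (b - a) - (L - p) * integral {a..b} (indicat_real E)"
proof -
  define g where "g x = - f (- x)" for x
  have "g (-a) - g (-b) \<le> L * (-a - -b) - (L - p) * integral {-b..-a} (indicat_real (uminus -` E))"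
  proof (rule increment_le_right)
    show "L-lipschitz_on UNIV g"
    proof (rule lipschitz_onI)
      fix x y :: real
      show "dist (g x) (g y) \<le> L * dist x y"
        using lipschitz_onD[OF lip, of "-x" "-y"] by (simp add: g_def dist_real_def abs_minus_commute)
    qed (use lip lipschitz_on_nonneg in auto)
    show "uminus -` E \<in> sets borel" using E by (intro measurable_sets_borel[OF _ E]) auto
    fix x assume "x \<in> uminus -` E"
    then have "- x \<in> E" by simp
    then have "\<exists>\<^sub>F h in at_left 0. f (- x + h) - f (- x) > p * h" by (rule low)
    then have "\<exists>\<^sub>F h in at_right 0. f (- x + - h) - f (- x) > p * - h"
      unfolding frequently_def at_left_minus[of 0] eventually_filtermap by simp
    then show "\<exists>\<^sub>F h in at_right 0. g (x + h) - g x < p * h"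
      by (rule frequently_elim1) (simp add: g_def)
  qed (use assms in auto)
  moreover have "integral {-b..-a} (indicat_real (uminus -` E)) = integral {a..b} (indicat_real E)"
    using Henstock_Kurzweil_Integration.integral_reflect_real[of b a "indicat_real E"]
    by (simp add: indicator_def[abs_def] vimage_def)
  ultimately show ?thesis by (simp add: g_def)
qed

text \<open>Let \<open>\<mu>\<close> be the measure of the part of \<open>E\<close> in an interval.
  Covering that part by nonoverlapping intervals of total length at most \<open>\<mu> + e\<close>
  gives \<open>\<mu> \<le> \<theta> * (\<mu> + e)\<close>, and \<open>e\<close> tending to 0 leaves
  \<open>\<mu> = 0\<close>.\<close>

lemma negligible_if_density_le:
  fixes E :: "real set"
  assumes E: "E \<in> sets borel" and "\<theta> < 1"
    and dens: "\<And>c d. c \<le> d \<Longrightarrow> integral {c..d} (indicat_real E) \<le> \<theta> * (d - c)"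
  shows "negligible E"
proof -
  have th: "0 \<le> \<theta>"
  proof -
    have "0 \<le> integral {0..1::real} (indicat_real E)"
      by (cases "indicat_real E integrable_on {0..1}") (auto intro: Henstock_Kurzweil_Integration.integral_nonneg simp: not_integrable_integral)
    then show ?thesis using dens[of 0 1] by simp
  qed
  have mE: "E \<inter> {c..d} \<in> lmeasurable" for c d
    using E by (rule borel_Int_interval_lmeasurable)
  have "negligible (E \<inter> {a..b})" for a b
  proof -
    let ?S = "E \<inter> {a..b}"
    let ?\<mu> = "measure lebesgue"
    have "?\<mu> ?S \<le> \<theta> * (?\<mu> ?S + e)" if e: "e > 0" for e
    proof -
      obtain D where D: "countable D" "\<And>K. K \<in> D \<Longrightarrow> K \<subseteq> cbox a b \<and> K \<noteq> {} \<and> (\<exists>c d. K = cbox c d)"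
        "pairwise (\<lambda>A B. interior A \<inter> interior B = {}) D"
        "?S \<subseteq> \<Union>D" "\<Union>D \<in> lmeasurable" "?\<mu> (\<Union>D) \<le> ?\<mu> ?S + e"
      proof (rule measurable_outer_intervals_bounded[OF mE, of a b a b e])
        show "E \<inter> {a..b} \<subseteq> cbox a b" by simp
      qed (use e in blast)+
      have DK: "\<exists>c d. c \<le> d \<and> K = {c..d}" if "K \<in> D" for K
        using D(2)[OF that] by (metis cbox_interval atLeastatMost_empty_iff2)
      have Km: "K \<in> lmeasurable" if "K \<in> D" for K using DK[OF that] by auto
      have EK: "?\<mu> (E \<inter> K) \<le> \<theta> * ?\<mu> K" if "K \<in> D" for K
      proof -
        obtain c d where cd: "c \<le> d" "K = {c..d}" using DK \<open>K \<in> D\<close> by blast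
        have "?\<mu> (E \<inter> {c..d}) = integral {c..d} (indicat_real E)"
          using mE by (simp add: integral_indicator)
        then show ?thesis using dens[OF cd(1)] cd by simp
      qed
      have "?\<mu> (\<Union>K\<in>D. E \<inter> K) \<le> \<theta> * ?\<mu> (\<Union>D)"
      proof (rule measure_UN_bound[OF D(1)])
        show "E \<inter> K \<in> lmeasurable" if K: "K \<in> D" for K
        proof -
          obtain c d where "K = {c..d}" using K DK by blast
          then show ?thesis using mE by auto
        qed
        fix D' assume D': "D' \<subseteq> D" "finite D'"
        have "?\<mu> (\<Union>K\<in>D'. E \<inter> K) \<le> (\<Sum>K\<in>D'. ?\<mu> (E \<inter> K))"
        proof (rule measure_UNION_le[OF D'(2)])
          fix K assume "K \<in> D'"
          then obtain c d where "K = {c..d}" using D' DK by blast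
          then show "E \<inter> K \<in> sets lebesgue" using mE by (auto dest: fmeasurableD)
        qed
        also have "\<dots> \<le> (\<Sum>K\<in>D'. \<theta> * ?\<mu> K)" using EK D' by (intro sum_mono) auto
        also have "\<dots> = \<theta> * (\<Sum>K\<in>D'. ?\<mu> K)" by (simp add: sum_distrib_left)
        also have "(\<Sum>K\<in>D'. ?\<mu> K) = ?\<mu> (\<Union>D')"
        proof (rule measure_negligible_finite_Union[symmetric])
          show "pairwise (\<lambda>S T. negligible (S \<inter> T)) D'"
          proof (rule pairwiseI)
            fix A B assume AB: "A \<in> D'" "B \<in> D'" "A \<noteq> B"
            then have "interior (A \<inter> B) = {}" using D(3) D'(1) unfolding pairwise_def by (auto simp del: interior_atLeastAtMost_real)
            moreover have "convex (A \<inter> B)" using DK[of A] DK[of B] AB D'(1) by (auto intro!: convex_Int)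
            ultimately show "negligible (A \<inter> B)" by (simp add: negligible_convex_interior)
          qed
        qed (use D' Km in auto)
        also have "\<dots> \<le> ?\<mu> (\<Union>D)"
        proof (rule measure_mono_fmeasurable[OF _ _ D(5)])
          show "\<Union>D' \<subseteq> \<Union>D" using D' by blast
          show "\<Union>D' \<in> sets lebesgue"
            by (rule sets.finite_Union[OF D'(2)]) (use D' Km fmeasurableD in blast)
        qed
        finally show "?\<mu> (\<Union>K\<in>D'. E \<inter> K) \<le> \<theta> * ?\<mu> (\<Union>D)" using th by (simp add: mult_left_mono)
      qed
      moreover have "?\<mu> ?S \<le> ?\<mu> (\<Union>K\<in>D. E \<inter> K)"
      proof (rule measure_mono_fmeasurable)
        show "?S \<subseteq> (\<Union>K\<in>D. E \<inter> K)" using D(4) by auto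
        show "(\<Union>K\<in>D. E \<inter> K) \<in> lmeasurable"
        proof (rule fmeasurableI2[OF D(5)])
          show "(\<Union>K\<in>D. E \<inter> K) \<in> sets lebesgue"
          proof (rule sets.countable_UN''[OF D(1)])
            fix K assume "K \<in> D"
            then obtain c d where "K = {c..d}" using DK by blast
            then show "E \<inter> K \<in> sets lebesgue" using mE by (auto dest: fmeasurableD)
          qed
        qed auto
      qed (use mE fmeasurableD in blast)
      ultimately show ?thesis using D(6) th by (meson mult_left_mono order_trans)
    qed
    then have "(1 - \<theta>) * ?\<mu> ?S \<le> \<theta> * e" if "e > 0" for e using that by (force simp: algebra_simps)
    then have le: "(1 - \<theta>) * ?\<mu> ?S \<le> e" if "e > 0" for e
    proof (cases "\<theta> = 0")
      case False
      have "(1 - \<theta>) * ?\<mu> ?S \<le> \<theta> * (e / \<theta>)"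
        using False th that by (intro \<open>\<And>e. e > 0 \<Longrightarrow> _ \<le> \<theta> * e\<close>) simp
      then show ?thesis using False by simp
    qed (use that \<open>\<And>e. e > 0 \<Longrightarrow> _ \<le> \<theta> * e\<close>[of 1] in linarith)
    have "(1 - \<theta>) * ?\<mu> ?S \<le> 0" by (rule field_le_epsilon) (use le in auto)
    then have "?\<mu> ?S = 0" using \<open>\<theta> < 1\<close>
      by (smt (verit) measure_nonneg mult_pos_pos)
    then show ?thesis using mE negligible_iff_measure by blast
  qed
  then have "negligible (E \<inter> cbox a b)" for a b by simp
  then show ?thesis using negligible_on_intervals by blast
qed

text \<open>Points with arbitrarily short steps to the given side whose difference quotient is below
  \<open>p\<close>; clearing the denominator reverses the inequality on the left. Quotients above
  \<open>q\<close> are expressed by \<open>dq_low (\<lambda>x. - f x) r (- q)\<close>.\<close>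

definition dq_low :: "(real \<Rightarrow> real) \<Rightarrow> bool \<Rightarrow> real \<Rightarrow> real set" where
  "dq_low f right p =
     {x. if right then \<exists>\<^sub>F h in at_right 0. f (x + h) - f x < p * h
         else \<exists>\<^sub>F h in at_left 0. f (x + h) - f x > p * h}"

text \<open>Testing step lengths below \<open>inverse (Suc n)\<close> for all \<open>n\<close> gives
  a countable intersection; each of its members is a union of open sets, uncountable but
  open.\<close>

lemma dq_low_borel:
  fixes f :: "real \<Rightarrow> real"
  assumes "continuous_on UNIV f"
  shows "dq_low f right p \<in> sets borel"
proof (cases right)
  case True
  have "(\<exists>\<^sub>F h in at_right 0. f (x + h) - f x < p * h) \<longleftrightarrow>
    (\<forall>n. \<exists>h\<in>{0<..<inverse (Suc n)}. f (x + h) - f x < p * h)" for x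
  proof
    assume fr: "\<exists>\<^sub>F h in at_right 0. f (x + h) - f x < p * h"
    have "eventually (\<lambda>h. h \<in> {0<..<inverse (real (Suc n))}) (at_right 0)" for n
      by (rule eventually_at_right_real) simp
    then show "\<forall>n. \<exists>h\<in>{0<..<inverse (Suc n)}. f (x + h) - f x < p * h"
      using frequently_ex[OF frequently_eventually_conj[OF fr]] by blast
  next
    assume R: "\<forall>n. \<exists>h\<in>{0<..<inverse (Suc n)}. f (x + h) - f x < p * h"
    show "\<exists>\<^sub>F h in at_right 0. f (x + h) - f x < p * h"
      unfolding frequently_def
    proof
      assume "\<forall>\<^sub>F h in at_right 0. \<not> f (x + h) - f x < p * h"
      then obtain b where b: "b > 0" "\<And>h. h > 0 \<Longrightarrow> h < b \<Longrightarrow> \<not> f (x + h) - f x < p * h"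
        by (auto simp: eventually_at_right_field)
      obtain n where "inverse (real (Suc n)) < b" using reals_Archimedean[OF b(1)] by auto
      with R b(2) show False by (metis greaterThanLessThan_iff less_trans)
    qed
  qed
  then have "dq_low f right p = (\<Inter>n. \<Union>h\<in>{0<..<inverse (real (Suc n))}. {x. f (x + h) - f x < p * h})"
    using True by (auto simp: dq_low_def)
  also have "\<dots> \<in> sets borel"
  proof (intro sets.countable_INT'' borel_open open_UN ballI)
    show "open {x. f (x + h) - f x < p * h}" for h
      by (intro open_Collect_less continuous_intros continuous_on_compose2[OF assms]) auto
  qed auto
  finally show ?thesis .
next
  case False
  have "(\<exists>\<^sub>F h in at_left 0. f (x + h) - f x > p * h) \<longleftrightarrow>
    (\<forall>n. \<exists>h\<in>{-inverse (Suc n)<..<0}. f (x + h) - f x > p * h)" for x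
  proof
    assume fr: "\<exists>\<^sub>F h in at_left 0. f (x + h) - f x > p * h"
    have "eventually (\<lambda>h. h \<in> {-inverse (real (Suc n))<..<0}) (at_left 0)" for n
      by (rule eventually_at_left_real) simp
    then show "\<forall>n. \<exists>h\<in>{-inverse (Suc n)<..<0}. f (x + h) - f x > p * h"
      using frequently_ex[OF frequently_eventually_conj[OF fr]] by blast
  next
    assume R: "\<forall>n. \<exists>h\<in>{-inverse (Suc n)<..<0}. f (x + h) - f x > p * h"
    show "\<exists>\<^sub>F h in at_left 0. f (x + h) - f x > p * h"
      unfolding frequently_def
    proof
      assume "\<forall>\<^sub>F h in at_left 0. \<not> f (x + h) - f x > p * h"
      then obtain b where b: "b < 0" "\<And>h. h > b \<Longrightarrow> h < 0 \<Longrightarrow> \<not> f (x + h) - f x > p * h"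
        by (auto simp: eventually_at_left_field)
      obtain n where "inverse (real (Suc n)) < - b" using reals_Archimedean[of "-b"] b(1) by auto
      then have "b < - inverse (real (Suc n))" by simp
      with R b(2) show False by (metis greaterThanLessThan_iff less_trans)
    qed
  qed
  then have "dq_low f right p = (\<Inter>n. \<Union>h\<in>{-inverse (real (Suc n))<..<0}. {x. f (x + h) - f x > p * h})"
    using False by (auto simp: dq_low_def)
  also have "\<dots> \<in> sets borel"
  proof (intro sets.countable_INT'' borel_open open_UN ballI)
    show "open {x. f (x + h) - f x > p * h}" for h
      by (intro open_Collect_less continuous_intros continuous_on_compose2[OF assms]) auto
  qed auto
  finally show ?thesis .
qed

lemma increment_le:
  fixes f :: "real \<Rightarrow> real"
  assumes "L-lipschitz_on UNIV f" "p \<le> L" "a \<le> b" "E \<in> sets borel" "E \<subseteq> dq_low f right p"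
  shows "f b - f a \<le> L * (b - a) - (L - p) * integral {a..b} (indicat_real E)"
  using increment_le_right[OF assms(1-4)] increment_le_left[OF assms(1-4)] assms(5)
  by (cases right) (auto simp: dq_low_def subset_iff)

text \<open>On such a set every interval $I$ would satisfy both
  $f(b) - f(a) \<le> L|I| - (L-p)|E \<inter> I|$ and $f(b) - f(a) \<ge> -L|I| + (L+q)|E \<inter> I|$,
  so that the density of $E$ in $I$ is at most $2L/(2L+q-p) < 1$.\<close>

lemma negligible_dq_gap:
  fixes f :: "real \<Rightarrow> real"
  assumes lip: "L-lipschitz_on UNIV f" and pq: "p < q"
  shows "negligible (dq_low f r1 p \<inter> dq_low (\<lambda>x. - f x) r2 (- q))"
proof -
  define E where "E = dq_low f r1 p \<inter> dq_low (\<lambda>x. - f x) r2 (- q)"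
  \<comment> \<open>Large enough for both uses of \<open>increment_le\<close>, where the slope
    bounds \<open>p\<close> and \<open>- q\<close> must not exceed the Lipschitz constant.\<close>
  define M where "M = Max {L, p, - q} + 1"
  have M: "M \<ge> L" "M \<ge> p" "M \<ge> -q" by (auto simp: M_def)
  have lipM: "M-lipschitz_on UNIV f" using lip M(1) by (rule lipschitz_on_le)
  then have lipM': "M-lipschitz_on UNIV (\<lambda>x. - f x)"
    by (simp add: lipschitz_on_def dist_real_def abs_minus_commute)
  have M0: "M \<ge> 0" using lipM by (rule lipschitz_on_nonneg)
  have E: "E \<in> sets borel"
    unfolding E_def using lipM lipM' by (intro sets.Int dq_low_borel) (auto intro: lipschitz_on_continuous_on)
  have "negligible E"
  proof (rule negligible_if_density_le[OF E])
    show "2 * M / (2 * M + (q - p)) < 1" using M0 pq by (simp add: divide_simps)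
    fix c d :: real assume cd: "c \<le> d"
    let ?I = "integral {c..d} (indicat_real E)"
    have "f d - f c \<le> M * (d - c) - (M - p) * ?I"
      by (rule increment_le[OF lipM M(2) cd E]) (auto simp: E_def)
    moreover have "- f d - - f c \<le> M * (d - c) - (M - - q) * ?I"
      by (rule increment_le[OF lipM' M(3) cd E]) (auto simp: E_def)
    ultimately have "(2 * M + (q - p)) * ?I \<le> 2 * M * (d - c)" by (simp add: algebra_simps)
    then show "?I \<le> 2 * M / (2 * M + (q - p)) * (d - c)" using M0 pq
      by (simp add: pos_le_divide_eq mult.commute)
  qed
  then show ?thesis by (simp add: E_def)
qed

text \<open>Difference quotients are bounded, so they have a limit \<open>l\<close> along some
  sequence of steps. Without a derivative they also take values at distance at least
  \<open>e\<close> from \<open>l\<close> for arbitrarily short steps, always on one side of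
  \<open>l\<close>; rationals \<open>p < q\<close> fit between the two behaviours.\<close>

lemma not_differentiable_imp_dq_gap:
  fixes f :: "real \<Rightarrow> real"
  assumes lip: "L-lipschitz_on UNIV f" and nd: "\<not> f differentiable (at x)"
  shows "\<exists>p\<in>\<rat>. \<exists>q\<in>\<rat>. p < q \<and> (\<exists>r1 r2. x \<in> dq_low f r1 p \<inter> dq_low (\<lambda>x. - f x) r2 (- q))"
proof -
  define Q where "Q h = (f (x + h) - f x) / h" for h
  have Qb: "\<bar>Q h\<bar> \<le> L" for h
  proof (cases "h = 0")
    case False
    then show ?thesis using lipschitz_onD[OF lip, of "x + h" x]
      by (simp add: Q_def dist_real_def divide_le_eq)
  qed (use lip lipschitz_on_nonneg in \<open>auto simp: Q_def\<close>)
  have low: "\<exists>r. x \<in> dq_low f r p" if "\<exists>\<^sub>F h in at 0. Q h < p" for p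
  proof -
    from that have "(\<exists>\<^sub>F h in at_left 0. Q h < p) \<or> (\<exists>\<^sub>F h in at_right 0. Q h < p)"
      by (simp add: frequently_def eventually_at_split)
    then show ?thesis
    proof
      assume "\<exists>\<^sub>F h in at_left 0. Q h < p"
      then have "\<exists>\<^sub>F h in at_left 0. h < 0 \<and> Q h < p"
        by (rule frequently_eventually_conj) (simp add: eventually_at_filter)
      then have "\<exists>\<^sub>F h in at_left 0. f (x + h) - f x > p * h"
        by (rule frequently_elim1) (auto simp: Q_def divide_less_eq split: if_splits)
      then have "x \<in> dq_low f False p" by (simp add: dq_low_def)
      then show ?thesis ..
    next
      assume "\<exists>\<^sub>F h in at_right 0. Q h < p"
      then have "\<exists>\<^sub>F h in at_right 0. h > 0 \<and> Q h < p"
        by (rule frequently_eventually_conj) (simp add: eventually_at_filter)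
      then have "\<exists>\<^sub>F h in at_right 0. f (x + h) - f x < p * h"
        by (rule frequently_elim1) (auto simp: Q_def divide_less_eq split: if_splits)
      then have "x \<in> dq_low f True p" by (simp add: dq_low_def)
      then show ?thesis ..
    qed
  qed
  have high: "\<exists>r. x \<in> dq_low (\<lambda>x. - f x) r (- q)" if "\<exists>\<^sub>F h in at 0. Q h > q" for q
  proof -
    from that have "(\<exists>\<^sub>F h in at_left 0. Q h > q) \<or> (\<exists>\<^sub>F h in at_right 0. Q h > q)"
      by (simp add: frequently_def eventually_at_split)
    then show ?thesis
    proof
      assume "\<exists>\<^sub>F h in at_left 0. Q h > q"
      then have "\<exists>\<^sub>F h in at_left 0. h < 0 \<and> Q h > q"
        by (rule frequently_eventually_conj) (simp add: eventually_at_filter)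
      then have "\<exists>\<^sub>F h in at_left 0. - f (x + h) - - f x > - q * h"
        by (rule frequently_elim1) (auto simp: Q_def less_divide_eq split: if_splits)
      then have "x \<in> dq_low (\<lambda>x. - f x) False (- q)" by (simp add: dq_low_def)
      then show ?thesis ..
    next
      assume "\<exists>\<^sub>F h in at_right 0. Q h > q"
      then have "\<exists>\<^sub>F h in at_right 0. h > 0 \<and> Q h > q"
        by (rule frequently_eventually_conj) (simp add: eventually_at_filter)
      then have "\<exists>\<^sub>F h in at_right 0. - f (x + h) - - f x < - q * h"
        by (rule frequently_elim1) (auto simp: Q_def less_divide_eq split: if_splits)
      then have "x \<in> dq_low (\<lambda>x. - f x) True (- q)" by (simp add: dq_low_def)
      then show ?thesis ..
    qed
  qed
  have "\<forall>n. Q (inverse (real (Suc n))) \<in> {-L..L}" using Qb by (auto simp: abs_le_iff minus_le_iff)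
  then obtain l r where r: "strict_mono r" "((\<lambda>n. Q (inverse (real (Suc n)))) \<circ> r) \<longlonglongrightarrow> l"
    using seq_compactE[OF compact_imp_seq_compact[OF compact_Icc[of "-L" L]]] by metis
  define s where "s n = inverse (real (Suc (r n)))" for n
  have s0: "s \<longlonglongrightarrow> 0"
    using LIMSEQ_subseq_LIMSEQ[OF LIMSEQ_inverse_real_of_nat r(1)] by (simp add: s_def[abs_def] o_def)
  have fs: "filterlim s (at 0) sequentially"
    unfolding filterlim_at using s0 by (auto simp: s_def)
  have Qs: "(\<lambda>n. Q (s n)) \<longlonglongrightarrow> l" using r(2) by (simp add: s_def o_def)
  have frs: "\<exists>\<^sub>F h in at 0. P h" if "\<forall>\<^sub>F n in sequentially. P (s n)" for P
  proof (unfold frequently_def, rule notI)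
    assume "\<forall>\<^sub>F h in at 0. \<not> P h"
    then have "\<forall>\<^sub>F n in sequentially. \<not> P (s n)" using fs by (rule eventually_compose_filterlim)
    with that have "\<forall>\<^sub>F n in sequentially. False" by eventually_elim simp
    then show False by simp
  qed
  have "\<not> (Q \<longlongrightarrow> l) (at 0)"
    using nd unfolding Q_def real_differentiable_def by (simp flip: DERIV_def)
  then obtain e where e: "e > 0" "\<not> (\<forall>\<^sub>F h in at 0. dist (Q h) l < e)" by (auto simp: tendsto_iff)
  from e(2) have "\<exists>\<^sub>F h in at 0. Q h \<ge> l + e \<or> Q h \<le> l - e"
    unfolding not_eventually by (rule frequently_elim1) (auto simp: dist_real_def abs_if split: if_splits)
  then consider "\<exists>\<^sub>F h in at 0. Q h \<ge> l + e" | "\<exists>\<^sub>F h in at 0. Q h \<le> l - e"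
    by (auto simp: frequently_disj_iff)
  then show ?thesis
  proof cases
    case 1
    obtain p where p: "p \<in> \<rat>" "l < p" "p < l + e" using Rats_dense_in_real[of l "l + e"] e by auto
    obtain q where q: "q \<in> \<rat>" "p < q" "q < l + e" using Rats_dense_in_real[of p "l + e"] p by auto
    have "\<exists>\<^sub>F h in at 0. Q h < p" using order_tendstoD(2)[OF Qs p(2)] by (rule frs)
    moreover have "\<exists>\<^sub>F h in at 0. Q h > q" using 1 by (rule frequently_elim1) (use q in auto)
    ultimately show ?thesis using low high p q by blast
  next
    case 2
    obtain p where p: "p \<in> \<rat>" "l - e < p" "p < l" using Rats_dense_in_real[of "l - e" l] e by auto
    obtain q where q: "q \<in> \<rat>" "p < q" "q < l" using Rats_dense_in_real[of p l] p by auto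
    have "\<exists>\<^sub>F h in at 0. Q h > q" using order_tendstoD(1)[OF Qs q(3)] by (rule frs)
    moreover have "\<exists>\<^sub>F h in at 0. Q h < p" using 2 by (rule frequently_elim1) (use p in auto)
    ultimately show ?thesis using low high p q by blast
  qed
qed

lemma negligible_UN:
  assumes "countable I" "\<And>i. i \<in> I \<Longrightarrow> negligible (S i)"
  shows "negligible (\<Union>i\<in>I. S i)"
  using assms by (intro negligible_countable_Union) auto

text \<open>Rational thresholds and the choices of sides leave only countably many exceptional sets,
  each null by \<open>negligible_dq_gap\<close>.\<close>

theorem lipschitz_differentiable_ae:
  fixes f :: "real \<Rightarrow> real"
  assumes "L-lipschitz_on UNIV f"
  shows "negligible {x. \<not> f differentiable (at x)}"
proof (rule negligible_subset)
  let ?N = "\<Union>p\<in>\<rat>. \<Union>q\<in>\<rat> \<inter> {p<..}. \<Union>r1. \<Union>r2. dq_low f r1 p \<inter> dq_low (\<lambda>x. - f x) r2 (- q)"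
  show "{x. \<not> f differentiable (at x)} \<subseteq> ?N"
    using not_differentiable_imp_dq_gap[OF assms] by fastforce
  show "negligible ?N"
    by (intro negligible_UN countable_rat countable_Int1 negligible_dq_gap[OF assms]) auto
qed

section \<open>Lengths of Lipschitz curves as integrals of the speed\<close>

lemma integral_split_equal:
  fixes g :: "real \<Rightarrow> real"
  assumes c: "0 \<le> c" and g: "continuous_on UNIV g"
  shows "integral {0..real n * c} g = integral {0..c} (\<lambda>x. \<Sum>i<n. g (x + real i * c))"
proof -
  have int: "g integrable_on {a..b}" for a b
    using continuous_on_subset[OF g] by (intro integrable_continuous_real) auto
  have sh: "(\<lambda>x. g (x + d)) integrable_on {a..b}" for a b d
    by (intro integrable_continuous_real continuous_on_compose2[OF g] continuous_intros) auto
  show ?thesis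
  proof (induction n)
    case (Suc n)
    have "integral {0..real (Suc n) * c} g
        = integral {0..real n * c} g + integral {real n * c..real (Suc n) * c} g"
      using c int by (intro Henstock_Kurzweil_Integration.integral_combine[symmetric]) (auto simp: algebra_simps)
    also have "integral {real n * c..real (Suc n) * c} g = integral {0..c} (\<lambda>x. g (x + real n * c))"
      using Henstock_Kurzweil_Integration.integral_shift_real_ivl[of "real n * c" "real n * c" "real (Suc n) * c" g]
      by (simp add: algebra_simps)
    finally show ?case using Suc sh
      by (simp add: Henstock_Kurzweil_Integration.integral_add integrable_sum)
  qed simp
qed

text \<open>Freezing a curve outside \<open>{0..1}\<close> makes the results for functions on the
  whole line applicable; the projection to the interval does not increase distances.\<close>

lemma lipschitz_on_clamp:
  fixes \<gamma> :: "real \<Rightarrow> 'a::metric_space"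
  assumes "L-lipschitz_on {0..1} \<gamma>"
  shows "L-lipschitz_on UNIV (\<lambda>x. \<gamma> (max 0 (min 1 x)))"
proof (rule lipschitz_onI)
  fix x y :: real
  have "dist (\<gamma> (max 0 (min 1 x))) (\<gamma> (max 0 (min 1 y))) \<le> L * dist (max 0 (min 1 x)) (max 0 (min 1 y))"
    by (rule lipschitz_onD[OF assms]) auto
  also have "\<dots> \<le> L * dist x y"
    by (intro mult_left_mono lipschitz_on_nonneg[OF assms]) (auto simp: dist_real_def)
  finally show "dist (\<gamma> (max 0 (min 1 x))) (\<gamma> (max 0 (min 1 y))) \<le> L * dist x y" .
qed (use lipschitz_on_nonneg[OF assms] in auto)

lemma lipschitz_vector_differentiable_ae:
  fixes g :: "real \<Rightarrow> 'a::euclidean_space"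
  assumes "L-lipschitz_on UNIV g"
  shows "negligible {x. \<not> g differentiable (at x)}"
proof (rule negligible_subset)
  show "{x. \<not> g differentiable (at x)} \<subseteq> (\<Union>b\<in>Basis. {x. \<not> (\<lambda>x. g x \<bullet> b) differentiable (at x)})"
    using differentiable_componentwise_within[of g _ UNIV] by auto
  show "negligible (\<Union>b\<in>Basis. {x. \<not> (\<lambda>x. g x \<bullet> b) differentiable (at x)})"
  proof (intro negligible_UN lipschitz_differentiable_ae lipschitz_onI)
    fix b :: 'a and x y :: real assume b: "b \<in> Basis"
    have "dist (g x \<bullet> b) (g y \<bullet> b) \<le> dist (g x) (g y)"
      using Basis_le_norm[OF b, of "g x - g y"] by (simp add: dist_norm inner_diff_left)
    also have "\<dots> \<le> L * dist x y" using assms by (auto dest: lipschitz_onD)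
    finally show "dist (g x \<bullet> b) (g y \<bullet> b) \<le> L * dist x y" .
  qed (use lipschitz_on_nonneg[OF assms] in \<open>auto simp: countable_finite\<close>)
qed

text \<open>With the fixed steps \<open>1 / Suc n\<close> the derivative is a pointwise limit of a
  sequence, as needed for dominated convergence and later for measurability of the growth
  density.\<close>

lemma vector_derivative_dq_tendsto:
  fixes g :: "real \<Rightarrow> 'a::real_normed_vector"
  assumes "g differentiable (at x)"
  shows "(\<lambda>n. real (Suc n) *\<^sub>R (g (x + 1 / real (Suc n)) - g x)) \<longlonglongrightarrow> vector_derivative g (at x)"
proof -
  have "(g has_vector_derivative vector_derivative g (at x)) (at x)"
    using assms vector_derivative_works by blast
  then have D: "((\<lambda>h. inverse h *\<^sub>R (g (x + h) - g x)) \<longlongrightarrow> vector_derivative g (at x)) (at 0)"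
  proof -
    assume "(g has_vector_derivative vector_derivative g (at x)) (at x)"
    then have "((\<lambda>h. norm (g (x + h) - g x - h *\<^sub>R vector_derivative g (at x)) / norm h) \<longlongrightarrow> 0) (at 0)"
      by (simp add: has_vector_derivative_def has_derivative_at)
    moreover have "\<forall>\<^sub>F h in at 0. norm (g (x + h) - g x - h *\<^sub>R vector_derivative g (at x)) / norm h
        = norm (inverse h *\<^sub>R (g (x + h) - g x) - vector_derivative g (at x))"
      using eventually_neq_at_within[of 0 0 UNIV]
    proof eventually_elim
      case (elim h)
      then have "inverse h *\<^sub>R (g (x + h) - g x) - vector_derivative g (at x)
        = inverse h *\<^sub>R (g (x + h) - g x - h *\<^sub>R vector_derivative g (at x))"
        by (simp add: scaleR_diff_right)
      then show ?case by (simp add: divide_inverse)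
    qed
    ultimately have "((\<lambda>h. norm (inverse h *\<^sub>R (g (x + h) - g x) - vector_derivative g (at x))) \<longlongrightarrow> 0) (at 0)"
      using tendsto_cong by force
    then show ?thesis by (rule LIM_zero_cancel[OF tendsto_norm_zero_cancel])
  qed
  have "filterlim (\<lambda>n. 1 / real (Suc n)) (at 0) sequentially"
    unfolding filterlim_at using LIMSEQ_inverse_real_of_nat by (auto simp: divide_inverse)
  from filterlim_compose[OF D this] show ?thesis by (simp add: divide_inverse)
qed

text \<open>The integral of a difference quotient is the difference of two averages of
  \<open>g\<close>, over short intervals starting at \<open>b\<close> and at \<open>a\<close>. These
  averages tend to \<open>g b\<close> and \<open>g a\<close>, and the limit passes under the
  integral because the quotients are bounded by \<open>L\<close>.\<close>

theorem lipschitz_has_integral_derivative: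
  fixes g :: "real \<Rightarrow> 'a::euclidean_space"
  assumes lip: "L-lipschitz_on UNIV g" and ab: "a \<le> b"
  shows "((\<lambda>x. vector_derivative g (at x)) has_integral g b - g a) {a..b}"
proof -
  define N where "N = {x. \<not> g differentiable (at x)}"
  have N: "negligible N" unfolding N_def using lip by (rule lipschitz_vector_differentiable_ae)
  have cont: "continuous_on UNIV g" using lip by (rule lipschitz_on_continuous_on)
  have L0: "L \<ge> 0" using lip by (rule lipschitz_on_nonneg)
  define c where "c n = 1 / real (Suc n)" for n
  have c: "c n > 0" for n by (simp add: c_def)
  define D where "D n x = real (Suc n) *\<^sub>R (g (x + c n) - g x)" for n x
  have intg: "g integrable_on {u..v}" for u v
    using continuous_on_subset[OF cont] by (intro integrable_continuous_real) auto
  have intsh: "(\<lambda>x. g (x + d)) integrable_on {u..v}" for u v d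
    by (intro integrable_continuous_real continuous_on_compose2[OF cont] continuous_intros) auto
  have intD: "D n integrable_on {a..b}" for n
    unfolding D_def[abs_def] by (intro integrable_cmul Henstock_Kurzweil_Integration.integrable_diff intg intsh)
  have normD: "norm (D n x) \<le> L" for n x
  proof -
    have "norm (g (x + c n) - g x) \<le> L * c n"
      using lipschitz_onD[OF lip, of "x + c n" x] c[of n] by (simp add: dist_norm)
    then have "real (Suc n) * norm (g (x + c n) - g x) \<le> real (Suc n) * (L * c n)"
      by (intro mult_left_mono) auto
    then show ?thesis by (simp add: D_def c_def)
  qed
  \<comment> \<open>Set to 0 on the null set of non-differentiability, so that the convergence holds
    at every point.\<close>
  define D' where "D' n x = (if x \<in> N then 0 else D n x)" for n x
  define g' where "g' x = (if x \<in> N then 0 else vector_derivative g (at x))" for x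
  have intD': "(D' n has_integral integral {a..b} (D n)) {a..b}" for n
    by (rule has_integral_spike[OF N _ integrable_integral[OF intD]]) (auto simp: D'_def)
  have lim: "(\<lambda>n. D' n x) \<longlonglongrightarrow> g' x" for x
    using vector_derivative_dq_tendsto[of g x]
    by (cases "x \<in> N") (auto simp: D'_def g'_def D_def N_def c_def)
  have "g' integrable_on {a..b} \<and> (\<lambda>n. integral {a..b} (D' n)) \<longlonglongrightarrow> integral {a..b} g'"
  proof (rule conjI)
    have *: "D' n integrable_on {a..b}" "norm (D' n x) \<le> L" for n x
      using intD' normD L0 by (auto simp: D'_def)
    show "g' integrable_on {a..b}"
      by (rule dominated_convergence(1)[of D' _ "\<lambda>_. L"]) (use * lim in auto)
    show "(\<lambda>n. integral {a..b} (D' n)) \<longlonglongrightarrow> integral {a..b} g'"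
      by (rule dominated_convergence(2)[of D' _ "\<lambda>_. L"]) (use * lim in auto)
  qed
  then have g': "g' integrable_on {a..b}" "(\<lambda>n. integral {a..b} (D n)) \<longlonglongrightarrow> integral {a..b} g'"
    by (simp_all add: integral_unique[OF intD'])
  have avg: "norm (integral {u..u + c n} g - c n *\<^sub>R g u) \<le> L * c n * c n" for u n
  proof -
    have "integral {u..u + c n} (\<lambda>x. g x - g u) = integral {u..u + c n} g - c n *\<^sub>R g u"
      using c[of n] by (subst Henstock_Kurzweil_Integration.integral_diff[OF intg]) auto
    moreover have "norm (integral {u..u + c n} (\<lambda>x. g x - g u)) \<le> L * c n * (u + c n - u)"
    proof (rule integral_bound)
      show "continuous_on {u..u + c n} (\<lambda>x. g x - g u)"
        using continuous_on_subset[OF cont] by (intro continuous_intros) auto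
      fix x assume x: "x \<in> {u..u + c n}"
      have "norm (g x - g u) \<le> L * \<bar>x - u\<bar>" using lipschitz_onD[OF lip, of x u] by (simp add: dist_norm)
      also have "\<dots> \<le> L * c n" using x L0 by (intro mult_left_mono) auto
      finally show "norm (g x - g u) \<le> L * c n" .
    qed (use c[of n] in auto)
    ultimately show ?thesis by simp
  qed
  have lim_avg: "(\<lambda>n. real (Suc n) *\<^sub>R integral {u..u + c n} g) \<longlonglongrightarrow> g u" for u
  proof (rule LIM_zero_cancel, rule Lim_null_comparison)
    have "norm (real (Suc n) *\<^sub>R integral {u..u + c n} g - g u) \<le> L * c n" for n
    proof -
      have "real (Suc n) *\<^sub>R integral {u..u + c n} g - g u = real (Suc n) *\<^sub>R (integral {u..u + c n} g - c n *\<^sub>R g u)"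
        by (simp add: c_def scaleR_diff_right)
      then have "norm (real (Suc n) *\<^sub>R integral {u..u + c n} g - g u)
        \<le> real (Suc n) * (L * c n * c n)"
        using mult_left_mono[OF avg[of u n], of "real (Suc n)"] by simp
      then show ?thesis by (simp add: c_def)
    qed
    then show "\<forall>\<^sub>F n in sequentially. norm (real (Suc n) *\<^sub>R integral {u..u + c n} g - g u) \<le> L * c n" by simp
    have "c \<longlonglongrightarrow> 0" using LIMSEQ_inverse_real_of_nat by (simp add: c_def[abs_def] divide_inverse)
    then show "(\<lambda>n. L * c n) \<longlonglongrightarrow> 0" by (rule tendsto_mult_right_zero)
  qed
  have "integral {a..b} (D n) = real (Suc n) *\<^sub>R integral {b..b + c n} g - real (Suc n) *\<^sub>R integral {a..a + c n} g" for n
  proof -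
    have "integral {a..b} (\<lambda>x. g (x + c n)) = integral {a + c n..b + c n} g"
      using Henstock_Kurzweil_Integration.integral_shift_real_ivl[of "a + c n" "c n" "b + c n" g] by simp
    moreover have "integral {a..b} g + integral {b..b + c n} g = integral {a..b + c n} g"
      using ab c[of n] intg by (intro Henstock_Kurzweil_Integration.integral_combine) auto
    moreover have "integral {a..a + c n} g + integral {a + c n..b + c n} g = integral {a..b + c n} g"
      using ab c[of n] intg by (intro Henstock_Kurzweil_Integration.integral_combine) auto
    ultimately have "integral {a..b} (\<lambda>x. g (x + c n)) = integral {a..b + c n} g - integral {a..a + c n} g"
      "integral {a..b} g = integral {a..b + c n} g - integral {b..b + c n} g"
      by (simp_all add: eq_diff_eq add.commute)
    then have "integral {a..b} (\<lambda>x. g (x + c n)) - integral {a..b} g = integral {b..b + c n} g - integral {a..a + c n} g"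
      by simp
    then show ?thesis
      unfolding D_def[abs_def] using intg intsh
      by (simp add: Henstock_Kurzweil_Integration.integral_diff flip: scaleR_diff_right)
  qed
  then have "(\<lambda>n. integral {a..b} (D n)) \<longlonglongrightarrow> g b - g a"
    using tendsto_diff[OF lim_avg lim_avg, of b a] by simp
  then have "integral {a..b} g' = g b - g a" using g'(2) LIMSEQ_unique by blast
  then have "(g' has_integral g b - g a) {a..b}" using g'(1) by (simp add: has_integral_iff)
  then show ?thesis by (rule has_integral_spike[OF N, rotated]) (auto simp: g'_def)
qed

lemma norm_vector_derivative_le:
  fixes g :: "real \<Rightarrow> 'a::real_normed_vector"
  assumes lip: "L-lipschitz_on UNIV g" and d: "g differentiable (at x)"
  shows "norm (vector_derivative g (at x)) \<le> L"
proof (rule Lim_norm_ubound[OF _ vector_derivative_dq_tendsto[OF d]])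
  have "real (Suc n) * norm (g (x + 1 / real (Suc n)) - g x) \<le> real (Suc n) * (L * (1 / real (Suc n)))" for n
    using lipschitz_onD[OF lip, of "x + 1 / real (Suc n)" x] by (intro mult_left_mono) (auto simp: dist_norm)
  then show "\<forall>\<^sub>F n in sequentially. norm (real (Suc n) *\<^sub>R (g (x + 1 / real (Suc n)) - g x)) \<le> L"
    by (simp del: of_nat_Suc)
qed simp

lemma integrable_norm_vector_derivative:
  fixes g :: "real \<Rightarrow> 'a::euclidean_space"
  assumes lip: "L-lipschitz_on UNIV g"
  shows "(\<lambda>x. norm (vector_derivative g (at x))) integrable_on {a..b}"
proof -
  define N where "N = {x. \<not> g differentiable (at x)}"
  have N: "negligible N" unfolding N_def using lip by (rule lipschitz_vector_differentiable_ae)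
  define g' where "g' x = (if x \<in> N then 0 else vector_derivative g (at x))" for x
  have "(\<lambda>x. vector_derivative g (at x)) integrable_on {a..b}"
    using lipschitz_has_integral_derivative[OF lip] by (cases "a \<le> b") auto
  then have "g' integrable_on {a..b}" by (rule integrable_spike[OF _ N]) (auto simp: g'_def)
  then have "g' absolutely_integrable_on {a..b}"
    by (rule absolutely_integrable_integrable_bound[of _ _ "\<lambda>_. L", rotated])
       (use norm_vector_derivative_le[OF lip] lipschitz_on_nonneg[OF lip] in \<open>auto simp: g'_def N_def\<close>)
  then have "(\<lambda>x. norm (g' x)) integrable_on {a..b}" by (simp add: absolutely_integrable_on_def)
  then show ?thesis by (rule integrable_spike[OF _ N]) (auto simp: g'_def)
qed

text \<open>A chord is at most the integral of the speed. Conversely the integral of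
  \<open>D n\<close> is an average of lengths of inscribed polygons, taken over the offset of an
  equidistant grid, and it tends to the integral of the speed.\<close>

theorem curve_length_eq_integral_UNIV:
  fixes g :: "real \<Rightarrow> real^2"
  assumes lip: "L-lipschitz_on UNIV g" and const: "\<And>x. x \<ge> 1 \<Longrightarrow> g x = g 1"
  shows "curve_length g = ereal (integral {0..1} (\<lambda>x. norm (vector_derivative g (at x))))"
proof (rule antisym)
  let ?v = "\<lambda>x. vector_derivative g (at x)"
  have intn: "(\<lambda>x. norm (?v x)) integrable_on {a..b}" for a b
    using lip by (rule integrable_norm_vector_derivative)
  show "curve_length g \<le> ereal (integral {0..1} (\<lambda>x. norm (?v x)))"
    unfolding curve_length_def
  proof (rule SUP_least, clarsimp)
    fix n :: nat and s :: "nat \<Rightarrow> real" assume s: "mono_on {..n} s" "s ` {..n} \<subseteq> {0..1}"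
    have le: "s i \<le> s (Suc i)" if "i < n" for i using s(1) that by (auto simp: mono_on_def)
    have "m \<le> n \<Longrightarrow> (\<Sum>i<m. dist (g (s i)) (g (s (Suc i)))) \<le> integral {s 0..s m} (\<lambda>x. norm (?v x))" for m
    proof (induction m)
      case (Suc m)
      have "dist (g (s m)) (g (s (Suc m))) = norm (integral {s m..s (Suc m)} ?v)"
        using lipschitz_has_integral_derivative[OF lip le[of m]] Suc.prems
        by (simp add: integral_unique dist_norm norm_minus_commute)
      also have "\<dots> \<le> integral {s m..s (Suc m)} (\<lambda>x. norm (?v x))"
        using lipschitz_has_integral_derivative[OF lip le[of m]] Suc.prems intn
        by (intro integral_norm_bound_integral) auto
      finally have "(\<Sum>i<Suc m. dist (g (s i)) (g (s (Suc i))))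
          \<le> integral {s 0..s m} (\<lambda>x. norm (?v x)) + integral {s m..s (Suc m)} (\<lambda>x. norm (?v x))"
        using Suc by simp
      also have "\<dots> = integral {s 0..s (Suc m)} (\<lambda>x. norm (?v x))"
        using s(1) Suc.prems intn le[of m]
        by (intro Henstock_Kurzweil_Integration.integral_combine) (auto simp: mono_on_def)
      finally show ?case .
    qed simp
    from this[of n] have "(\<Sum>i<n. dist (g (s i)) (g (s (Suc i)))) \<le> integral {s 0..s n} (\<lambda>x. norm (?v x))" by simp
    also have "\<dots> \<le> integral {0..1} (\<lambda>x. norm (?v x))"
      using s(2) intn by (intro integral_subset_le) auto
    finally show "(\<Sum>i<n. dist (g (s i)) (g (s (Suc i)))) \<le> integral {0..1} (\<lambda>x. norm (?v x))" .
  qed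
next
  let ?v = "\<lambda>x. vector_derivative g (at x)"
  define N where "N = {x. \<not> g differentiable (at x)}"
  have N: "negligible N" unfolding N_def using lip by (rule lipschitz_vector_differentiable_ae)
  have cont: "continuous_on UNIV g" using lip by (rule lipschitz_on_continuous_on)
  have L0: "L \<ge> 0" using lip by (rule lipschitz_on_nonneg)
  define c where "c n = 1 / real (Suc n)" for n
  have c: "c n > 0" "real (Suc n) * c n = 1" for n by (simp_all add: c_def)
  define D where "D n x = real (Suc n) * norm (g (x + c n) - g x)" for n x
  have contD: "continuous_on UNIV (D n)" for n
    unfolding D_def[abs_def] by (intro continuous_intros continuous_on_compose2[OF cont]) auto
  have normD: "norm (D n x) \<le> L" for n x
  proof -
    have "norm (g (x + c n) - g x) \<le> L * c n"
      using lipschitz_onD[OF lip, of "x + c n" x] c(1)[of n] by (simp add: dist_norm)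
    then have "real (Suc n) * norm (g (x + c n) - g x) \<le> real (Suc n) * (L * c n)"
      by (intro mult_left_mono) auto
    then show ?thesis by (simp add: D_def c_def)
  qed
  define D' where "D' n x = (if x \<in> N then 0 else D n x)" for n x
  define g' where "g' x = (if x \<in> N then 0 else norm (?v x))" for x
  have intD: "D n integrable_on {0..1}" for n
    using continuous_on_subset[OF contD] by (intro integrable_continuous_real) auto
  have intD': "(D' n has_integral integral {0..1} (D n)) {0..1}" for n
    by (rule has_integral_spike[OF N _ integrable_integral[OF intD]]) (auto simp: D'_def)
  have lim: "(\<lambda>n. D' n x) \<longlonglongrightarrow> g' x" for x
    using tendsto_norm[OF vector_derivative_dq_tendsto[of g x]]
    by (cases "x \<in> N") (auto simp: D'_def g'_def D_def N_def c_def)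
  have *: "D' n integrable_on {0..1}" "norm (D' n x) \<le> L" for n x
    using intD' normD L0 by (auto simp: D'_def)
  have "(\<lambda>n. integral {0..1} (D' n)) \<longlonglongrightarrow> integral {0..1} g'"
    by (rule dominated_convergence(2)[of D' _ "\<lambda>_. L"]) (use * lim in auto)
  moreover have "integral {0..1} g' = integral {0..1} (\<lambda>x. norm (?v x))"
    by (rule integral_spike[OF N]) (auto simp: g'_def)
  ultimately have conv: "(\<lambda>n. integral {0..1} (D n)) \<longlonglongrightarrow> integral {0..1} (\<lambda>x. norm (?v x))"
    by (simp add: integral_unique[OF intD'])
  have poly: "ereal (\<Sum>i<Suc n. norm (g (x + real i * c n + c n) - g (x + real i * c n))) \<le> curve_length g"
    if "x \<in> {0..c n}" for n x
  proof -
    \<comment> \<open>The last node may pass 1; clamping it does not move its image, as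
      \<open>g\<close> is constant from 1 on.\<close>
    define s where "s i = min 1 (x + real i * c n)" for i
    have "mono_on {..Suc n} s" using c(1)[of n] by (auto simp: s_def mono_on_def min_def)
       (meson mult_right_mono of_nat_mono add_left_mono less_imp_le order_trans)+
    moreover have "s ` {..Suc n} \<subseteq> {0..1}" using that c(1)[of n] by (auto simp: s_def)
    ultimately have "ereal (\<Sum>i<Suc n. dist (g (s i)) (g (s (Suc i)))) \<le> curve_length g"
      unfolding curve_length_def by (intro SUP_upper2[of "(Suc n, s)"]) auto
    moreover have "dist (g (s i)) (g (s (Suc i))) = norm (g (x + real i * c n + c n) - g (x + real i * c n))" for i
    proof -
      have gs: "g (s j) = g (x + real j * c n)" for j
        using const[of "x + real j * c n"] by (cases "x + real j * c n \<ge> 1") (simp_all add: s_def)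
      have "x + real (Suc i) * c n = x + real i * c n + c n" by (simp add: algebra_simps)
      then show ?thesis unfolding gs dist_norm by (metis norm_minus_commute)
    qed
    ultimately show ?thesis by simp
  qed
  show "ereal (integral {0..1} (\<lambda>x. norm (?v x))) \<le> curve_length g"
  proof (cases "curve_length g")
    case (real l)
    have "integral {0..1} (D n) \<le> l" for n
    proof -
      have "integral {0..1} (D n) = integral {0..c n} (\<lambda>x. \<Sum>i<Suc n. D n (x + real i * c n))"
        using integral_split_equal[of "c n" "D n" "Suc n"] contD c[of n] by simp
      also have "\<dots> \<le> integral {0..c n} (\<lambda>_. real (Suc n) * l)"
      proof (rule integral_le)
        show "(\<lambda>x. \<Sum>i<Suc n. D n (x + real i * c n)) integrable_on {0..c n}"
          by (intro integrable_continuous_real continuous_intros continuous_on_compose2[OF contD]) auto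
        fix x assume "x \<in> {0..c n}"
        from poly[OF this] have "(\<Sum>i<Suc n. norm (g (x + real i * c n + c n) - g (x + real i * c n))) \<le> l"
          using real by simp
        then have "real (Suc n) * (\<Sum>i<Suc n. norm (g (x + real i * c n + c n) - g (x + real i * c n))) \<le> real (Suc n) * l"
          by (intro mult_left_mono) auto
        then show "(\<Sum>i<Suc n. D n (x + real i * c n)) \<le> real (Suc n) * l"
          by (simp only: D_def sum_distrib_left)
      qed auto
      also have "\<dots> = l" using c(1)[of n] by (simp add: c_def del: of_nat_Suc)
      finally show ?thesis .
    qed
    then have "integral {0..1} (\<lambda>x. norm (?v x)) \<le> l" using conv by (intro LIMSEQ_le_const2[OF conv]) auto
    then show ?thesis using real by simp
  next
    case MInf
    then show ?thesis using poly[of 0 0] c(1)[of 0] by (simp add: less_imp_le)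
  qed auto
qed

theorem lipschitz_curve_length:
  fixes \<gamma> :: "real \<Rightarrow> real^2"
  assumes lip: "L-lipschitz_on {0..1} \<gamma>"
  obtains N where "negligible N"
    "\<And>x. x \<in> {0..1} - N \<Longrightarrow> 0 < x \<and> x < 1 \<and>
       (\<gamma> has_vector_derivative vector_derivative \<gamma> (at x within {0..1})) (at x)"
    "(\<lambda>x. norm (vector_derivative \<gamma> (at x within {0..1}))) integrable_on {0..1}"
    "curve_length \<gamma> = ereal (integral {0..1} (\<lambda>x. norm (vector_derivative \<gamma> (at x within {0..1}))))"
proof -
  define g where "g x = \<gamma> (max 0 (min 1 x))" for x
  have lipg: "L-lipschitz_on UNIV g" unfolding g_def using lip by (rule lipschitz_on_clamp)
  \<comment> \<open>The end points join the null set, so that outside it the derivative within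
    \<open>{0..1}\<close> is two-sided.\<close>
  define N where "N = {x. \<not> g differentiable (at x)} \<union> {0, 1}"
  have N: "negligible N"
    unfolding N_def using lipschitz_vector_differentiable_ae[OF lipg] by (simp add: negligible_Un)
  have *: "0 < x \<and> x < 1 \<and> (\<gamma> has_vector_derivative vector_derivative g (at x)) (at x) \<and>
      vector_derivative \<gamma> (at x within {0..1}) = vector_derivative g (at x)" if x: "x \<in> {0..1} - N" for x
  proof -
    have x01: "0 < x" "x < 1" using x by (auto simp: N_def)
    have "(g has_vector_derivative vector_derivative g (at x)) (at x)"
      using x by (auto simp: N_def vector_derivative_works)
    then have d: "(\<gamma> has_vector_derivative vector_derivative g (at x)) (at x)"
      by (rule has_vector_derivative_transform_within_open[of _ _ _ "{0<..<1}"]) (use x01 in \<open>auto simp: g_def\<close>)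
    moreover have "at x within {0..1} = at x" using x01 by (simp add: at_within_Icc_at)
    ultimately show ?thesis using x01 vector_derivative_at[OF d] by simp
  qed
  have eq: "norm (vector_derivative \<gamma> (at x within {0..1})) = norm (vector_derivative g (at x))"
    if "x \<in> {0..1} - N" for x using *[OF that] by simp
  have "curve_length \<gamma> = curve_length g"
    unfolding curve_length_def
  proof (rule SUP_cong[OF refl], clarsimp, rule sum.cong[OF refl])
    fix n i :: nat and s :: "nat \<Rightarrow> real" assume s: "s ` {..n} \<subseteq> {0..1}" "i \<in> {..<n}"
    then have "s i \<in> {0..1}" "s (Suc i) \<in> {0..1}" by (auto simp: image_subset_iff simp del: atLeastAtMost_iff)
    then show "dist (\<gamma> (s i)) (\<gamma> (s (Suc i))) = dist (g (s i)) (g (s (Suc i)))" by (simp add: g_def)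
  qed
  also have "\<dots> = ereal (integral {0..1} (\<lambda>x. norm (vector_derivative g (at x))))"
    by (rule curve_length_eq_integral_UNIV[OF lipg]) (simp add: g_def)
  also have "integral {0..1} (\<lambda>x. norm (vector_derivative g (at x)))
      = integral {0..1} (\<lambda>x. norm (vector_derivative \<gamma> (at x within {0..1})))"
    by (rule integral_spike[OF N]) (use eq in auto)
  finally have len: "curve_length \<gamma> = ereal \<dots>" .
  have "(\<lambda>x. norm (vector_derivative \<gamma> (at x within {0..1}))) integrable_on {0..1}"
    by (rule integrable_spike[OF integrable_norm_vector_derivative[OF lipg] N]) (use eq in auto)
  then show thesis using that[OF N _ _ len] * by auto
qed


section \<open>The flow of a planar Hamiltonian vector field\<close>

definition rot :: "real^2 \<Rightarrow> real^2" where
  "rot w = vector [w $ 2, - w $ 1]"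

lemma rot_nth [simp]: "rot w $ 1 = w $ 2" "rot w $ 2 = - w $ 1"
  by (simp_all add: rot_def)

lemma vec2_eq_iff: "u = w \<longleftrightarrow> u $ 1 = w $ 1 \<and> u $ 2 = (w::real^2) $ 2"
  by (simp add: vec_eq_iff forall_2)

lemma inner_vec2: "u \<bullet> w = u $ 1 * w $ 1 + u $ 2 * (w::real^2) $ 2"
  by (simp add: inner_vec_def sum_2)

lemma bounded_linear_rot: "bounded_linear rot"
  by (rule linear_conv_bounded_linear[THEN iffD1], rule linearI) (simp_all add: vec2_eq_iff)

lemma rot_simps [simp]:
  "rot 0 = 0" "rot (- u) = - rot u" "rot (u + w) = rot u + rot w" "rot (u - w) = rot u - rot w"
  "rot (c *\<^sub>R u) = c *\<^sub>R rot u" "rot (rot u) = - u"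
  by (simp_all add: vec2_eq_iff)

lemma rot_inner_self [simp]: "rot u \<bullet> u = 0" "u \<bullet> rot u = 0"
  by (simp_all add: inner_vec2)

lemma rot_inner_rot [simp]: "rot u \<bullet> rot w = u \<bullet> w"
  by (simp add: inner_vec2)

lemma rot_inner: "rot u \<bullet> w = - (u \<bullet> rot w)"
  by (simp add: inner_vec2)

lemma norm_rot [simp]: "norm (rot u) = norm u"
  by (simp add: norm_eq_sqrt_inner)

lemma rot_eq_0_iff [simp]: "rot u = 0 \<longleftrightarrow> u = 0"
  using norm_rot[of u] by (metis norm_eq_zero)

lemma rot_decomp: "(norm n)\<^sup>2 *\<^sub>R w = (n \<bullet> w) *\<^sub>R n + (rot n \<bullet> w) *\<^sub>R rot n"
  by (simp add: vec2_eq_iff inner_vec2 power2_norm_eq_inner algebra_simps)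

lemma rot_frame_eqI:
  assumes "n \<noteq> 0" "n \<bullet> u = n \<bullet> w" "rot n \<bullet> u = rot n \<bullet> w"
  shows "u = w"
proof -
  have "(norm n)\<^sup>2 *\<^sub>R u = (norm n)\<^sup>2 *\<^sub>R w" unfolding rot_decomp using assms by simp
  with assms(1) show ?thesis by simp
qed

text \<open>Derivatives are demanded in the open interval only, because the integral defining
  \<open>shear\<close> will be differentiated at positive times only.\<close>

lemma gronwall:
  fixes y :: "real \<Rightarrow> 'a::real_inner"
  assumes t: "0 \<le> t" and M: "0 \<le> M" and e: "0 \<le> e" and cont: "continuous_on {0..t} y"
    and d: "\<And>s. 0 < s \<Longrightarrow> s < t \<Longrightarrow> (y has_vector_derivative y' s) (at s)"
    and le: "\<And>s. 0 < s \<Longrightarrow> s < t \<Longrightarrow> norm (y' s) \<le> M * norm (y s) + e"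
  shows "norm (y t) \<le> (norm (y 0) + e * t) * exp (M * t)"
proof -
  have "norm (y t) \<le> (norm (y 0) + \<delta> + e * t) * exp (M * t)" if \<delta>: "\<delta> > 0" for \<delta>
  proof -
    \<comment> \<open>A smooth substitute for the norm, which may fail to be differentiable where
      \<open>y\<close> vanishes; \<open>\<delta>\<close> tends to 0 at the end.\<close>
    define q where "q s = sqrt (y s \<bullet> y s + \<delta>\<^sup>2)" for s
    have pos: "y s \<bullet> y s + \<delta>\<^sup>2 > 0" for s using \<delta> by (simp add: add_nonneg_pos)
    have q: "q s > 0" "norm (y s) \<le> q s" "q s \<le> norm (y s) + \<delta>" for s
    proof -
      show "q s > 0" unfolding q_def using pos by simp
      show "norm (y s) \<le> q s" unfolding q_def norm_eq_sqrt_inner by simp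
      have "q s \<le> sqrt (y s \<bullet> y s) + sqrt (\<delta>\<^sup>2)" unfolding q_def by (rule sqrt_add_le_add_sqrt) auto
      then show "q s \<le> norm (y s) + \<delta>" using \<delta> by (simp add: norm_eq_sqrt_inner)
    qed
    define \<phi> where "\<phi> s = q s * exp (- M * s) - e * s" for s
    have "\<phi> t \<le> \<phi> 0"
    proof (rule DERIV_nonpos_imp_decreasing_open[OF t])
      show "continuous_on {0..t} \<phi>" unfolding \<phi>_def q_def using cont by (intro continuous_intros)
      fix s assume s: "0 < s" "s < t"
      have dy: "((\<lambda>s. y s \<bullet> y s + \<delta>\<^sup>2) has_real_derivative 2 * (y s \<bullet> y' s)) (at s)"
        using d[OF s] unfolding has_vector_derivative_def has_field_derivative_def
        by (auto intro!: derivative_eq_intros simp: inner_commute algebra_simps)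
      have dq: "(q has_real_derivative (y s \<bullet> y' s) / q s) (at s)"
        unfolding q_def[abs_def]
        by (rule derivative_eq_intros DERIV_real_sqrt_generic dy refl | use pos[of s] in \<open>force simp: field_simps\<close>)+
      have "(\<phi> has_real_derivative (y s \<bullet> y' s) / q s * exp (- M * s) + q s * (exp (- M * s) * - M) - e) (at s)"
        unfolding \<phi>_def[abs_def] by (auto intro!: derivative_eq_intros dq)
      moreover have "(y s \<bullet> y' s) / q s * exp (- M * s) + q s * (exp (- M * s) * - M) - e \<le> 0"
      proof -
        have "y s \<bullet> y' s \<le> norm (y s) * norm (y' s)" by (rule norm_cauchy_schwarz)
        also have "\<dots> \<le> q s * (M * q s + e)"
          using q[of s] le[OF s] M by (intro mult_mono) (auto intro: order_trans add_right_mono mult_left_mono)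
        finally have "(y s \<bullet> y' s) / q s \<le> M * q s + e" using q(1)[of s] by (simp add: divide_le_eq mult.commute)
        then have "(y s \<bullet> y' s) / q s * exp (- M * s) \<le> (M * q s + e) * exp (- M * s)" by (intro mult_right_mono) auto
        moreover have "e * exp (- M * s) \<le> e * 1" using e M s by (intro mult_left_mono) auto
        ultimately show ?thesis by (simp add: algebra_simps)
      qed
      ultimately show "\<exists>y. (\<phi> has_real_derivative y) (at s) \<and> y \<le> 0" by blast
    qed
    then have "q t * exp (- M * t) \<le> q 0 + e * t" by (simp add: \<phi>_def)
    then have "q t * exp (- M * t) * exp (M * t) \<le> (q 0 + e * t) * exp (M * t)" by (rule mult_right_mono) simp
    then have "q t \<le> (q 0 + e * t) * exp (M * t)" by (simp add: mult.assoc flip: exp_add)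
    also have "\<dots> \<le> (norm (y 0) + \<delta> + e * t) * exp (M * t)" using q(3)[of 0] by (intro mult_right_mono) auto
    finally show ?thesis using q(2)[of t] by linarith
  qed
  then have *: "norm (y t) \<le> (norm (y 0) + e * t) * exp (M * t) + \<delta> * exp (M * t)" if "\<delta> > 0" for \<delta>
    using that by (force simp: algebra_simps)
  show ?thesis
  proof (rule field_le_epsilon)
    fix \<epsilon> :: real assume "\<epsilon> > 0"
    then show "norm (y t) \<le> (norm (y 0) + e * t) * exp (M * t) + \<epsilon>"
      using *[of "\<epsilon> / exp (M * t)"] by simp
  qed
qed

text \<open>\<open>X\<close> will be \<open>closure \<Omega>\<close>, with \<open>N\<close> and
  \<open>A\<close> the gradient and the Hessian of \<open>H\<close>. These live on the whole plane,
  but the symmetry of \<open>A\<close> is asked for on \<open>X\<close> only, where the vanishing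
  divergence provides it.\<close>

locale planar_hamiltonian_flow =
  fixes X :: "(real^2) set" and H :: "real^2 \<Rightarrow> real" and N :: "real^2 \<Rightarrow> real^2"
    and A :: "real^2 \<Rightarrow> (real^2) \<Rightarrow>\<^sub>L (real^2)" and \<Phi> :: "real \<Rightarrow> real^2 \<Rightarrow> real^2"
  assumes compact_X: "compact X"
    and H_deriv: "\<And>x. (H has_derivative (\<lambda>h. N x \<bullet> h)) (at x)"
    and N_deriv: "\<And>x. (N has_derivative blinfun_apply (A x)) (at x)"
    and A_cont: "continuous_on UNIV A"
    and A_sym: "\<And>x u w. x \<in> X \<Longrightarrow> blinfun_apply (A x) u \<bullet> w = u \<bullet> blinfun_apply (A x) w"
    and flow_0: "\<And>x. x \<in> X \<Longrightarrow> \<Phi> 0 x = x"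
    and flow_in: "\<And>x t. x \<in> X \<Longrightarrow> \<Phi> t x \<in> X"
    and flow_deriv: "\<And>x t. x \<in> X \<Longrightarrow> ((\<lambda>s. \<Phi> s x) has_vector_derivative rot (N (\<Phi> t x))) (at t)"
begin

definition W :: "real^2 \<Rightarrow> real^2" where "W x = rot (N x)"

lemma norm_W [simp]: "norm (W x) = norm (N x)" by (simp add: W_def)

lemma N_continuous: "continuous_on S N"
  using N_deriv by (metis continuous_at_imp_continuous_on has_derivative_continuous)

lemma W_continuous: "continuous_on S W"
  unfolding W_def using N_continuous bounded_linear.continuous_on[OF bounded_linear_rot] by blast

lemma H_continuous: "continuous_on S H"
  using H_deriv by (metis continuous_at_imp_continuous_on has_derivative_continuous)

lemma flow_continuous: "x \<in> X \<Longrightarrow> continuous_on S (\<lambda>s. \<Phi> s x)"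
  using flow_deriv by (metis continuous_at_imp_continuous_on has_vector_derivative_continuous)

lemma flow_deriv_W: "x \<in> X \<Longrightarrow> ((\<lambda>s. \<Phi> s x) has_vector_derivative W (\<Phi> t x)) (at t)"
  using flow_deriv by (simp add: W_def)

lemma linearization_bound:
  assumes S: "convex S" "x \<in> S" "y \<in> S" and b: "\<And>z. z \<in> S \<Longrightarrow> norm (A z - A x) \<le> B"
  shows "norm (W y - W x - rot (A x (y - x))) \<le> B * norm (y - x)"
proof -
  have "norm (N y - N x - A x (y - x)) \<le> norm (y - x) * B"
  proof (rule differentiable_bound_linearization[where S = S and f' = "\<lambda>z. blinfun_apply (A z)"])
    show "x + t *\<^sub>R (y - x) \<in> S" if "t \<in> {0..1}" for t
    proof -
      have "(1 - t) *\<^sub>R x + t *\<^sub>R y \<in> S" using S that by (intro convexD) auto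
      then show ?thesis by (simp add: algebra_simps)
    qed
    show "onorm (blinfun_apply (A z) - blinfun_apply (A x)) \<le> B" if "z \<in> S" for z
      using b[OF that] by (simp add: norm_blinfun.rep_eq minus_blinfun.rep_eq fun_diff_def)
  qed (use S has_derivative_at_withinI[OF N_deriv] in auto)
  moreover have "W y - W x - rot (A x (y - x)) = rot (N y - N x - A x (y - x))" by (simp add: W_def)
  ultimately show ?thesis by (simp only: norm_rot mult.commute)
qed

lemma X_in_ball: obtains R where "R > 0" "X \<subseteq> cball 0 R"
  using compact_imp_bounded[OF compact_X] by (auto simp: bounded_pos subset_iff)

text \<open>\<open>X\<close> need not be convex, so the mean value estimate runs along segments in a
  ball containing \<open>X\<close>.\<close>

lemma W_lipschitz_ex:
  "\<exists>L>0. (\<forall>x\<in>X. norm (A x) \<le> L) \<and> (\<forall>x\<in>X. \<forall>y\<in>X. norm (W x - W y) \<le> L * norm (x - y))"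
proof -
  obtain R where R: "R > 0" "X \<subseteq> cball 0 R" by (rule X_in_ball)
  have "compact (A ` cball 0 R)" by (intro compact_continuous_image continuous_on_subset[OF A_cont]) auto
  then obtain B where B: "\<And>z. z \<in> cball 0 R \<Longrightarrow> norm (A z) \<le> B"
    using compact_imp_bounded bounded_iff by (metis image_eqI)
  have B0: "B \<ge> 0" using B[of 0] R norm_ge_zero by (metis centre_in_cball less_imp_le order_trans)
  have "norm (W x - W y) \<le> (3 * B) * norm (x - y)" if "x \<in> X" "y \<in> X" for x y
  proof -
    have "norm (W x - W y - rot (A y (x - y))) \<le> (2 * B) * norm (x - y)"
    proof (rule linearization_bound)
      fix z :: "real^2" assume "z \<in> cball 0 R"
      then have "norm (A z) \<le> B" "norm (A y) \<le> B" using B R that by auto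
      then show "norm (A z - A y) \<le> 2 * B" using norm_triangle_ineq4[of "A z" "A y"] by linarith
    qed (use R that in auto)
    moreover have "norm (rot (A y (x - y))) \<le> B * norm (x - y)"
    proof -
      have "norm (A y (x - y)) \<le> norm (A y) * norm (x - y)" by (rule norm_blinfun)
      also have "\<dots> \<le> B * norm (x - y)" using B[of y] R that by (intro mult_right_mono) auto
      finally show ?thesis by simp
    qed
    ultimately show ?thesis
      using norm_triangle_ineq[of "W x - W y - rot (A y (x - y))" "rot (A y (x - y))"] by simp
  qed
  moreover have "norm (A x) \<le> 3 * B + 1" if "x \<in> X" for x using B[of x] R that B0 by auto
  ultimately show ?thesis using B0
    by (intro exI[of _ "3 * B + 1"]) (auto simp: distrib_right intro!: add_increasing2)
qed

text \<open>Mentions neither the flow nor a curve, so it may enter the final constant and is the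
  same for all flows.\<close>

definition L :: real where
  "L = (SOME L. L > 0 \<and> (\<forall>x\<in>X. norm (A x) \<le> L) \<and> (\<forall>x\<in>X. \<forall>y\<in>X. norm (W x - W y) \<le> L * norm (x - y)))"

lemma L_pos: "L > 0"
  and norm_A_le: "x \<in> X \<Longrightarrow> norm (A x) \<le> L"
  and W_lipschitz: "x \<in> X \<Longrightarrow> y \<in> X \<Longrightarrow> norm (W x - W y) \<le> L * norm (x - y)"
  using someI_ex[OF W_lipschitz_ex] unfolding L_def[symmetric] by auto

text \<open>One \<open>d\<close> serves all base points, by uniform continuity of \<open>A\<close>
  on a ball; this allows two nearby orbits to be compared over a whole time interval.\<close>

lemma W_uniformly_differentiable:
  assumes "e > 0"
  shows "\<exists>d>0. \<forall>x\<in>X. \<forall>y\<in>X. norm (y - x) < d \<longrightarrow> norm (W y - W x - rot (A x (y - x))) \<le> e * norm (y - x)"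
proof -
  obtain R where R: "R > 0" "X \<subseteq> cball 0 R" by (rule X_in_ball)
  have "uniformly_continuous_on (cball 0 R) A"
    by (intro compact_uniformly_continuous continuous_on_subset[OF A_cont]) auto
  then obtain d where d: "d > 0" "\<And>x y. x \<in> cball 0 R \<Longrightarrow> y \<in> cball 0 R \<Longrightarrow> dist y x < d \<Longrightarrow> dist (A y) (A x) < e"
    using assms unfolding uniformly_continuous_on_def by metis
  have "norm (W y - W x - rot (A x (y - x))) \<le> e * norm (y - x)"
    if "x \<in> X" "y \<in> X" "norm (y - x) < d" for x y
  proof (rule linearization_bound[where S = "cball 0 R \<inter> ball x d"])
    show "norm (A z - A x) \<le> e" if "z \<in> cball 0 R \<inter> ball x d" for z
      using d(2)[of x z] that \<open>x \<in> X\<close> R by (auto simp: dist_norm dist_commute less_imp_le norm_minus_commute)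
  qed (use that R d in \<open>auto simp: dist_norm norm_minus_commute intro!: convex_Int\<close>)
  with d(1) show ?thesis by blast
qed

lemma flow_lipschitz:
  assumes "x \<in> X" "y \<in> X" "0 \<le> t"
  shows "norm (\<Phi> t x - \<Phi> t y) \<le> exp (L * t) * norm (x - y)"
proof -
  have "norm (\<Phi> t x - \<Phi> t y) \<le> (norm (\<Phi> 0 x - \<Phi> 0 y) + 0 * t) * exp (L * t)"
  proof (rule gronwall[where y' = "\<lambda>s. W (\<Phi> s x) - W (\<Phi> s y)"])
    show "continuous_on {0..t} (\<lambda>s. \<Phi> s x - \<Phi> s y)"
      using assms flow_continuous by (intro continuous_intros) auto
    show "((\<lambda>s. \<Phi> s x - \<Phi> s y) has_vector_derivative W (\<Phi> s x) - W (\<Phi> s y)) (at s)" for s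
      using assms by (intro derivative_intros flow_deriv_W)
    show "norm (W (\<Phi> s x) - W (\<Phi> s y)) \<le> L * norm (\<Phi> s x - \<Phi> s y) + 0" for s
      using assms by (simp add: W_lipschitz flow_in)
  qed (use L_pos assms in auto)
  then show ?thesis using assms by (simp add: flow_0 mult.commute)
qed

lemma flow_shift_deriv:
  assumes "x \<in> X"
  shows "((\<lambda>s. \<Phi> (s + t) x) has_vector_derivative W (\<Phi> (s + t) x)) (at s)"
proof -
  have "((\<lambda>s. \<Phi> s x) \<circ> (\<lambda>s. s + t) has_vector_derivative 1 *\<^sub>R W (\<Phi> (s + t) x)) (at s)"
    by (rule vector_diff_chain_at) (auto intro!: derivative_eq_intros flow_deriv_W assms)
  then show ?thesis by (simp add: o_def)
qed

lemma flow_reverse_deriv: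
  assumes "x \<in> X"
  shows "((\<lambda>s. \<Phi> (t - s) x) has_vector_derivative - W (\<Phi> (t - s) x)) (at s)"
proof -
  have "((\<lambda>s. \<Phi> s x) \<circ> (\<lambda>s. t - s) has_vector_derivative (-1) *\<^sub>R W (\<Phi> (t - s) x)) (at s)"
    by (rule vector_diff_chain_at) (auto intro!: derivative_eq_intros flow_deriv_W assms)
  then show ?thesis by (simp add: o_def)
qed

text \<open>Applied to shifted solutions it gives the composition law, to constants the rest at
  critical points, and to another flow the independence of all periods from the choice of the
  flow.\<close>

lemma solution_unique:
  assumes "x \<in> X" "0 \<le> t" "z 0 = x" "\<And>s. z s \<in> X"
    and d: "\<And>s. (z has_vector_derivative W (z s)) (at s)"
  shows "z t = \<Phi> t x"
proof -
  have "norm (z t - \<Phi> t x) \<le> (norm (z 0 - \<Phi> 0 x) + 0 * t) * exp (L * t)"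
  proof (rule gronwall[where y' = "\<lambda>s. W (z s) - W (\<Phi> s x)"])
    have "continuous_on {0..t} z"
      using d by (metis continuous_at_imp_continuous_on has_vector_derivative_continuous)
    then show "continuous_on {0..t} (\<lambda>s. z s - \<Phi> s x)"
      using assms flow_continuous by (intro continuous_intros) auto
    show "((\<lambda>s. z s - \<Phi> s x) has_vector_derivative W (z s) - W (\<Phi> s x)) (at s)" for s
      using assms by (intro derivative_intros flow_deriv_W)
    show "norm (W (z s) - W (\<Phi> s x)) \<le> L * norm (z s - \<Phi> s x) + 0" for s
      using assms by (simp add: W_lipschitz flow_in)
  qed (use L_pos assms in auto)
  then show ?thesis using assms by (simp add: flow_0)
qed

lemma flow_add:
  assumes "x \<in> X" "0 \<le> s"
  shows "\<Phi> (s + t) x = \<Phi> s (\<Phi> t x)"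
  using solution_unique[of "\<Phi> t x" s "\<lambda>s. \<Phi> (s + t) x"] assms flow_in flow_shift_deriv by simp

lemma H_flow:
  assumes "x \<in> X"
  shows "H (\<Phi> t x) = H x"
proof -
  have "((\<lambda>s. H (\<Phi> s x)) has_real_derivative 0) (at s)" for s
  proof -
    have "((\<lambda>s. H (\<Phi> s x)) has_derivative (\<lambda>h. N (\<Phi> s x) \<bullet> (h *\<^sub>R W (\<Phi> s x)))) (at s)"
      using has_derivative_compose[OF flow_deriv_W[OF assms, unfolded has_vector_derivative_def] H_deriv] .
    then show ?thesis by (simp add: W_def has_field_derivative_def lambda_zero)
  qed
  then have "H (\<Phi> t x) = H (\<Phi> 0 x)" by (intro DERIV_isconst_all) auto
  then show ?thesis using assms by (simp add: flow_0)
qed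

lemma flow_critical:
  assumes "x \<in> X" "N x = 0" "0 \<le> t"
  shows "\<Phi> t x = x"
  using solution_unique[of x t "\<lambda>_. x"] assms by (simp add: W_def)

text \<open>For \<open>t \<ge> 0\<close>, Gronwall run backwards from a supposed zero keeps the
  distance to it at 0, so the orbit would have started there. For negative \<open>t\<close>, the
  orbit starting at the zero rests, yet it arrives at \<open>x\<close>.\<close>

lemma flow_noncritical:
  assumes "x \<in> X" "N x \<noteq> 0"
  shows "N (\<Phi> t x) \<noteq> 0"
proof
  assume 0: "N (\<Phi> t x) = 0"
  show False
  proof (cases "t \<ge> 0")
    case True
    have "norm (\<Phi> (t - t) x - \<Phi> t x) \<le> (norm (\<Phi> (t - 0) x - \<Phi> t x) + 0 * t) * exp (L * t)"
    proof (rule gronwall[where y' = "\<lambda>s. - W (\<Phi> (t - s) x)"])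
      have d: "((\<lambda>s. \<Phi> (t - s) x - \<Phi> t x) has_vector_derivative - W (\<Phi> (t - s) x)) (at s)" for s
        using flow_reverse_deriv[OF assms(1), of t s] by (auto intro: derivative_eq_intros)
      then show "\<And>s. ((\<lambda>s. \<Phi> (t - s) x - \<Phi> t x) has_vector_derivative - W (\<Phi> (t - s) x)) (at s)" .
      show "continuous_on {0..t} (\<lambda>s. \<Phi> (t - s) x - \<Phi> t x)"
        using d by (metis continuous_at_imp_continuous_on has_vector_derivative_continuous)
      show "norm (- W (\<Phi> (t - s) x)) \<le> L * norm (\<Phi> (t - s) x - \<Phi> t x) + 0" for s
        using W_lipschitz[of "\<Phi> (t - s) x" "\<Phi> t x"] assms 0 by (simp add: flow_in W_def[of "\<Phi> t x"])
    qed (use L_pos True in auto)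
    then have "\<Phi> t x = x" using assms flow_0 by simp
    with 0 assms show False by simp
  next
    case False
    have "\<Phi> (- t + t) x = \<Phi> t x"
      using flow_add[OF assms(1), of "-t" t] flow_critical[OF flow_in[OF assms(1)] 0, of "- t"] False by simp
    with 0 assms show False by (simp add: flow_0)
  qed
qed

end

text \<open>With \<open>av = A (rot n)\<close> and \<open>an = A n\<close>, the hypothesis is the
  symmetry of \<open>A\<close>. The left side is the shear rate times the velocity plus the time
  derivative of \<open>N / |N|^2\<close>; equality is checked against \<open>n\<close> and
  \<open>rot n\<close>.\<close>

lemma frame_identity:
  assumes n: "n \<noteq> 0" and sym: "rot n \<bullet> an = n \<bullet> av"
  shows "((n \<bullet> an - rot n \<bullet> av) / norm n ^ 4) *\<^sub>R rot n + (- 2 * (n \<bullet> av) / norm n ^ 4) *\<^sub>R n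
     + (1 / (norm n)\<^sup>2) *\<^sub>R av = (1 / (norm n)\<^sup>2) *\<^sub>R rot an"
proof -
  define q where "q = (norm n)\<^sup>2"
  have q: "q > 0" "n \<bullet> n = q" using n by (auto simp: q_def power2_norm_eq_inner)
  have q4: "norm n ^ 4 = q * q" by (simp add: q_def power4_eq_xxxx power2_eq_square)
  have r: "n \<bullet> rot an = - (n \<bullet> av)" using sym rot_inner[of n an] by simp
  show ?thesis
    unfolding q4 q_def[symmetric]
  proof (rule rot_frame_eqI[OF n])
    show "n \<bullet> (((n \<bullet> an - rot n \<bullet> av) / (q * q)) *\<^sub>R rot n + (- 2 * (n \<bullet> av) / (q * q)) *\<^sub>R n
        + (1 / q) *\<^sub>R av) = n \<bullet> ((1 / q) *\<^sub>R rot an)"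
      using q(1) by (simp only: inner_add_right inner_scaleR_right q(2) r rot_inner_self) (simp add: field_simps)
    show "rot n \<bullet> (((n \<bullet> an - rot n \<bullet> av) / (q * q)) *\<^sub>R rot n + (- 2 * (n \<bullet> av) / (q * q)) *\<^sub>R n
        + (1 / q) *\<^sub>R av) = rot n \<bullet> ((1 / q) *\<^sub>R rot an)"
      using q(1) by (simp only: inner_add_right inner_scaleR_right q(2) rot_inner_rot rot_inner_self) (simp add: field_simps)
  qed
qed

section \<open>The derivative of the flow at non-critical points\<close>

context planar_hamiltonian_flow
begin

text \<open>The variational equation \<open>y' = DW(\<Phi> t x) y\<close> is solved by reduction of order in the moving
  frame \<open>W\<close>, \<open>N / |N|\<^sup>2\<close>: the component of \<open>y\<close> along \<open>N\<close> is determined by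
  conservation of \<open>H\<close>, and the remaining component is found by integrating \<open>shear_rate\<close>.\<close>

definition shear_rate :: "real^2 \<Rightarrow> real \<Rightarrow> real" where
  "shear_rate x t =
     (N (\<Phi> t x) \<bullet> A (\<Phi> t x) (N (\<Phi> t x)) - W (\<Phi> t x) \<bullet> A (\<Phi> t x) (W (\<Phi> t x))) / norm (N (\<Phi> t x)) ^ 4"

definition shear :: "real^2 \<Rightarrow> real \<Rightarrow> real" where
  "shear x t = integral {0..t} (shear_rate x)"

text \<open>The candidate for the derivative of \<open>\<Phi> t\<close> at \<open>x\<close> in
  direction \<open>h\<close>. The factor \<open>N x \<bullet> h\<close> does not change with time:
  it is the change of \<open>H\<close> to first order, which the flow preserves.\<close>

definition tangent_flow :: "real^2 \<Rightarrow> real \<Rightarrow> real^2 \<Rightarrow> real^2" where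
  "tangent_flow x t h =
     ((W x \<bullet> h) / (norm (N x))\<^sup>2 + (N x \<bullet> h) * shear x t) *\<^sub>R W (\<Phi> t x)
     + ((N x \<bullet> h) / (norm (N (\<Phi> t x)))\<^sup>2) *\<^sub>R N (\<Phi> t x)"

lemma N_flow_deriv:
  assumes "x \<in> X"
  shows "((\<lambda>s. N (\<Phi> s x)) has_vector_derivative A (\<Phi> t x) (W (\<Phi> t x))) (at t)"
proof -
  have "((\<lambda>s. N (\<Phi> s x)) has_derivative (\<lambda>h. A (\<Phi> t x) (h *\<^sub>R W (\<Phi> t x)))) (at t)"
    using has_derivative_compose[OF flow_deriv_W[OF assms, unfolded has_vector_derivative_def] N_deriv] .
  then show ?thesis by (simp add: has_vector_derivative_def blinfun.scaleR_right)
qed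

lemma W_flow_deriv:
  assumes "x \<in> X"
  shows "((\<lambda>s. W (\<Phi> s x)) has_vector_derivative rot (A (\<Phi> t x) (W (\<Phi> t x)))) (at t)"
  using bounded_linear.has_vector_derivative[OF bounded_linear_rot N_flow_deriv[OF assms]]
  by (simp add: W_def)

lemma shear_rate_continuous:
  assumes "x \<in> X" "N x \<noteq> 0"
  shows "continuous_on S (shear_rate x)"
proof -
  have "continuous_on S (\<lambda>t. A (\<Phi> t x))"
    by (rule continuous_on_compose2[OF A_cont flow_continuous[OF assms(1)]]) auto
  moreover have "continuous_on S (\<lambda>t. N (\<Phi> t x))" "continuous_on S (\<lambda>t. W (\<Phi> t x))"
    by (rule continuous_on_compose2[OF N_continuous flow_continuous[OF assms(1)]]
             continuous_on_compose2[OF W_continuous flow_continuous[OF assms(1)]], blast)+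
  ultimately show ?thesis
    unfolding shear_rate_def[abs_def] using flow_noncritical[OF assms] by (intro continuous_intros) auto
qed

lemma shear_deriv:
  assumes "x \<in> X" "N x \<noteq> 0" "0 < s"
  shows "(shear x has_real_derivative shear_rate x s) (at s)"
proof -
  have "((\<lambda>u. integral {0..u} (shear_rate x)) has_vector_derivative shear_rate x s) (at s within {0..s + 1})"
    using assms by (intro integral_has_vector_derivative shear_rate_continuous) auto
  moreover have "at s within {0..s + 1} = at s" using assms by (simp add: at_within_Icc_at)
  ultimately show ?thesis
    by (simp add: shear_def[abs_def] has_real_derivative_iff_has_vector_derivative)
qed

lemma shear_continuous:
  assumes "x \<in> X" "N x \<noteq> 0"
  shows "continuous_on {0..t} (shear x)"
  unfolding shear_def[abs_def]
  by (intro indefinite_integral_continuous_1 integrable_continuous_real shear_rate_continuous assms)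

lemma inv_norm_sq_flow_deriv:
  assumes "x \<in> X" "N x \<noteq> 0"
  shows "((\<lambda>s. 1 / (norm (N (\<Phi> s x)))\<^sup>2) has_real_derivative
    - 2 * (N (\<Phi> s x) \<bullet> A (\<Phi> s x) (W (\<Phi> s x))) / norm (N (\<Phi> s x)) ^ 4) (at s)"
proof -
  have n: "N (\<Phi> s x) \<bullet> N (\<Phi> s x) \<noteq> 0" using flow_noncritical[OF assms] by simp
  have d: "((\<lambda>s. N (\<Phi> s x) \<bullet> N (\<Phi> s x)) has_real_derivative
      2 * (N (\<Phi> s x) \<bullet> A (\<Phi> s x) (W (\<Phi> s x)))) (at s)"
    using N_flow_deriv[OF assms(1), of s] unfolding has_vector_derivative_def has_field_derivative_def
    by (auto intro!: derivative_eq_intros simp: inner_commute algebra_simps)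
  have "((\<lambda>s. 1 / (N (\<Phi> s x) \<bullet> N (\<Phi> s x))) has_real_derivative
    (0 * (N (\<Phi> s x) \<bullet> N (\<Phi> s x)) - 1 * (2 * (N (\<Phi> s x) \<bullet> A (\<Phi> s x) (W (\<Phi> s x)))))
      / ((N (\<Phi> s x) \<bullet> N (\<Phi> s x)) * (N (\<Phi> s x) \<bullet> N (\<Phi> s x)))) (at s)"
    by (intro DERIV_divide DERIV_const d n)
  then show ?thesis
    by (simp add: power2_norm_eq_inner power4_eq_xxxx flip: power2_norm_eq_inner)
qed

text \<open>The frame vector \<open>W\<close> itself solves the variational equation; the terms with
  factor \<open>N x \<bullet> h\<close> are matched by \<open>frame_identity\<close>.\<close>

lemma tangent_flow_deriv:
  assumes "x \<in> X" "N x \<noteq> 0" "0 < s"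
  shows "((\<lambda>s. tangent_flow x s h) has_vector_derivative
           rot (A (\<Phi> s x) (tangent_flow x s h))) (at s)"
proof -
  let ?n = "N (\<Phi> s x)" and ?v = "W (\<Phi> s x)" and ?a = "blinfun_apply (A (\<Phi> s x))"
  let ?b = "N x \<bullet> h" and ?\<beta> = "(W x \<bullet> h) / (norm (N x))\<^sup>2"
  have n0: "?n \<noteq> 0" using assms flow_noncritical by simp
  let ?q = "(norm ?n)\<^sup>2"
  let ?D = "(?\<beta> + ?b * shear x s) *\<^sub>R rot (?a ?v) + (?b * shear_rate x s) *\<^sub>R ?v
     + (?b * (- 2 * (?n \<bullet> ?a ?v) / norm ?n ^ 4)) *\<^sub>R ?n + (?b * (1 / ?q)) *\<^sub>R ?a ?v"
  have "((\<lambda>s. (?\<beta> + ?b * shear x s) *\<^sub>R W (\<Phi> s x) + (?b * (1 / (norm (N (\<Phi> s x)))\<^sup>2)) *\<^sub>R N (\<Phi> s x))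
      has_vector_derivative ?D) (at s)"
  proof -
    have d1: "((\<lambda>s. ?\<beta> + ?b * shear x s) has_real_derivative ?b * shear_rate x s) (at s)"
      by (auto intro!: derivative_eq_intros shear_deriv[OF assms])
    have d2: "((\<lambda>s. ?b * (1 / (norm (N (\<Phi> s x)))\<^sup>2)) has_real_derivative
        ?b * (- 2 * (?n \<bullet> ?a ?v) / norm ?n ^ 4)) (at s)"
      by (rule DERIV_cmult[OF inv_norm_sq_flow_deriv[OF assms(1,2)]])
    show ?thesis
      by (rule has_vector_derivative_eq_rhs[OF has_vector_derivative_add[OF
            has_vector_derivative_scaleR[OF d1 W_flow_deriv[OF assms(1)]]
            has_vector_derivative_scaleR[OF d2 N_flow_deriv[OF assms(1)]]]])
        (simp only: add_ac)
  qed
  moreover have "?D = rot (?a (tangent_flow x s h))"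
  proof -
    have "?b *\<^sub>R (shear_rate x s *\<^sub>R ?v + (- 2 * (?n \<bullet> ?a ?v) / norm ?n ^ 4) *\<^sub>R ?n + (1 / ?q) *\<^sub>R ?a ?v)
        = ?b *\<^sub>R rot (?a ((1 / ?q) *\<^sub>R ?n))" (is "_ *\<^sub>R ?l = _ *\<^sub>R ?r")
    proof -
      have "rot ?n \<bullet> ?a ?n = ?n \<bullet> ?a ?v"
        using A_sym[OF flow_in[OF assms(1), of s], of ?v ?n] by (simp add: inner_commute W_def)
      from frame_identity[OF n0 this] have "?l = ?r"
        by (simp add: shear_rate_def W_def blinfun.scaleR_right)
      then show ?thesis by simp
    qed
    then show ?thesis
      by (simp add: tangent_flow_def blinfun.add_right blinfun.scaleR_right algebra_simps)
  qed
  ultimately show ?thesis by (simp add: tangent_flow_def[abs_def])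
qed

lemma tangent_flow_continuous:
  assumes "x \<in> X" "N x \<noteq> 0"
  shows "continuous_on {0..t} (\<lambda>s. tangent_flow x s h)"
proof -
  have "continuous_on {0..t} (\<lambda>t. N (\<Phi> t x))" "continuous_on {0..t} (\<lambda>t. W (\<Phi> t x))"
    by (rule continuous_on_compose2[OF N_continuous flow_continuous[OF assms(1)]]
             continuous_on_compose2[OF W_continuous flow_continuous[OF assms(1)]], blast)+
  then show ?thesis
    unfolding tangent_flow_def using shear_continuous[OF assms] flow_noncritical[OF assms]
    by (intro continuous_intros) auto
qed

lemma tangent_flow_0:
  assumes "x \<in> X" "N x \<noteq> 0"
  shows "tangent_flow x 0 h = h"
proof -
  have "tangent_flow x 0 h = (1 / (norm (N x))\<^sup>2) *\<^sub>R ((N x \<bullet> h) *\<^sub>R N x + (W x \<bullet> h) *\<^sub>R W x)"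
    using assms by (simp add: tangent_flow_def flow_0 shear_def algebra_simps)
  also have "\<dots> = h" using rot_decomp[of "N x" h] assms(2) by (simp add: W_def flip: rot_decomp)
  finally show ?thesis .
qed

lemma tangent_flow_linear: "bounded_linear (tangent_flow x t)"
  unfolding tangent_flow_def[abs_def]
  by (intro bounded_linear_add bounded_linear_scaleR_left[THEN bounded_linear_compose] 
        bounded_linear_const_mult bounded_linear_mult_const bounded_linear_divide[THEN bounded_linear_compose] bounded_linear_inner_right)

text \<open>The bound \<open>M\<close> is taken along the orbit instead of the global
  \<open>L\<close>, because near a critical point only the product of such an \<open>M\<close> with
  the period stays bounded.\<close>

lemma tangent_flow_norm_le:
  assumes x: "x \<in> X" "N x \<noteq> 0" and t: "0 \<le> t" and M: "\<And>s. 0 \<le> s \<Longrightarrow> s \<le> t \<Longrightarrow> norm (A (\<Phi> s x)) \<le> M"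
  shows "norm (tangent_flow x t h) \<le> exp (M * t) * norm h"
proof -
  have M0: "0 \<le> M" using M[of 0] t norm_ge_zero order_trans by blast
  have "norm (tangent_flow x t h) \<le> (norm (tangent_flow x 0 h) + 0 * t) * exp (M * t)"
  proof (rule gronwall[OF t M0 _ tangent_flow_continuous[OF x] tangent_flow_deriv[OF x]])
    fix s assume s: "0 < s" "s < t"
    have "norm (A (\<Phi> s x) (tangent_flow x s h)) \<le> norm (A (\<Phi> s x)) * norm (tangent_flow x s h)"
      by (rule norm_blinfun)
    also have "\<dots> \<le> M * norm (tangent_flow x s h)" using M s by (intro mult_right_mono) auto
    finally show "norm (rot (A (\<Phi> s x) (tangent_flow x s h))) \<le> M * norm (tangent_flow x s h) + 0" by simp
  qed auto
  then show ?thesis using x by (simp add: tangent_flow_0 mult.commute)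
qed

lemma tangent_flow_W:
  assumes "x \<in> X" "N x \<noteq> 0"
  shows "tangent_flow x t (W x) = W (\<Phi> t x)"
  using assms by (simp add: tangent_flow_def W_def power2_norm_eq_inner)

text \<open>The remainder solves the variational equation up to the linearization error of
  \<open>W\<close> along two neighbouring orbits. That error is uniformly small relative to their
  distance, hence relative to \<open>y - x\<close>, and Gronwall transfers this to the
  remainder.\<close>

theorem flow_has_derivative:
  assumes x: "x \<in> X" "N x \<noteq> 0" and t: "0 \<le> t"
  shows "(\<Phi> t has_derivative tangent_flow x t) (at x within X)"
  unfolding has_derivative_within_alt
proof (intro conjI allI impI tangent_flow_linear)
  fix e :: real assume e: "e > 0"
  \<comment> \<open>One factor \<open>exp (L * t)\<close> comes from the spreading of the orbits,
    the other from Gronwall; \<open>t + 1\<close> covers the integration time and is positive even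
    for \<open>t = 0\<close>.\<close>
  define \<eta> where "\<eta> = e / (exp (L * t) * exp (L * t) * (t + 1))"
  have \<eta>: "\<eta> > 0" using e t by (simp add: \<eta>_def)
  obtain d where d: "d > 0" "\<And>x y. x \<in> X \<Longrightarrow> y \<in> X \<Longrightarrow> norm (y - x) < d \<Longrightarrow>
      norm (W y - W x - rot (A x (y - x))) \<le> \<eta> * norm (y - x)"
    using W_uniformly_differentiable[OF \<eta>] by blast
  show "\<exists>d>0. \<forall>y\<in>X. norm (y - x) < d \<longrightarrow> norm (\<Phi> t y - \<Phi> t x - tangent_flow x t (y - x)) \<le> e * norm (y - x)"
  proof (intro exI[of _ "d / exp (L * t)"] conjI ballI impI)
    \<comment> \<open>With this radius the two orbits stay closer than \<open>d\<close> up to time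
      \<open>t\<close>.\<close>
    show "d / exp (L * t) > 0" using d by simp
    fix y assume y: "y \<in> X" "norm (y - x) < d / exp (L * t)"
    let ?h = "y - x"
    let ?z = "\<lambda>s. \<Phi> s y - \<Phi> s x - tangent_flow x s ?h"
    have grow: "norm (\<Phi> s y - \<Phi> s x) \<le> exp (L * t) * norm ?h" if "0 \<le> s" "s \<le> t" for s
    proof -
      have "norm (\<Phi> s y - \<Phi> s x) \<le> exp (L * s) * norm ?h" by (rule flow_lipschitz[OF y(1) x(1) that(1)])
      also have "\<dots> \<le> exp (L * t) * norm ?h" using that L_pos by (intro mult_right_mono) auto
      finally show ?thesis .
    qed
    have "norm (?z t) \<le> (norm (?z 0) + \<eta> * (exp (L * t) * norm ?h) * t) * exp (L * t)"
    proof (rule gronwall[where y' = "\<lambda>s. W (\<Phi> s y) - W (\<Phi> s x) - rot (A (\<Phi> s x) (tangent_flow x s ?h))"])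
      show "continuous_on {0..t} ?z"
        using x y tangent_flow_continuous flow_continuous by (intro continuous_intros) auto
      fix s assume s: "0 < s" "s < t"
      show "(?z has_vector_derivative W (\<Phi> s y) - W (\<Phi> s x) - rot (A (\<Phi> s x) (tangent_flow x s ?h))) (at s)"
        using x y s by (intro derivative_intros flow_deriv_W tangent_flow_deriv)
      have "norm (\<Phi> s y - \<Phi> s x) < d"
      proof -
        have "norm (\<Phi> s y - \<Phi> s x) \<le> exp (L * t) * norm ?h" using grow s by simp
        also have "\<dots> < d" using y(2) by (simp add: pos_less_divide_eq mult.commute)
        finally show ?thesis .
      qed
      then have "norm (W (\<Phi> s y) - W (\<Phi> s x) - rot (A (\<Phi> s x) (\<Phi> s y - \<Phi> s x))) \<le> \<eta> * norm (\<Phi> s y - \<Phi> s x)"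
        using d(2) flow_in x y by simp
      also have "\<dots> \<le> \<eta> * (exp (L * t) * norm ?h)" using grow s \<eta> by (intro mult_left_mono) auto
      finally have 1: "norm (W (\<Phi> s y) - W (\<Phi> s x) - rot (A (\<Phi> s x) (\<Phi> s y - \<Phi> s x))) \<le> \<eta> * (exp (L * t) * norm ?h)" .
      have 2: "norm (rot (A (\<Phi> s x) (?z s))) \<le> L * norm (?z s)"
      proof -
        have "norm (A (\<Phi> s x) (?z s)) \<le> norm (A (\<Phi> s x)) * norm (?z s)" by (rule norm_blinfun)
        also have "\<dots> \<le> L * norm (?z s)" using norm_A_le flow_in x by (intro mult_right_mono) auto
        finally show ?thesis by simp
      qed
      have "W (\<Phi> s y) - W (\<Phi> s x) - rot (A (\<Phi> s x) (tangent_flow x s ?h))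
        = (W (\<Phi> s y) - W (\<Phi> s x) - rot (A (\<Phi> s x) (\<Phi> s y - \<Phi> s x))) + rot (A (\<Phi> s x) (?z s))"
        by (simp add: blinfun.diff_right)
      then show "norm (W (\<Phi> s y) - W (\<Phi> s x) - rot (A (\<Phi> s x) (tangent_flow x s ?h)))
          \<le> L * norm (?z s) + \<eta> * (exp (L * t) * norm ?h)"
        by (simp only:) (rule norm_triangle_le, use 1 2 in linarith)
    qed (use t L_pos \<eta> in auto)
    also have "\<dots> = \<eta> * (exp (L * t) * exp (L * t) * t) * norm ?h"
      using x y by (simp add: flow_0 tangent_flow_0)
    also have "\<dots> \<le> \<eta> * (exp (L * t) * exp (L * t) * (t + 1)) * norm ?h"
      using \<eta> t by (intro mult_right_mono mult_left_mono) auto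
    also have "\<dots> = e * norm ?h" using t by (simp add: \<eta>_def)
    finally show "norm (?z t) \<le> e * norm (y - x)" .
  qed
qed

end


section \<open>Periods\<close>

context planar_hamiltonian_flow
begin

definition is_period :: "real^2 \<Rightarrow> real \<Rightarrow> bool" where
  "is_period x T \<longleftrightarrow> 0 < T \<and> \<Phi> T x = x \<and> (\<forall>t. 0 < t \<and> t < T \<longrightarrow> \<Phi> t x \<noteq> x)"

text \<open>Since \<open>rot\<close> preserves inner products, all velocities in this ball have a
  positive component along \<open>W x\<close>, so the line through \<open>x\<close> in direction
  \<open>N x\<close> is a local section of the flow.\<close>

lemma transversal_ball:
  assumes "N x \<noteq> 0"
  obtains \<rho> where "\<rho> > 0" "\<And>y. norm (y - x) < \<rho> \<Longrightarrow> N y \<bullet> N x > 0"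
proof -
  have "open {y. N y \<bullet> N x > 0}"
    using N_continuous by (intro open_Collect_less continuous_intros) auto
  moreover have "x \<in> {y. N y \<bullet> N x > 0}" using assms by simp
  ultimately obtain \<rho> where "\<rho> > 0" "ball x \<rho> \<subseteq> {y. N y \<bullet> N x > 0}" using open_contains_ball by blast
  then show thesis using that[of \<rho>] by (auto simp: dist_norm norm_minus_commute subset_iff)
qed

lemma flow_advances:
  assumes y: "y \<in> X" and ab: "a < b" and pos: "\<And>s. a \<le> s \<Longrightarrow> s \<le> b \<Longrightarrow> N (\<Phi> s y) \<bullet> N x > 0"
  shows "\<Phi> a y \<bullet> W x < \<Phi> b y \<bullet> W x"
proof (rule DERIV_pos_imp_increasing[OF ab])
  fix s assume "a \<le> s" "s \<le> b"
  then have "W (\<Phi> s y) \<bullet> W x > 0" using pos by (simp add: W_def)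
  moreover have "((\<lambda>s. \<Phi> s y \<bullet> W x) has_real_derivative W (\<Phi> s y) \<bullet> W x) (at s)"
    using flow_deriv_W[OF y, of s] unfolding has_vector_derivative_def has_field_derivative_def
    by (auto intro!: derivative_eq_intros simp: mult.commute[of _ "W (\<Phi> s y) \<bullet> W x"])
  ultimately show "\<exists>y'. ((\<lambda>s. \<Phi> s y \<bullet> W x) has_real_derivative y') (at s) \<and> y' > 0" by blast
qed

text \<open>The difference \<open>y2 - y1\<close> is a multiple of \<open>N x\<close>, and along the
  segment between the points \<open>H\<close> is strictly monotone in that direction.\<close>

lemma section_injective:
  assumes "N x \<noteq> 0" and \<rho>: "\<And>y. norm (y - x) < \<rho> \<Longrightarrow> N y \<bullet> N x > 0"
    and y: "norm (y1 - x) < \<rho>" "norm (y2 - x) < \<rho>" and W: "(y2 - y1) \<bullet> W x = 0" and H: "H y1 = H y2"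
  shows "y1 = y2"
proof -
  define k where "k = (N x \<bullet> (y2 - y1)) / (norm (N x))\<^sup>2"
  have "(norm (N x))\<^sup>2 *\<^sub>R (y2 - y1) = (N x \<bullet> (y2 - y1)) *\<^sub>R N x"
    using rot_decomp[of "N x" "y2 - y1"] W by (simp add: W_def inner_commute)
  then have k: "y2 - y1 = k *\<^sub>R N x"
  proof -
    assume *: "(norm (N x))\<^sup>2 *\<^sub>R (y2 - y1) = (N x \<bullet> (y2 - y1)) *\<^sub>R N x"
    have "y2 - y1 = (1 / (norm (N x))\<^sup>2) *\<^sub>R ((norm (N x))\<^sup>2 *\<^sub>R (y2 - y1))" using assms(1) by simp
    then show ?thesis unfolding * by (simp add: k_def)
  qed
  obtain z where z: "z \<in> closed_segment y1 y2" "H y2 - H y1 = N z \<bullet> (y2 - y1)"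
  proof -
    obtain s where s: "0 < s" "s < 1" "H (y1 + 1 *\<^sub>R (y2 - y1)) - H (y1 + 0 *\<^sub>R (y2 - y1)) = N (y1 + s *\<^sub>R (y2 - y1)) \<bullet> (y2 - y1) * (1 - 0)"
    proof -
      have d: "((\<lambda>s. H (y1 + s *\<^sub>R (y2 - y1))) has_real_derivative N (y1 + s *\<^sub>R (y2 - y1)) \<bullet> (y2 - y1)) (at s)" for s
      proof -
        have "((\<lambda>s. y1 + s *\<^sub>R (y2 - y1)) has_derivative (\<lambda>h. h *\<^sub>R (y2 - y1))) (at s)"
          by (auto intro!: derivative_eq_intros)
        from has_derivative_compose[OF this H_deriv] show ?thesis
          by (simp add: has_field_derivative_def mult.commute[of _ "_ \<bullet> _"])
      qed
      from MVT2[of 0 1, OF _ d] show thesis using that by (auto simp: mult.commute)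
    qed
    have "y1 + s *\<^sub>R (y2 - y1) \<in> closed_segment y1 y2"
      using s by (auto simp: closed_segment_def algebra_simps intro!: exI[of _ s])
    then show thesis using s that by simp
  qed
  have "closed_segment y1 y2 \<subseteq> ball x \<rho>"
    using y by (intro closed_segment_subset) (auto simp: dist_norm norm_minus_commute)
  then have "N z \<bullet> N x > 0" using \<rho>[of z] z(1) by (auto simp: dist_norm norm_minus_commute)
  moreover have "k * (N z \<bullet> N x) = 0" using z(2) H k by simp
  ultimately show ?thesis using k by simp
qed

lemma is_period_noncritical:
  assumes "x \<in> X" "is_period x T"
  shows "N x \<noteq> 0"
proof
  assume "N x = 0"
  then have "\<Phi> (T / 2) x = x" using assms by (intro flow_critical) (auto simp: is_period_def)
  moreover have "0 < T / 2" "T / 2 < T" using assms(2) by (auto simp: is_period_def)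
  ultimately show False using assms(2) unfolding is_period_def by blast
qed

lemma no_small_return:
  assumes x: "x \<in> X" "N x \<noteq> 0"
  obtains \<epsilon> where "\<epsilon> > 0" "\<And>t. 0 < t \<Longrightarrow> t \<le> \<epsilon> \<Longrightarrow> \<Phi> t x \<noteq> x"
proof -
  obtain \<rho> where \<rho>: "\<rho> > 0" "\<And>y. norm (y - x) < \<rho> \<Longrightarrow> N y \<bullet> N x > 0" using transversal_ball[OF x(2)] by metis
  have "isCont (\<lambda>s. \<Phi> s x) 0" using flow_continuous[OF x(1), of UNIV] by (simp add: continuous_on_eq_continuous_at)
  then obtain \<delta> where \<delta>: "\<delta> > 0" "\<And>s. \<bar>s\<bar> < \<delta> \<Longrightarrow> norm (\<Phi> s x - x) < \<rho>"
    using \<rho>(1) flow_0[OF x(1)] unfolding continuous_at_eps_delta by (metis dist_norm dist_real_def diff_zero)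
  show thesis
  proof (rule that[of "\<delta> / 2"])
    fix t assume t: "0 < t" "t \<le> \<delta> / 2"
    have "\<Phi> 0 x \<bullet> W x < \<Phi> t x \<bullet> W x" using t \<delta> \<rho>(2) by (intro flow_advances[OF x(1)]) auto
    then show "\<Phi> t x \<noteq> x" using flow_0[OF x(1)] by auto
  qed (use \<delta> in simp)
qed

lemma is_period_exists:
  assumes x: "x \<in> X" "N x \<noteq> 0" and t: "0 < t" "\<Phi> t x = x"
  obtains T where "is_period x T" "T \<le> t"
proof -
  obtain \<epsilon> where \<epsilon>: "\<epsilon> > 0" "\<And>t. 0 < t \<Longrightarrow> t \<le> \<epsilon> \<Longrightarrow> \<Phi> t x \<noteq> x" using no_small_return[OF x] by metis
  define S where "S = {s\<in>{\<epsilon>..}. \<Phi> s x = x}"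
  have "closed S" unfolding S_def
    using flow_continuous[OF x(1)] by (intro continuous_closed_preimage_constant) auto
  moreover have tS: "t \<in> S" using t \<epsilon> by (force simp: S_def not_le[symmetric])
  moreover have bdd: "bdd_below S" by (auto simp: S_def)
  ultimately have inf: "Inf S \<in> S" by (intro closed_contains_Inf) auto
  show thesis
  proof (rule that[of "Inf S"])
    show "Inf S \<le> t" using tS bdd by (rule cInf_lower)
    show "is_period x (Inf S)" unfolding is_period_def
    proof (intro conjI allI impI)
      fix s assume s: "0 < s \<and> s < Inf S"
      show "\<Phi> s x \<noteq> x"
      proof
        assume "\<Phi> s x = x"
        then have "s \<in> S" using s \<epsilon> by (force simp: S_def not_le[symmetric])
        then show False using cInf_lower[OF _ bdd] s by force
      qed
    qed (use inf \<epsilon> in \<open>auto simp: S_def\<close>)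
  qed
qed

lemma orbit_period_eq:
  assumes "is_period x T"
  shows "orbit_period \<Phi> x = ereal T"
  unfolding orbit_period_def
proof (rule antisym)
  show "Inf (ereal ` {t. 0 < t \<and> \<Phi> t x = x}) \<le> ereal T"
    using assms by (intro Inf_lower) (auto simp: is_period_def)
  show "ereal T \<le> Inf (ereal ` {t. 0 < t \<and> \<Phi> t x = x})"
  proof (rule Inf_greatest, clarsimp)
    fix t assume "0 < t" "\<Phi> t x = x"
    then show "T \<le> t" using assms unfolding is_period_def by (meson not_le)
  qed
qed

text \<open>Every positive time is a return time, so equilibria count neither as periodic nor as
  non-periodic points.\<close>

lemma orbit_period_critical:
  assumes "x \<in> X" "N x = 0"
  shows "orbit_period \<Phi> x = 0"
proof (rule antisym)
  show "orbit_period \<Phi> x \<le> 0"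
  proof (rule ereal_le_epsilon2, clarsimp)
    fix e :: real assume "e > 0"
    then show "orbit_period \<Phi> x \<le> ereal e"
      unfolding orbit_period_def using flow_critical[OF assms] by (intro Inf_lower) auto
  qed
  show "0 \<le> orbit_period \<Phi> x"
    unfolding orbit_period_def by (intro Inf_greatest) auto
qed

lemma orbit_period_finite_cases:
  assumes "x \<in> X" "orbit_period \<Phi> x \<noteq> \<infinity>" "N x \<noteq> 0"
  obtains T where "is_period x T"
proof -
  have "{t. 0 < t \<and> \<Phi> t x = x} \<noteq> {}"
  proof
    assume "{t. 0 < t \<and> \<Phi> t x = x} = {}"
    then have "orbit_period \<Phi> x = Inf (ereal ` {})" unfolding orbit_period_def by (simp only:)
    then show False using assms(2) by (simp add: top_ereal_def)
  qed
  then show thesis using is_period_exists[OF assms(1,3)] that by blast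
qed

lemma orbit_period_pos_finite_iff:
  assumes "x \<in> X"
  shows "0 < orbit_period \<Phi> x \<and> orbit_period \<Phi> x < \<infinity> \<longleftrightarrow> (\<exists>T. is_period x T)"
proof
  assume *: "0 < orbit_period \<Phi> x \<and> orbit_period \<Phi> x < \<infinity>"
  then have "N x \<noteq> 0" using orbit_period_critical[OF assms] by auto
  then obtain T where "is_period x T"
    using orbit_period_finite_cases[OF assms] * by (metis less_irrefl)
  then show "\<exists>T. is_period x T" ..
qed (auto simp: orbit_period_eq is_period_def)

text \<open>The displacement of \<open>y\<close> along \<open>W x\<close> changes sign near time
  \<open>T\<close>. At its zero the orbit meets the section through \<open>y\<close> on the level of
  \<open>y\<close>, which is an exact return. An earlier return is impossible: for short times the
  flow advances, and in between the orbit of \<open>x\<close> keeps away from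
  \<open>x\<close>.\<close>

theorem period_near:
  assumes x: "x \<in> X" and T: "is_period x T" and \<epsilon>: "\<epsilon> > 0"
  shows "\<exists>d>0. \<forall>y\<in>X. norm (y - x) < d \<longrightarrow> (\<exists>T'. is_period y T' \<and> \<bar>T' - T\<bar> < \<epsilon>)"
proof -
  have Nx: "N x \<noteq> 0" using is_period_noncritical[OF x T] .
  have T0: "T > 0" "\<Phi> T x = x" using T by (auto simp: is_period_def)
  obtain \<rho> where \<rho>: "\<rho> > 0" "\<And>y. norm (y - x) < \<rho> \<Longrightarrow> N y \<bullet> N x > 0" using transversal_ball[OF Nx] by metis
  have cont: "isCont (\<lambda>s. \<Phi> s x) u" for u
    using flow_continuous[OF x, of UNIV] by (simp add: continuous_on_eq_continuous_at)
  obtain \<delta>0 where \<delta>0: "\<delta>0 > 0" "\<And>s. \<bar>s\<bar> < \<delta>0 \<Longrightarrow> norm (\<Phi> s x - x) < \<rho> / 2"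
    using cont[of 0] \<rho>(1) flow_0[OF x] unfolding continuous_at_eps_delta
    by (metis dist_norm dist_real_def diff_zero half_gt_zero)
  obtain \<delta>1 where \<delta>1: "\<delta>1 > 0" "\<And>s. \<bar>s - T\<bar> < \<delta>1 \<Longrightarrow> norm (\<Phi> s x - x) < \<rho> / 2"
    using cont[of T] \<rho>(1) T0 unfolding continuous_at_eps_delta
    by (metis dist_norm dist_real_def half_gt_zero)
  define e where "e = min (min (\<delta>0 / 2) (\<delta>1 / 2)) (min \<epsilon> (T / 3))"
  have e: "e > 0" "e < \<delta>0" "e < \<delta>1" "e \<le> \<epsilon>" "e < T - e" using \<delta>0 \<delta>1 \<epsilon> T0 by (auto simp: e_def min_def)
  have near0: "norm (\<Phi> s x - x) < \<rho> / 2" if "0 \<le> s" "s \<le> e" for s using that e by (intro \<delta>0) auto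
  have nearT: "norm (\<Phi> s x - x) < \<rho> / 2" if "T - e \<le> s" "s \<le> T + e" for s using that e by (intro \<delta>1) auto
  have r2: "\<rho> / 2 < \<rho>" using \<rho> by simp
  have posT: "N (\<Phi> s x) \<bullet> N x > 0" if "T - e \<le> s" "s \<le> T + e" for s
    by (rule \<rho>(2), rule less_trans[OF nearT[OF that] r2])
  have "\<exists>s0\<in>{e..T - e}. \<forall>s\<in>{e..T - e}. norm (\<Phi> s0 x - x) \<le> norm (\<Phi> s x - x)"
    using e flow_continuous[OF x] by (intro continuous_attains_inf) (auto intro!: continuous_intros)
  \<comment> \<open>Its distance to \<open>x\<close> is the margin against returns at times between
    \<open>e\<close> and \<open>T - e\<close>.\<close>
  then obtain s0 where s0: "e \<le> s0" "s0 \<le> T - e" "\<And>s. e \<le> s \<Longrightarrow> s \<le> T - e \<Longrightarrow> norm (\<Phi> s0 x - x) \<le> norm (\<Phi> s x - x)"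
    by auto
  define c where "c = norm (\<Phi> s0 x - x)"
  have c: "c > 0" using T s0(1,2) e by (simp add: c_def is_period_def)
  define f where "f y s = (\<Phi> s y - y) \<bullet> W x" for y s
  have f1: "f x (T - e) < 0"
  proof -
    have "\<Phi> (T - e) x \<bullet> W x < \<Phi> T x \<bullet> W x"
      using e by (intro flow_advances[OF x] posT) auto
    then show ?thesis using T0 by (simp add: f_def inner_diff_left)
  qed
  have f2: "f x (T + e) > 0"
  proof -
    have "\<Phi> T x \<bullet> W x < \<Phi> (T + e) x \<bullet> W x"
      using e by (intro flow_advances[OF x] posT) auto
    then show ?thesis using T0 by (simp add: f_def inner_diff_left)
  qed
  define K where "K = exp (L * (T + e))"
  have K: "K \<ge> 1" "K > 0" using L_pos T0 e by (auto simp: K_def)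
  have NW: "norm (W x) > 0" using Nx by simp
  \<comment> \<open>Up to time \<open>T + e\<close> the displacement changes by at most
    \<open>(K + 1) * norm (y - x)\<close>: \<open>K\<close> for the moving point and 1 for the
    starting point. This stays below the margin \<open>c\<close> and, after pairing with
    \<open>W x\<close>, below the two sign margins.\<close>
  define d where "d = min (min (\<rho> / 2) c) (min (- f x (T - e)) (f x (T + e)) / norm (W x)) / (K + 1)"
  have d: "d > 0" using \<rho> c f1 f2 K NW by (auto simp: d_def min_def)
  show ?thesis
  proof (rule exI[of _ d], intro conjI ballI impI d)
    fix y assume y: "y \<in> X" "norm (y - x) < d"
    have Kd: "(K + 1) * norm (y - x) < min (min (\<rho> / 2) c) (min (- f x (T - e)) (f x (T + e)) / norm (W x))"
      using y(2) K unfolding d_def by (simp add: pos_less_divide_eq mult.commute)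
    have grow: "norm (\<Phi> s y - \<Phi> s x) \<le> K * norm (y - x)" if "0 \<le> s" "s \<le> T + e" for s
    proof -
      have "norm (\<Phi> s y - \<Phi> s x) \<le> exp (L * s) * norm (y - x)" by (rule flow_lipschitz[OF y(1) x that(1)])
      also have "\<dots> \<le> K * norm (y - x)" unfolding K_def using that L_pos by (intro mult_right_mono) auto
      finally show ?thesis .
    qed
    have diff: "norm ((\<Phi> s y - y) - (\<Phi> s x - x)) \<le> (K + 1) * norm (y - x)" if "0 \<le> s" "s \<le> T + e" for s
    proof -
      have "(\<Phi> s y - y) - (\<Phi> s x - x) = (\<Phi> s y - \<Phi> s x) - (y - x)" by simp
      then show ?thesis using norm_triangle_ineq4[of "\<Phi> s y - \<Phi> s x" "y - x"] grow[OF that]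
        by (simp add: algebra_simps)
    qed
    have fdiff: "\<bar>f y s - f x s\<bar> < min (- f x (T - e)) (f x (T + e))" if "0 \<le> s" "s \<le> T + e" for s
    proof -
      have "\<bar>f y s - f x s\<bar> \<le> norm ((\<Phi> s y - y) - (\<Phi> s x - x)) * norm (W x)"
        unfolding f_def by (simp only: flip: inner_diff_left) (rule Cauchy_Schwarz_ineq2)
      also have "\<dots> \<le> (K + 1) * norm (y - x) * norm (W x)" using diff[OF that] by (intro mult_right_mono) auto
      also have "\<dots> < min (- f x (T - e)) (f x (T + e))" using Kd NW by (simp add: pos_less_divide_eq)
      finally show ?thesis .
    qed
    have g1: "f y (T - e) < 0" using fdiff[of "T - e"] e T0 by (simp add: abs_less_iff)
    have g2: "f y (T + e) > 0" using fdiff[of "T + e"] e T0 by (simp add: abs_less_iff)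
    have "\<exists>\<tau>\<ge>T - e. \<tau> \<le> T + e \<and> f y \<tau> = 0"
      using g1 g2 e flow_continuous[OF y(1)] unfolding f_def
      by (intro IVT') (auto intro!: continuous_intros)
    then obtain \<tau> where \<tau>: "T - e \<le> \<tau>" "\<tau> \<le> T + e" "f y \<tau> = 0" by blast
    have \<tau>T: "\<tau> < T + e" using \<tau> g2 by (cases "\<tau> = T + e") auto
    have yK: "norm (y - x) \<le> (K + 1) * norm (y - x)" "K * norm (y - x) \<le> (K + 1) * norm (y - x)"
      using K mult_right_mono[of 1 "K + 1" "norm (y - x)"] by (auto simp: mult_right_mono)
    have small: "norm (\<Phi> s y - x) < \<rho>" if "0 \<le> s" "s \<le> T + e" "norm (\<Phi> s x - x) < \<rho> / 2" for s
    proof -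
      have "norm (\<Phi> s y - x) \<le> norm (\<Phi> s y - \<Phi> s x) + norm (\<Phi> s x - x)"
        using norm_triangle_ineq[of "\<Phi> s y - \<Phi> s x" "\<Phi> s x - x"] by simp
      then show ?thesis using grow[OF that(1,2)] yK Kd that(3) by simp
    qed
    have y\<rho>: "norm (y - x) < \<rho>" using yK Kd \<rho>(1) by simp
    have "y = \<Phi> \<tau> y"
    proof (rule section_injective[OF Nx \<rho>(2)])
      show "norm (\<Phi> \<tau> y - x) < \<rho>" using \<tau> e nearT by (intro small) auto
      show "(\<Phi> \<tau> y - y) \<bullet> W x = 0" using \<tau>(3) by (simp add: f_def)
    qed (use y\<rho> y H_flow in auto)
    moreover have Ny: "N y \<noteq> 0" using \<rho>(2)[OF y\<rho>] by auto
    ultimately obtain T' where T': "is_period y T'" "T' \<le> \<tau>"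
      using is_period_exists[OF y(1) Ny, of \<tau>] \<tau> e by auto
    have T'0: "T' > 0" "\<Phi> T' y = y" using T'(1) by (auto simp: is_period_def)
    have "T - e < T'"
    proof (rule ccontr)
      assume "\<not> T - e < T'"
      then have le: "T' \<le> T - e" by simp
      show False
      proof (cases "T' \<le> e")
        case True
        have "\<Phi> 0 y \<bullet> W x < \<Phi> T' y \<bullet> W x"
        proof (rule flow_advances[OF y(1) T'0(1)])
          fix s assume s: "0 \<le> s" "s \<le> T'"
          have "norm (\<Phi> s y - x) < \<rho>" using s True e T0 by (intro small near0) auto
          then show "N (\<Phi> s y) \<bullet> N x > 0" by (rule \<rho>(2))
        qed
        then show False using T'0 flow_0[OF y(1)] by simp
      next
        case False
        then have "c \<le> norm (\<Phi> T' x - x)" using s0(3)[of T'] le by (simp add: c_def)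
        moreover have "norm (\<Phi> T' x - x) \<le> (K + 1) * norm (y - x)"
          using diff[of T'] T'0 le e by (simp add: norm_minus_commute)
        ultimately show False using Kd by simp
      qed
    qed
    then have "\<bar>T' - T\<bar> < \<epsilon>" using T'(2) \<tau>T e by simp
    with T'(1) show "\<exists>T'. is_period y T' \<and> \<bar>T' - T\<bar> < \<epsilon>" by blast
  qed
qed

lemma flow_period_shift:
  assumes "x \<in> X" "is_period x T" "0 \<le> s"
  shows "\<Phi> (real n * T + s) x = \<Phi> s x"
proof (induction n)
  case (Suc n)
  have T: "T > 0" "\<Phi> T x = x" using assms(2) by (auto simp: is_period_def)
  have "\<Phi> (real (Suc n) * T + s) x = \<Phi> ((real n * T + s) + T) x" by (simp add: algebra_simps)
  also have "\<dots> = \<Phi> (real n * T + s) x" using flow_add[OF assms(1), of "real n * T + s" T] T assms(3) by simp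
  finally show ?case using Suc by simp
qed simp

lemma shear_period_shift:
  assumes "x \<in> X" "is_period x T" "0 \<le> s"
  shows "shear x (real n * T + s) = real n * shear x T + shear x s"
proof (induction n)
  case (Suc n)
  have T: "T > 0" using assms(2) by (auto simp: is_period_def)
  have Nx: "N x \<noteq> 0" using is_period_noncritical assms by blast
  let ?u = "real n * T + s"
  have u: "?u \<ge> 0" using T assms by simp
  have "shear x (real (Suc n) * T + s) = shear x (T + ?u)" by (simp add: algebra_simps)
  also have "\<dots> = integral {0..T} (shear_rate x) + integral {T..T + ?u} (shear_rate x)"
    unfolding shear_def using T u assms Nx
    by (intro Henstock_Kurzweil_Integration.integral_combine[symmetric] integrable_continuous_real shear_rate_continuous) auto
  also have "integral {T..T + ?u} (shear_rate x) = integral {0..?u} (\<lambda>t. shear_rate x (t + T))"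
    using Henstock_Kurzweil_Integration.integral_shift_real_ivl[of T T "T + ?u" "shear_rate x"] by (simp add: add.assoc)
  also have "\<dots> = shear x ?u"
    unfolding shear_def
  proof (rule Henstock_Kurzweil_Integration.integral_cong)
    fix t assume "t \<in> {0..?u}"
    then have "\<Phi> (t + T) x = \<Phi> t x" using flow_period_shift[OF assms(1,2), of t 1] by (simp add: add.commute)
    then show "shear_rate x (t + T) = shear_rate x t" by (simp add: shear_rate_def)
  qed
  finally show ?case using Suc by (simp add: shear_def algebra_simps)
qed simp

text \<open>The source of linear growth: every completed period adds the same multiple of the
  velocity.\<close>

lemma tangent_flow_period_shift:
  assumes "x \<in> X" "is_period x T" "0 \<le> s"
  shows "tangent_flow x (real n * T + s) h
    = tangent_flow x s h + (real n * ((N x \<bullet> h) * shear x T)) *\<^sub>R W (\<Phi> s x)"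
  using flow_period_shift[OF assms] shear_period_shift[OF assms]
  by (simp add: tangent_flow_def algebra_simps)

lemma tangent_flow_period:
  assumes "x \<in> X" "is_period x T"
  shows "tangent_flow x T h = h + ((N x \<bullet> h) * shear x T) *\<^sub>R W x"
  using tangent_flow_period_shift[OF assms, of 0 1 h] tangent_flow_0[OF assms(1) is_period_noncritical[OF assms]] assms
  by (simp add: flow_0)

definition period :: "real^2 \<Rightarrow> real" where
  "period x = real_of_ereal (orbit_period \<Phi> x)"

lemma period_eq: "is_period x T \<Longrightarrow> period x = T"
  by (simp add: period_def orbit_period_eq)

definition periodic :: "(real^2) set" where
  "periodic = {x\<in>X. \<exists>T. is_period x T}"

text \<open>Expanding \<open>\<Phi> T' y = y\<close> around \<open>T\<close> and \<open>x\<close>,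
  the terms in \<open>y - x\<close> cancel up to a multiple of \<open>W x\<close>. Comparing
  coefficients of \<open>W x\<close> gives \<open>T' - T\<close> as minus
  \<open>shear x T * (N x \<bullet> (y - x))\<close> up to a small error.\<close>

theorem period_has_derivative:
  assumes x: "x \<in> X" and T: "is_period x T"
  shows "(period has_derivative (\<lambda>h. (- shear x T *\<^sub>R N x) \<bullet> h)) (at x within periodic)"
  unfolding has_derivative_within_alt
proof (intro conjI allI impI bounded_linear_inner_right)
  fix e :: real assume e: "e > 0"
  define G where "G = - shear x T *\<^sub>R N x"
  have Nx: "N x \<noteq> 0" using is_period_noncritical[OF x T] .
  have T0: "T > 0" "\<Phi> T x = x" using T by (auto simp: is_period_def)
  define w where "w = norm (W x)"
  have w: "w > 0" using Nx by (simp add: w_def)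
  \<comment> \<open>The first entry lets the error proportional to the unknown \<open>T' - T\<close>
    be absorbed into the left side; the second makes the rest at most \<open>e * w / 2\<close> times
    the increment.\<close>
  define \<eta> where "\<eta> = min (w / 2) (e * w / (2 * (1 + norm G)))"
  have gp: "1 + norm G > 0" by (simp add: add_pos_nonneg)
  have \<eta>: "\<eta> > 0" "\<eta> \<le> w / 2" "\<eta> * (1 + norm G) \<le> e * w / 2"
  proof -
    show "\<eta> > 0" using e w gp by (auto simp: \<eta>_def)
    show "\<eta> \<le> w / 2" unfolding \<eta>_def by (rule min.cobounded1)
    have "\<eta> \<le> e * w / (2 * (1 + norm G))" by (simp add: \<eta>_def)
    then have "\<eta> * (1 + norm G) \<le> e * w / (2 * (1 + norm G)) * (1 + norm G)" using gp by (intro mult_right_mono) auto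
    also have "e * w / (2 * g) * g = e * w / 2" if "g > 0" for g using that by simp
    note this[OF gp]
    finally show "\<eta> * (1 + norm G) \<le> e * w / 2" .
  qed
  have "isCont W x" using W_continuous[of UNIV] by (simp add: continuous_on_eq_continuous_at)
  then obtain \<rho> where \<rho>: "\<rho> > 0" "\<And>y. norm (y - x) < \<rho> \<Longrightarrow> norm (W y - W x) < \<eta>"
    using \<eta>(1) unfolding continuous_at_eps_delta by (metis dist_norm)
  have "isCont (\<lambda>s. \<Phi> s x) T" using flow_continuous[OF x, of UNIV] by (simp add: continuous_on_eq_continuous_at)
  then obtain \<delta> where \<delta>: "\<delta> > 0" "\<And>s. \<bar>s - T\<bar> < \<delta> \<Longrightarrow> norm (\<Phi> s x - x) < \<rho> / 2"
    using \<rho>(1) T0 unfolding continuous_at_eps_delta by (metis dist_norm dist_real_def half_gt_zero)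
  define \<epsilon> where "\<epsilon> = min \<delta> (T / 2)"
  have \<epsilon>: "\<epsilon> > 0" "\<epsilon> \<le> \<delta>" "\<epsilon> < T" using \<delta> T0 by (auto simp: \<epsilon>_def)
  obtain d1 where d1: "d1 > 0" "\<And>y. y \<in> X \<Longrightarrow> norm (y - x) < d1 \<Longrightarrow> \<exists>T'. is_period y T' \<and> \<bar>T' - T\<bar> < \<epsilon>"
    using period_near[OF x T \<epsilon>(1)] by blast
  obtain d2 where d2: "d2 > 0" "\<And>y. y \<in> X \<Longrightarrow> norm (y - x) < d2 \<Longrightarrow>
      norm (\<Phi> T y - \<Phi> T x - tangent_flow x T (y - x)) \<le> \<eta> * norm (y - x)"
    using flow_has_derivative[OF x Nx, of T] T0 \<eta>(1) unfolding has_derivative_within_alt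
    by (meson less_imp_le)
  define K where "K = exp (L * (T + \<epsilon>))"
  have K: "K > 0" by (simp add: K_def)
  show "\<exists>d>0. \<forall>y\<in>periodic. norm (y - x) < d \<longrightarrow>
      norm (period y - period x - (- shear x T *\<^sub>R N x) \<bullet> (y - x)) \<le> e * norm (y - x)"
  proof (intro exI[of _ "min (min d1 d2) (\<rho> / (2 * K))"] conjI ballI impI)
    \<comment> \<open>The last radius keeps the orbits of \<open>x\<close> and \<open>y\<close>
      within \<open>\<rho> / 2\<close> of each other up to time \<open>T + \<epsilon>\<close>, hence
      \<open>\<Phi> s y\<close> near \<open>x\<close> for all \<open>s\<close> between
      \<open>T\<close> and \<open>T'\<close>.\<close>
    show "min (min d1 d2) (\<rho> / (2 * K)) > 0" using d1 d2 \<rho> K by simp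
    fix y assume "y \<in> periodic" and near: "norm (y - x) < min (min d1 d2) (\<rho> / (2 * K))"
    then have y: "y \<in> X" by (simp add: periodic_def)
    obtain T' where T': "is_period y T'" "\<bar>T' - T\<bar> < \<epsilon>" using d1(2)[OF y] near by auto
    have T'0: "\<Phi> T' y = y" using T' by (simp add: is_period_def)
    let ?h = "y - x" and ?\<delta> = "T' - T"
    let ?r2 = "\<Phi> T y - \<Phi> T x - tangent_flow x T ?h"
    have r2: "norm ?r2 \<le> \<eta> * norm ?h" using d2(2)[OF y] near by simp
    let ?r1 = "\<Phi> T' y - \<Phi> T y - ?\<delta> *\<^sub>R W x"
    have closeW: "norm (W (\<Phi> s y) - W x) \<le> \<eta>" if s: "s \<in> closed_segment T T'" for s
    proof -
      have "\<bar>s - T\<bar> \<le> \<bar>T' - T\<bar>" using s by (auto simp: closed_segment_eq_real_ivl split: if_splits)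
      then have s': "0 \<le> s" "s \<le> T + \<epsilon>" "\<bar>s - T\<bar> < \<delta>" using T'(2) \<epsilon> by auto
      have "norm (\<Phi> s y - \<Phi> s x) \<le> exp (L * s) * norm ?h" by (rule flow_lipschitz[OF y x s'(1)])
      also have "\<dots> \<le> K * norm ?h" unfolding K_def using s' L_pos by (intro mult_right_mono) auto
      also have "\<dots> < \<rho> / 2" using near K by (simp add: pos_less_divide_eq mult_ac)
      finally have "norm (\<Phi> s y - \<Phi> s x) < \<rho> / 2" .
      moreover have "norm (\<Phi> s x - x) < \<rho> / 2" using \<delta>(2) s' by simp
      ultimately have "norm (\<Phi> s y - x) < \<rho>"
        using norm_triangle_ineq[of "\<Phi> s y - \<Phi> s x" "\<Phi> s x - x"] by simp
      then show ?thesis using \<rho>(2) less_imp_le by blast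
    qed
    have r1: "norm ?r1 \<le> \<eta> * \<bar>?\<delta>\<bar>"
    proof -
      have "norm ((\<Phi> T' y - T' *\<^sub>R W x) - (\<Phi> T y - T *\<^sub>R W x)) \<le> \<eta> * norm (T' - T)"
      proof (rule differentiable_bound[where S = "closed_segment T T'"
            and f' = "\<lambda>s h. h *\<^sub>R (W (\<Phi> s y) - W x)"])
        fix s assume s: "s \<in> closed_segment T T'"
        have "((\<lambda>s. \<Phi> s y - s *\<^sub>R W x) has_vector_derivative (W (\<Phi> s y) - 1 *\<^sub>R W x)) (at s)"
          by (intro has_vector_derivative_diff flow_deriv_W[OF y]) (auto intro!: derivative_eq_intros)
        then show "((\<lambda>s. \<Phi> s y - s *\<^sub>R W x) has_derivative (\<lambda>h. h *\<^sub>R (W (\<Phi> s y) - W x))) (at s within closed_segment T T')"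
          by (simp add: has_vector_derivative_def has_derivative_at_withinI)
        show "onorm (\<lambda>h. h *\<^sub>R (W (\<Phi> s y) - W x)) \<le> \<eta>"
          using closeW[OF s] \<eta>(1) by (intro onorm_bound) (auto simp: mult.commute[of _ "norm (W (\<Phi> s y) - W x)"] intro!: mult_right_mono)
      qed auto
      then show ?thesis by (simp add: algebra_simps)
    qed
    have "(?\<delta> - G \<bullet> ?h) *\<^sub>R W x = - (?r1 + ?r2)"
      using T'0 T0 tangent_flow_period[OF x T, of ?h] by (simp add: G_def algebra_simps)
    then have "norm ((?\<delta> - G \<bullet> ?h) *\<^sub>R W x) = norm (?r1 + ?r2)" by (simp only: norm_minus_cancel)
    then have "\<bar>?\<delta> - G \<bullet> ?h\<bar> * w = norm (?r1 + ?r2)" by (simp only: norm_scaleR w_def real_norm_def)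
    also have "\<dots> \<le> \<eta> * \<bar>?\<delta>\<bar> + \<eta> * norm ?h" by (rule norm_triangle_le[OF add_mono[OF r1 r2]])
    finally have i1: "\<bar>?\<delta> - G \<bullet> ?h\<bar> * w \<le> \<eta> * \<bar>?\<delta>\<bar> + \<eta> * norm ?h" .
    have "\<bar>?\<delta>\<bar> \<le> \<bar>?\<delta> - G \<bullet> ?h\<bar> + norm G * norm ?h"
      using Cauchy_Schwarz_ineq2[of G ?h] by linarith
    then have i2: "\<eta> * \<bar>?\<delta>\<bar> \<le> \<eta> * (\<bar>?\<delta> - G \<bullet> ?h\<bar> + norm G * norm ?h)"
      using \<eta>(1) by (intro mult_left_mono) auto
    have i3: "\<eta> * \<bar>?\<delta> - G \<bullet> ?h\<bar> \<le> w / 2 * \<bar>?\<delta> - G \<bullet> ?h\<bar>" using \<eta>(2) by (intro mult_right_mono) auto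
    have i4: "\<eta> * (1 + norm G) * norm ?h \<le> e * w / 2 * norm ?h" using \<eta>(3) by (intro mult_right_mono) auto
    \<comment> \<open>Here \<open>u\<close> stands for the error of the linear approximation; the
      term \<open>\<eta> * u\<close> is absorbed by half of \<open>u * w\<close>.\<close>
    have "u * (w / 2) \<le> e * n * (w / 2)"
      if "u * w \<le> \<eta> * D + \<eta> * n" "\<eta> * D \<le> \<eta> * (u + g * n)" "\<eta> * u \<le> w / 2 * u" "\<eta> * (1 + g) * n \<le> e * w / 2 * n"
      for u D n g :: real
      using that by (simp add: algebra_simps)
    from this[OF i1 i2 i3 i4] have "\<bar>?\<delta> - G \<bullet> ?h\<bar> * (w / 2) \<le> e * norm ?h * (w / 2)" .
    then have "\<bar>?\<delta> - G \<bullet> ?h\<bar> \<le> e * norm ?h" using w by simp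
    then show "norm (period y - period x - (- shear x T *\<^sub>R N x) \<bullet> (y - x)) \<le> e * norm (y - x)"
      using period_eq[OF T] period_eq[OF T'(1)] by (simp add: G_def)
  qed
qed

end

text \<open>Along every direction leading into \<open>S\<close> the two linear forms agree. Such
  directions contain a ball, and moving its centre by a multiple of \<open>G1 - G2\<close> makes
  \<open>G1 - G2\<close> orthogonal to itself. This justifies the definite description in
  \<open>gradient_within\<close>.\<close>

lemma gradient_unique_cone:
  fixes g :: "real^2 \<Rightarrow> real"
  assumes G1: "(g has_derivative (\<lambda>h. G1 \<bullet> h)) (at x within S)"
    and G2: "(g has_derivative (\<lambda>h. G2 \<bullet> h)) (at x within S)"
    and r: "r > 0" and cone: "\<And>d. d \<in> ball d0 r \<Longrightarrow> \<exists>s0>0. \<forall>s. 0 < s \<and> s < s0 \<longrightarrow> x + s *\<^sub>R d \<in> S"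
  shows "G1 = G2"
proof -
  let ?D = "G1 - G2"
  have D: "((\<lambda>_. 0) has_derivative (\<lambda>h. ?D \<bullet> h)) (at x within S)"
    using has_derivative_diff[OF G1 G2] by (simp add: inner_diff_left)
  have zero: "?D \<bullet> d = 0" if d: "d \<in> ball d0 r" for d
  proof -
    obtain s0 where s0: "s0 > 0" "\<And>s. 0 < s \<Longrightarrow> s < s0 \<Longrightarrow> x + s *\<^sub>R d \<in> S" using cone[OF d] by blast
    have "\<bar>?D \<bullet> d\<bar> \<le> e" if e: "e > 0" for e
    proof -
      define e' where "e' = e / (norm d + 1)"
      have np: "norm d + 1 > 0" by (simp add: add_nonneg_pos)
      have e': "e' > 0" using e np by (simp add: e'_def)
      obtain \<delta> where \<delta>: "\<delta> > 0" "\<And>y. y \<in> S \<Longrightarrow> norm (y - x) < \<delta> \<Longrightarrow> \<bar>?D \<bullet> (y - x)\<bar> \<le> e' * norm (y - x)"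
        using D e' unfolding has_derivative_within_alt by force
      define s where "s = min (s0 / 2) (\<delta> / (2 * (norm d + 1)))"
      have s_pos: "s > 0" using s0(1) \<delta>(1) np by (simp add: s_def)
      have "s \<le> s0 / 2" unfolding s_def by (rule min.cobounded1)
      with s_pos s0(1) have s: "s > 0" "s < s0" by auto
      have "s * norm d \<le> \<delta> / (2 * (norm d + 1)) * (norm d + 1)"
        using s(1) \<delta>(1) np by (intro mult_mono) (auto simp: s_def)
      also have "\<delta> / (2 * g) * g < \<delta>" if "g > 0" for g using that \<delta>(1) by simp
      note this[OF np]
      finally have "norm ((x + s *\<^sub>R d) - x) < \<delta>" using s by simp
      from \<delta>(2)[OF s0(2)[OF s] this] have "s * \<bar>?D \<bullet> d\<bar> \<le> s * (e' * norm d)" using s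
        by (simp add: abs_mult mult_ac)
      then have "\<bar>?D \<bullet> d\<bar> \<le> e' * norm d" using s(1) by simp
      also have "\<dots> \<le> e' * (norm d + 1)" using e' by (intro mult_left_mono) auto
      also have "\<dots> = e" using np by (simp add: e'_def)
      finally show ?thesis .
    qed
    then have "\<bar>?D \<bullet> d\<bar> \<le> 0" by (rule field_le_epsilon) simp
    then show ?thesis by simp
  qed
  show "G1 = G2"
  proof (rule ccontr)
    assume "G1 \<noteq> G2"
    then have nz: "norm ?D > 0" by simp
    define k where "k = r / (2 * norm ?D)"
    have k: "k > 0" using r nz by (simp add: k_def)
    have "norm (k *\<^sub>R ?D) < r" using r nz k by (simp add: k_def)
    then have "d0 + k *\<^sub>R ?D \<in> ball d0 r" by (simp add: dist_norm)
    from zero[OF this] zero[of d0] r have "k * (?D \<bullet> ?D) = 0" by (simp add: inner_add_right)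
    with k nz show False by simp
  qed
qed

section \<open>Growth of tangent vectors and the gradient of the logarithmic period\<close>

context planar_hamiltonian_flow
begin

text \<open>Let \<open>M\<close> be the maximal speed, attained at \<open>s0\<close>. The orbit
  stays within \<open>M * T\<close> of that point, so the velocity differs from the one there by at
  most \<open>L * M * T\<close>. As the velocity integrates to 0 over a period, \<open>M * T\<close>
  is at most \<open>L * M * T * T\<close>.\<close>

lemma period_lower_bound:
  assumes x: "x \<in> X" and T: "is_period x T"
  shows "1 \<le> L * T"
proof -
  have T0: "T > 0" "\<Phi> T x = x" using T by (auto simp: is_period_def)
  have Nx: "N x \<noteq> 0" using is_period_noncritical[OF x T] .
  have cW: "continuous_on {0..T} (\<lambda>s. norm (W (\<Phi> s x)))"
    by (intro continuous_intros continuous_on_compose2[OF W_continuous flow_continuous[OF x]]) auto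
  obtain s0 where s0: "s0 \<in> {0..T}" "\<And>s. s \<in> {0..T} \<Longrightarrow> norm (W (\<Phi> s x)) \<le> norm (W (\<Phi> s0 x))"
    using continuous_attains_sup[OF _ _ cW] T0 by auto
  define M where "M = norm (W (\<Phi> s0 x))"
  have M: "M > 0" using flow_noncritical[OF x Nx] by (simp add: M_def)
  have disp: "norm (\<Phi> s x - \<Phi> s0 x) \<le> M * T" if s: "s \<in> {0..T}" for s
  proof -
    have "norm (\<Phi> s x - \<Phi> s0 x) \<le> M * norm (s - s0)"
    proof (rule differentiable_bound[where S = "{0..T}" and f' = "\<lambda>s h. h *\<^sub>R W (\<Phi> s x)"])
      fix u assume u: "u \<in> {0..T}"
      show "((\<lambda>s. \<Phi> s x) has_derivative (\<lambda>h. h *\<^sub>R W (\<Phi> u x))) (at u within {0..T})"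
        using flow_deriv_W[OF x, of u] by (simp add: has_vector_derivative_def has_derivative_at_withinI)
      show "onorm (\<lambda>h. h *\<^sub>R W (\<Phi> u x)) \<le> M"
        using s0(2)[OF u] M by (intro onorm_bound) (auto simp: M_def mult.commute[of _ "norm (N _)"] intro!: mult_right_mono)
    qed (use s s0 in auto)
    also have "\<dots> \<le> M * T" using s s0 M by (intro mult_left_mono) auto
    finally show ?thesis .
  qed
  have "norm ((\<Phi> T x - T *\<^sub>R W (\<Phi> s0 x)) - (\<Phi> 0 x - 0 *\<^sub>R W (\<Phi> s0 x))) \<le> (L * (M * T)) * norm (T - 0)"
  proof (rule differentiable_bound[where S = "{0..T}" and f' = "\<lambda>s h. h *\<^sub>R (W (\<Phi> s x) - W (\<Phi> s0 x))"])
    fix u assume u: "u \<in> {0..T}"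
    have "((\<lambda>s. \<Phi> s x - s *\<^sub>R W (\<Phi> s0 x)) has_vector_derivative (W (\<Phi> u x) - 1 *\<^sub>R W (\<Phi> s0 x))) (at u)"
      by (intro has_vector_derivative_diff flow_deriv_W[OF x]) (auto intro!: derivative_eq_intros)
    then show "((\<lambda>s. \<Phi> s x - s *\<^sub>R W (\<Phi> s0 x)) has_derivative (\<lambda>h. h *\<^sub>R (W (\<Phi> u x) - W (\<Phi> s0 x)))) (at u within {0..T})"
      by (simp add: has_vector_derivative_def has_derivative_at_withinI)
    have "norm (W (\<Phi> u x) - W (\<Phi> s0 x)) \<le> L * norm (\<Phi> u x - \<Phi> s0 x)" using x by (intro W_lipschitz flow_in)
    also have "\<dots> \<le> L * (M * T)" using disp[OF u] L_pos by (intro mult_left_mono) auto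
    finally show "onorm (\<lambda>h. h *\<^sub>R (W (\<Phi> u x) - W (\<Phi> s0 x))) \<le> L * (M * T)"
      using L_pos M T0 
      by (intro onorm_bound) (auto simp: mult.commute[of _ "norm (W _ - W _)"] intro!: mult_right_mono)
  qed (use T0 in auto)
  then have "norm (T *\<^sub>R W (\<Phi> s0 x)) \<le> L * (M * T) * T" using T0 flow_0[OF x] by simp
  then have "1 * (M * T) \<le> (L * T) * (M * T)" using T0 by (simp add: M_def mult_ac)
  then show ?thesis using M T0 by (simp only: mult_le_cancel_right) auto
qed

text \<open>\<open>E\<close> bounds the derivative of the flow within one period. The shear vector
  at \<open>x\<close> equals \<open>tangent_flow x T h - h\<close>, which gives
  \<open>1 + E\<close>, and carrying it along the orbit costs another \<open>E\<close>. The bound on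
  \<open>g\<close> uses \<open>1 / T \<le> L\<close>.\<close>

theorem tangent_flow_growth:
  fixes h :: "real^2"
  assumes x: "x \<in> X" and T: "is_period x T" and M: "\<And>s. 0 \<le> s \<Longrightarrow> s \<le> T \<Longrightarrow> norm (A (\<Phi> s x)) \<le> M"
    and B: "M * T \<le> B" and t: "0 \<le> t"
  defines "g \<equiv> \<bar>(N x \<bullet> h) * shear x T\<bar> / T * norm (W (\<Phi> t x))" and "E \<equiv> exp B"
  shows "\<bar>norm (tangent_flow x t h) - t * g\<bar> \<le> (E + E * (1 + E)) * norm h"
    and "g \<le> L * (E * (1 + E)) * norm h"
proof -
  have T0: "T > 0" "\<Phi> T x = x" using T by (auto simp: is_period_def)
  have Nx: "N x \<noteq> 0" using is_period_noncritical[OF x T] .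
  have "norm (A (\<Phi> 0 x)) \<le> M" using M[of 0] T0 by simp
  then have M0: "M \<ge> 0" by (rule order_trans[OF norm_ge_zero])
  have E1: "E > 0" by (simp add: E_def)
  have tf: "norm (tangent_flow x s u) \<le> E * norm u" if s: "0 \<le> s" "s \<le> T" for s u
  proof -
    have "norm (tangent_flow x s u) \<le> exp (M * s) * norm u"
      using M s by (intro tangent_flow_norm_le[OF x Nx]) auto
    also have "M * s \<le> M * T" using s M0 by (intro mult_left_mono)
    then have "exp (M * s) * norm u \<le> E * norm u" using B by (intro mult_right_mono) (auto simp: E_def)
    finally show ?thesis .
  qed
  \<comment> \<open>The completed periods. The incomplete one contributes
    \<open>s / T \<le> 1\<close> to the difference between \<open>n\<close> and
    \<open>t / T\<close>.\<close>
  define n where "n = nat \<lfloor>t / T\<rfloor>"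
  define s where "s = t - real n * T"
  have "real n = \<lfloor>t / T\<rfloor>" using t T0 by (simp add: n_def)
  then have "real n \<le> t / T" "t / T < real n + 1" by linarith+
  then have s: "0 \<le> s" "s \<le> T" and ts: "t = real n * T + s"
    using T0 by (auto simp: s_def field_simps)
  have \<Phi>t: "\<Phi> t x = \<Phi> s x" unfolding ts by (rule flow_period_shift[OF x T s(1)])
  let ?c = "(N x \<bullet> h) * shear x T" and ?v = "norm (W (\<Phi> s x))"
  have v: "?v \<le> E * norm (W x)" using tf[OF s, of "W x"] tangent_flow_W[OF x Nx, of s] by simp
  have "?c *\<^sub>R W x = tangent_flow x T h - h" using tangent_flow_period[OF x T, of h] by simp
  then have "norm (?c *\<^sub>R W x) \<le> norm (tangent_flow x T h) + norm h"
    using norm_triangle_ineq4[of "tangent_flow x T h" h] by (simp only:)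
  then have "\<bar>?c\<bar> * norm (W x) \<le> E * norm h + norm h" using tf[of T h] T0 by simp
  then have cW: "\<bar>?c\<bar> * norm (W x) \<le> (1 + E) * norm h" by (simp add: algebra_simps)
  have "\<bar>?c\<bar> * ?v \<le> \<bar>?c\<bar> * (E * norm (W x))" using v by (intro mult_left_mono) auto
  also have "\<dots> = E * (\<bar>?c\<bar> * norm (W x))" by (simp only: mult_ac)
  also have "\<dots> \<le> E * ((1 + E) * norm h)" using cW E1 by (intro mult_left_mono) auto
  finally have cv: "\<bar>?c\<bar> * ?v \<le> E * (1 + E) * norm h" by (simp only: mult.assoc)
  have g: "g = \<bar>?c\<bar> * ?v / T" by (simp add: g_def \<Phi>t)
  have "norm (tangent_flow x t h - (real n * ?c) *\<^sub>R W (\<Phi> s x)) \<le> E * norm h"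
    unfolding ts using tangent_flow_period_shift[OF x T s(1), of n h] tf[OF s, of h] by simp
  then have "\<bar>norm (tangent_flow x t h) - norm ((real n * ?c) *\<^sub>R W (\<Phi> s x))\<bar> \<le> E * norm h"
    by (rule order_trans[OF norm_triangle_ineq3])
  then have 1: "\<bar>norm (tangent_flow x t h) - real n * (\<bar>?c\<bar> * ?v)\<bar> \<le> E * norm h"
    by (simp add: abs_mult mult.assoc)
  have tg: "t * g = real n * (\<bar>?c\<bar> * ?v) + (s / T) * (\<bar>?c\<bar> * ?v)"
    unfolding g ts using T0 by (simp add: field_simps)
  have "(s / T) * (\<bar>?c\<bar> * ?v) \<le> 1 * (\<bar>?c\<bar> * ?v)" using s T0 by (intro mult_right_mono) auto
  then have 2: "(s / T) * (\<bar>?c\<bar> * ?v) \<le> E * (1 + E) * norm h" using cv by linarith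
  have 3: "0 \<le> (s / T) * (\<bar>?c\<bar> * ?v)" using s T0 by simp
  have "\<bar>norm (tangent_flow x t h) - t * g\<bar> \<le> E * norm h + E * (1 + E) * norm h"
    using 1 2 3 unfolding tg by linarith
  then show "\<bar>norm (tangent_flow x t h) - t * g\<bar> \<le> (E + E * (1 + E)) * norm h"
    by (simp only: distrib_right)
  have "1 / T \<le> L" using period_lower_bound[OF x T] T0 by (simp add: divide_le_eq)
  then have "(1 / T) * (\<bar>?c\<bar> * ?v) \<le> L * (E * (1 + E) * norm h)"
    using L_pos by (intro mult_mono[OF _ cv]) auto
  moreover have "g = (1 / T) * (\<bar>?c\<bar> * ?v)" by (simp add: g)
  ultimately show "g \<le> L * (E * (1 + E)) * norm h" by (simp only: mult.assoc)
qed

lemma ln_period_gradient: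
  assumes x: "x \<in> X" and T: "is_period x T"
    and r: "r > 0" and cone: "\<And>d. d \<in> ball d0 r \<Longrightarrow> \<exists>s0>0. \<forall>s. 0 < s \<and> s < s0 \<longrightarrow> x + s *\<^sub>R d \<in> X"
  shows "(ln_period \<Phi> has_derivative (\<lambda>h. ((- shear x T / T) *\<^sub>R N x) \<bullet> h)) (at x within periodic)"
    and "gradient_within (ln_period \<Phi>) periodic x = (- shear x T / T) *\<^sub>R N x"
proof -
  have T0: "T > 0" using T by (simp add: is_period_def)
  have lnp: "ln_period \<Phi> = (\<lambda>y. ln (period y))" by (simp add: ln_period_def period_def fun_eq_iff)
  have "((\<lambda>y. ln (period y)) has_derivative (\<lambda>h. ((- shear x T *\<^sub>R N x) \<bullet> h) * inverse (period x))) (at x within periodic)"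
    by (rule has_derivative_eq_rhs[OF has_derivative_ln[OF _ period_has_derivative[OF x T]]])
       (use T0 period_eq[OF T] in \<open>auto simp: divide_inverse\<close>)
  then show D: "(ln_period \<Phi> has_derivative (\<lambda>h. ((- shear x T / T) *\<^sub>R N x) \<bullet> h)) (at x within periodic)"
    unfolding lnp by (rule has_derivative_eq_rhs) (use period_eq[OF T] in \<open>simp add: fun_eq_iff divide_inverse\<close>)
  \<comment> \<open>By \<open>period_near\<close>, \<open>periodic\<close> is open relative to
    \<open>X\<close>, so a cone of directions leading into \<open>X\<close> also leads into
    \<open>periodic\<close>.\<close>
  obtain \<delta> where \<delta>: "\<delta> > 0" "\<And>y. y \<in> X \<Longrightarrow> norm (y - x) < \<delta> \<Longrightarrow> y \<in> periodic"
  proof -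
    obtain d where "d > 0" "\<forall>y\<in>X. norm (y - x) < d \<longrightarrow> (\<exists>T'. is_period y T' \<and> \<bar>T' - T\<bar> < 1)"
      using period_near[OF x T, of 1] by auto
    then show thesis by (intro that[of d]) (auto simp: periodic_def)
  qed
  have cone': "\<exists>s0>0. \<forall>s. 0 < s \<and> s < s0 \<longrightarrow> x + s *\<^sub>R d \<in> periodic" if d: "d \<in> ball d0 r" for d
  proof -
    obtain s0 where s0: "s0 > 0" "\<And>s. 0 < s \<Longrightarrow> s < s0 \<Longrightarrow> x + s *\<^sub>R d \<in> X" using cone[OF d] by blast
    have np: "norm d + 1 > 0" by (simp add: add_nonneg_pos)
    show ?thesis
    proof (intro exI[of _ "min s0 (\<delta> / (norm d + 1))"] conjI allI impI)
      show "min s0 (\<delta> / (norm d + 1)) > 0" using s0 \<delta> np by simp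
      fix s assume s: "0 < s \<and> s < min s0 (\<delta> / (norm d + 1))"
      then have "s * (norm d + 1) < \<delta>" using np by (simp add: pos_less_divide_eq)
      moreover have "s * norm d \<le> s * (norm d + 1)" using s by (intro mult_left_mono) auto
      ultimately have "s * norm d < \<delta>" by linarith
      then have "norm ((x + s *\<^sub>R d) - x) < \<delta>" using s by simp
      then show "x + s *\<^sub>R d \<in> periodic" using s0 s by (intro \<delta>(2)) auto
    qed
  qed
  show "gradient_within (ln_period \<Phi>) periodic x = (- shear x T / T) *\<^sub>R N x"
    unfolding gradient_within_def
  proof (rule the_equality)
    show "(ln_period \<Phi> has_derivative (\<lambda>h. ((- shear x T / T) *\<^sub>R N x) \<bullet> h)) (at x within periodic)" by (rule D)
    show "G = (- shear x T / T) *\<^sub>R N x"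
      if "(ln_period \<Phi> has_derivative (\<lambda>h. G \<bullet> h)) (at x within periodic)" for G
      by (rule gradient_unique_cone[OF that D r cone'])
  qed
qed

end

text \<open>Each isolated point is the only point of \<open>Z\<close> in some member of a countable
  basis. Used to discard the isolated parameters at which a curve meets critical points.\<close>

lemma countable_isolated_points:
  fixes Z :: "'a::second_countable_topology set"
  shows "countable {x\<in>Z. \<not> x islimpt Z}"
proof -
  obtain B :: "'a set set" where B: "countable B" "topological_basis B" using ex_countable_basis by blast
  have "\<forall>x\<in>{x\<in>Z. \<not> x islimpt Z}. \<exists>U\<in>B. x \<in> U \<and> (\<forall>y\<in>Z. y \<in> U \<longrightarrow> y = x)"
  proof
    fix x assume "x \<in> {x\<in>Z. \<not> x islimpt Z}"
    then obtain T where T: "x \<in> T" "open T" "\<forall>y\<in>Z. y \<in> T \<longrightarrow> y = x" by (auto simp: islimpt_def)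
    then obtain U where "U \<in> B" "x \<in> U" "U \<subseteq> T" using topological_basisE[OF B(2)] by blast
    with T show "\<exists>U\<in>B. x \<in> U \<and> (\<forall>y\<in>Z. y \<in> U \<longrightarrow> y = x)" by blast
  qed
  then obtain U where U: "\<And>x. x \<in> {x\<in>Z. \<not> x islimpt Z} \<Longrightarrow> U x \<in> B \<and> x \<in> U x \<and> (\<forall>y\<in>Z. y \<in> U x \<longrightarrow> y = x)"
    by metis
  have "inj_on U {x\<in>Z. \<not> x islimpt Z}"
    by (rule inj_onI) (metis (no_types, lifting) U mem_Collect_eq)
  moreover have "countable (U ` {x\<in>Z. \<not> x islimpt Z})"
    by (rule countable_subset[OF _ B(1)]) (use U in blast)
  ultimately show ?thesis by (rule countable_image_inj_on[rotated])
qed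

text \<open>The difference vanishes along \<open>Z\<close>, which accumulates at \<open>x\<close>.
  Used where the curve and its transported copy agree because the flow rests.\<close>

lemma has_vector_derivative_unique_on_limpt:
  fixes f g :: "real \<Rightarrow> 'a::real_normed_vector"
  assumes f: "(f has_vector_derivative f') (at x)" and g: "(g has_vector_derivative g') (at x)"
    and Z: "x islimpt Z" "x \<in> Z" and eq: "\<And>y. y \<in> Z \<Longrightarrow> f y = g y"
  shows "f' = g'"
proof -
  have "((\<lambda>y. f y - g y) has_vector_derivative f' - g') (at x within Z)"
    using has_vector_derivative_diff[OF f g] by (rule has_vector_derivative_at_within)
  then have 1: "((\<lambda>_. 0) has_vector_derivative f' - g') (at x within Z)"
    by (rule has_vector_derivative_transform[rotated 2]) (use Z eq in auto)
  have "((\<lambda>_. 0) has_vector_derivative 0) (at x within Z)" by simp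
  from vector_derivative_unique_within[OF _ this 1] Z show ?thesis
    by (simp add: trivial_limit_within)
qed

section \<open>Growth of transported curves\<close>

context planar_hamiltonian_flow
begin

lemma period_positive: "x \<in> periodic \<Longrightarrow> period x > 0"
  by (auto simp: periodic_def period_eq is_period_def)

lemma ln_period_continuous: "continuous_on periodic (ln_period \<Phi>)"
proof -
  have "continuous_on periodic period"
    unfolding continuous_on_eq_continuous_within
  proof
    fix x assume "x \<in> periodic"
    then obtain T where "x \<in> X" "is_period x T" by (auto simp: periodic_def)
    from has_derivative_continuous[OF period_has_derivative[OF this]]
    show "continuous (at x within periodic) period" .
  qed
  then have "continuous_on periodic (\<lambda>x. ln (period x))"
    using period_positive by (intro continuous_intros) (auto dest: period_positive)
  then show ?thesis by (simp add: ln_period_def[abs_def] period_def)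
qed

text \<open>A pointwise estimate for the speed of the transported curve, valid for almost all
  parameters, is integrated. In \<open>K\<close> the summand 1 serves critical points, where the
  speed is unchanged and \<open>F\<close> vanishes; the second summand bounds the deviation from
  \<open>t * F\<close>, the third \<open>F\<close> itself.\<close>

theorem curve_growth:
  fixes \<gamma> :: "real \<Rightarrow> real^2" and B t :: real
  defines "E \<equiv> exp B"
  defines "K \<equiv> 1 + (E + E * (1 + E)) + L * (E * (1 + E))"
  defines "F \<equiv> \<lambda>\<alpha>. if 0 < orbit_period \<Phi> (\<gamma> \<alpha>) \<and> orbit_period \<Phi> (\<gamma> \<alpha>) < \<infinity>
      then \<bar>vector_derivative \<gamma> (at \<alpha> within {0..1}) \<bullet> gradient_within (ln_period \<Phi>) periodic (\<gamma> \<alpha>)\<bar>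
           * norm (W (\<Phi> t (\<gamma> \<alpha>)))
      else 0"
  assumes lip: "L\<gamma>-lipschitz_on {0..1} \<gamma>" and img: "\<gamma> ` {0..1} \<subseteq> X" and t: "0 \<le> t"
    and cone: "\<And>x. x \<in> X \<Longrightarrow> \<exists>d0 r. r > 0 \<and> (\<forall>d\<in>ball d0 r. \<exists>s0>0. \<forall>s. 0 < s \<and> s < s0 \<longrightarrow> x + s *\<^sub>R d \<in> X)"
    and bound: "\<And>\<alpha>. \<alpha> \<in> {0..1} \<Longrightarrow> N (\<gamma> \<alpha>) \<noteq> 0 \<Longrightarrow>
      \<exists>T M. is_period (\<gamma> \<alpha>) T \<and> (\<forall>s\<in>{0..T}. norm (A (\<Phi> s (\<gamma> \<alpha>))) \<le> M) \<and> M * T \<le> B"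
  shows "F absolutely_integrable_on {0..1}"
    and "\<bar>curve_length (\<lambda>\<alpha>. \<Phi> t (\<gamma> \<alpha>)) - ereal (t * integral {0..1} F)\<bar> \<le> ereal K * curve_length \<gamma>"
    and "ereal (integral {0..1} F) \<le> ereal K * curve_length \<gamma>"
proof -
  have E: "E > 0" by (simp add: E_def)
  define K1 K2 where "K1 = E + E * (1 + E)" and "K2 = L * (E * (1 + E))"
  have K12: "K1 \<ge> 0" "K2 \<ge> 0" using E L_pos by (auto simp: K1_def K2_def)
  have K: "K = 1 + K1 + K2" by (simp add: K_def K1_def K2_def)
  define \<gamma>t where "\<gamma>t \<alpha> = \<Phi> t (\<gamma> \<alpha>)" for \<alpha>
  have \<gamma>X: "\<gamma> \<alpha> \<in> X" if "\<alpha> \<in> {0..1}" for \<alpha> using img that by blast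
  have lipt: "(exp (L * t) * L\<gamma>)-lipschitz_on {0..1} \<gamma>t"
  proof (rule lipschitz_onI)
    fix a b :: real assume ab: "a \<in> {0..1}" "b \<in> {0..1}"
    have "dist (\<gamma>t a) (\<gamma>t b) \<le> exp (L * t) * dist (\<gamma> a) (\<gamma> b)"
      unfolding \<gamma>t_def dist_norm using ab t by (intro flow_lipschitz \<gamma>X)
    also have "\<dots> \<le> exp (L * t) * (L\<gamma> * dist a b)" using lipschitz_onD[OF lip ab] by (intro mult_left_mono) auto
    finally show "dist (\<gamma>t a) (\<gamma>t b) \<le> exp (L * t) * L\<gamma> * dist a b" by (simp only: mult.assoc)
  qed (use lipschitz_on_nonneg[OF lip] in auto)
  let ?v = "\<lambda>\<alpha>. vector_derivative \<gamma> (at \<alpha> within {0..1})"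
  let ?vt = "\<lambda>\<alpha>. vector_derivative \<gamma>t (at \<alpha> within {0..1})"
  obtain N0 where N0: "negligible N0"
    "\<And>\<alpha>. \<alpha> \<in> {0..1} - N0 \<Longrightarrow> 0 < \<alpha> \<and> \<alpha> < 1 \<and> (\<gamma> has_vector_derivative ?v \<alpha>) (at \<alpha>)"
    "(\<lambda>\<alpha>. norm (?v \<alpha>)) integrable_on {0..1}" "curve_length \<gamma> = ereal (integral {0..1} (\<lambda>\<alpha>. norm (?v \<alpha>)))"
    using lipschitz_curve_length[OF lip] by metis
  obtain N1 where N1: "negligible N1"
    "\<And>\<alpha>. \<alpha> \<in> {0..1} - N1 \<Longrightarrow> 0 < \<alpha> \<and> \<alpha> < 1 \<and> (\<gamma>t has_vector_derivative ?vt \<alpha>) (at \<alpha>)"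
    "(\<lambda>\<alpha>. norm (?vt \<alpha>)) integrable_on {0..1}" "curve_length \<gamma>t = ereal (integral {0..1} (\<lambda>\<alpha>. norm (?vt \<alpha>)))"
    using lipschitz_curve_length[OF lipt] by metis
  define Z where "Z = {\<alpha>\<in>{0..1}. N (\<gamma> \<alpha>) = 0}"
  \<comment> \<open>Outside this null set both curves are differentiable and every parameter in
    \<open>Z\<close> is an accumulation point of \<open>Z\<close>.\<close>
  define N2 where "N2 = N0 \<union> N1 \<union> {\<alpha>\<in>Z. \<not> \<alpha> islimpt Z}"
  have N2: "negligible N2"
    unfolding N2_def using N0(1) N1(1) negligible_UN[OF countable_isolated_points[of Z], of "\<lambda>x. {x}"]
    by (simp add: negligible_Un)
  have F_period: "F \<alpha> = \<bar>(N (\<gamma> \<alpha>) \<bullet> ?v \<alpha>) * shear (\<gamma> \<alpha>) T\<bar> / T * norm (W (\<Phi> t (\<gamma> \<alpha>)))"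
    and F_grad: "F \<alpha> = \<bar>?v \<alpha> \<bullet> ((- shear (\<gamma> \<alpha>) T / T) *\<^sub>R N (\<gamma> \<alpha>))\<bar> * norm (W (\<Phi> t (\<gamma> \<alpha>)))"
    if \<alpha>: "\<alpha> \<in> {0..1}" and T: "is_period (\<gamma> \<alpha>) T" for \<alpha> T
  proof -
    obtain d0 r where "r > 0" "\<And>d. d \<in> ball d0 r \<Longrightarrow> \<exists>s0>0. \<forall>s. 0 < s \<and> s < s0 \<longrightarrow> \<gamma> \<alpha> + s *\<^sub>R d \<in> X"
      using cone[OF \<gamma>X[OF \<alpha>]] by blast
    from ln_period_gradient(2)[OF \<gamma>X[OF \<alpha>] T this]
    show g: "F \<alpha> = \<bar>?v \<alpha> \<bullet> ((- shear (\<gamma> \<alpha>) T / T) *\<^sub>R N (\<gamma> \<alpha>))\<bar> * norm (W (\<Phi> t (\<gamma> \<alpha>)))"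
      using orbit_period_pos_finite_iff[OF \<gamma>X[OF \<alpha>]] T by (auto simp: F_def)
    have "T > 0" using T by (simp add: is_period_def)
    then show "F \<alpha> = \<bar>(N (\<gamma> \<alpha>) \<bullet> ?v \<alpha>) * shear (\<gamma> \<alpha>) T\<bar> / T * norm (W (\<Phi> t (\<gamma> \<alpha>)))"
      unfolding g by (simp add: abs_mult inner_commute)
  qed
  have F_crit: "F \<alpha> = 0" if "\<alpha> \<in> Z" for \<alpha>
    using that \<gamma>X orbit_period_critical[of "\<gamma> \<alpha>"] by (auto simp: Z_def F_def)
  have crit: "?vt \<alpha> = ?v \<alpha>" if \<alpha>: "\<alpha> \<in> {0..1} - N2" "N (\<gamma> \<alpha>) = 0" for \<alpha>
  proof (rule has_vector_derivative_unique_on_limpt)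
    show "(\<gamma>t has_vector_derivative ?vt \<alpha>) (at \<alpha>)" "(\<gamma> has_vector_derivative ?v \<alpha>) (at \<alpha>)"
      using N0(2) N1(2) \<alpha> by (auto simp: N2_def)
    show "\<alpha> islimpt Z" "\<alpha> \<in> Z" using \<alpha> by (auto simp: N2_def Z_def)
    show "\<gamma>t y = \<gamma> y" if "y \<in> Z" for y
      using that t \<gamma>X by (auto simp: Z_def \<gamma>t_def flow_critical)
  qed
  have noncrit: "\<bar>norm (?vt \<alpha>) - t * F \<alpha>\<bar> \<le> K1 * norm (?v \<alpha>) \<and> F \<alpha> \<le> K2 * norm (?v \<alpha>)"
    if \<alpha>: "\<alpha> \<in> {0..1} - N2" "N (\<gamma> \<alpha>) \<noteq> 0" for \<alpha>
  proof -
    have \<alpha>01: "\<alpha> \<in> {0..1}" using \<alpha> by auto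
    obtain T M where T: "is_period (\<gamma> \<alpha>) T" "\<forall>s\<in>{0..T}. norm (A (\<Phi> s (\<gamma> \<alpha>))) \<le> M" "M * T \<le> B"
      using bound[OF \<alpha>01 \<alpha>(2)] by blast
    \<comment> \<open>The flow is differentiable relative to \<open>X\<close> only, so the chain
      rule is applied within \<open>{0..1}\<close>, whose image lies in \<open>X\<close>.\<close>
    have "(\<gamma> has_derivative (\<lambda>h. h *\<^sub>R ?v \<alpha>)) (at \<alpha> within {0..1})"
      using N0(2)[of \<alpha>] \<alpha>(1) by (auto simp: N2_def has_vector_derivative_def intro: has_derivative_at_withinI)
    then have "((\<lambda>\<alpha>. \<Phi> t (\<gamma> \<alpha>)) has_derivative (\<lambda>h. tangent_flow (\<gamma> \<alpha>) t (h *\<^sub>R ?v \<alpha>))) (at \<alpha> within {0..1})"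
      by (rule has_derivative_in_compose)
         (rule has_derivative_subset[OF flow_has_derivative[OF \<gamma>X[OF \<alpha>01] \<alpha>(2) t] img])
    then have "(\<gamma>t has_vector_derivative tangent_flow (\<gamma> \<alpha>) t (?v \<alpha>)) (at \<alpha> within {0..1})"
      unfolding \<gamma>t_def[abs_def] has_vector_derivative_def
      using bounded_linear.linear[OF tangent_flow_linear] by (simp add: linear_cmul)
    moreover have "at \<alpha> within {0..1} \<noteq> bot"
      using \<alpha>01 by (simp add: trivial_limit_within islimpt_Icc)
    ultimately have "?vt \<alpha> = tangent_flow (\<gamma> \<alpha>) t (?v \<alpha>)" by (rule vector_derivative_within[rotated])
    then show ?thesis
      using tangent_flow_growth[OF \<gamma>X[OF \<alpha>01] T(1) _ T(3) t, of "?v \<alpha>"] T(2) F_period[OF \<alpha>01 T(1)]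
      by (auto simp: K1_def K2_def E_def)
  qed
  have F0: "F \<alpha> \<ge> 0" for \<alpha> by (simp add: F_def)
  have growth: "\<bar>norm (?vt \<alpha>) - t * F \<alpha>\<bar> \<le> K * norm (?v \<alpha>) \<and> F \<alpha> \<le> K * norm (?v \<alpha>)"
    if \<alpha>: "\<alpha> \<in> {0..1} - N2" for \<alpha>
  proof (cases "N (\<gamma> \<alpha>) = 0")
    case True
    have "1 * norm (?v \<alpha>) \<le> K * norm (?v \<alpha>)" using K K12 by (intro mult_right_mono) auto
    then show ?thesis using crit[OF \<alpha> True] F_crit[of \<alpha>] \<alpha> True K K12 by (auto simp: Z_def)
  next
    case False
    have "K1 * norm (?v \<alpha>) \<le> K * norm (?v \<alpha>)" "K2 * norm (?v \<alpha>) \<le> K * norm (?v \<alpha>)"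
      using K K12 by (auto intro!: mult_right_mono)
    then show ?thesis using noncrit[OF \<alpha> False] by auto
  qed
  \<comment> \<open>Zero on the null set, so that estimates and limits hold at every
    parameter.\<close>
  define cut where "cut f \<alpha> = (if \<alpha> \<in> N2 then 0 else f \<alpha>)" for f :: "real \<Rightarrow> real" and \<alpha>
  \<comment> \<open>\<open>F\<close> is the limit of difference quotients of the logarithmic period
    along the curve, multiplied by the speed of the flow.\<close>
  have Fmeas: "cut F \<in> borel_measurable (lebesgue_on {0..1})"
  proof -
    \<comment> \<open>On this open set of parameters the logarithmic period is continuous along the
      curve; extended by 0 it is Borel.\<close>
    define O' where "O' = {\<alpha>\<in>{0<..<1}. N (\<gamma> \<alpha>) \<noteq> 0}"
    define \<gamma>c where "\<gamma>c \<alpha> = \<gamma> (max 0 (min 1 \<alpha>))" for \<alpha>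
    have contc: "continuous_on UNIV \<gamma>c"
      unfolding \<gamma>c_def using lipschitz_on_continuous_on[OF lipschitz_on_clamp[OF lip]] .
    have \<gamma>cX: "\<gamma>c \<alpha> \<in> X" for \<alpha> unfolding \<gamma>c_def by (rule \<gamma>X) auto
    have \<gamma>c: "\<gamma>c \<alpha> = \<gamma> \<alpha>" if "\<alpha> \<in> {0..1}" for \<alpha> using that by (simp add: \<gamma>c_def)
    have "O' = {0<..<1} \<inter> {\<alpha>. N (\<gamma>c \<alpha>) \<noteq> 0}" using \<gamma>c by (auto simp: O'_def)
    also have "open \<dots>"
      by (intro open_Int open_Collect_neq continuous_on_compose2[OF N_continuous contc] continuous_intros) auto
    finally have openO: "open O'" .
    have periodicO: "\<gamma> ` O' \<subseteq> periodic"
    proof (rule image_subsetI)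
      fix \<alpha> assume "\<alpha> \<in> O'"
      then have \<alpha>: "\<alpha> \<in> {0..1}" "N (\<gamma> \<alpha>) \<noteq> 0" by (auto simp: O'_def)
      then obtain T where "is_period (\<gamma> \<alpha>) T" using bound by blast
      with \<gamma>X[OF \<alpha>(1)] show "\<gamma> \<alpha> \<in> periodic" by (auto simp: periodic_def)
    qed
    have contO: "continuous_on O' (\<lambda>\<alpha>. ln_period \<Phi> (\<gamma> \<alpha>))"
      by (rule continuous_on_compose2[OF ln_period_continuous _ periodicO])
         (rule continuous_on_subset[OF lipschitz_on_continuous_on[OF lip]], auto simp: O'_def)
    define f where "f \<alpha> = indicator O' \<alpha> *\<^sub>R ln_period \<Phi> (\<gamma> \<alpha>)" for \<alpha>
    have fm[measurable]: "f \<in> borel_measurable borel"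
      unfolding f_def[abs_def] using openO contO by (intro borel_measurable_continuous_on_indicator) auto
    define s where "s \<alpha> = indicat_real O' \<alpha> * norm (W (\<Phi> t (\<gamma>c \<alpha>)))" for \<alpha>
    have sm[measurable]: "s \<in> borel_measurable borel"
    proof -
      have "continuous_on X (\<Phi> t)"
      proof (rule lipschitz_on_continuous_on, rule lipschitz_onI)
        show "dist (\<Phi> t x) (\<Phi> t y) \<le> exp (L * t) * dist x y" if "x \<in> X" "y \<in> X" for x y
          unfolding dist_norm using that t by (rule flow_lipschitz)
      qed simp
      then have "continuous_on UNIV (\<lambda>\<alpha>. \<Phi> t (\<gamma>c \<alpha>))" by (rule continuous_on_compose2[OF _ contc]) (use \<gamma>cX in auto)
      then have "continuous_on UNIV (\<lambda>\<alpha>. norm (W (\<Phi> t (\<gamma>c \<alpha>))))"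
        by (intro continuous_on_norm continuous_on_compose2[OF W_continuous]) auto
      then have "(\<lambda>\<alpha>. norm (W (\<Phi> t (\<gamma>c \<alpha>)))) \<in> borel_measurable borel" by (rule borel_measurable_continuous_onI)
      then show ?thesis
        unfolding s_def[abs_def] using openO by (intro borel_measurable_times borel_measurable_indicator) auto
    qed
    define q where "q n \<alpha> = \<bar>real (Suc n) * (f (\<alpha> + 1 / real (Suc n)) - f \<alpha>)\<bar> * s \<alpha>" for n \<alpha>
    have qm: "q n \<in> borel_measurable borel" for n unfolding q_def[abs_def] by measurable
    have N2s: "N2 \<in> sets lebesgue" using N2 by (rule negligible_imp_sets)
    have cutm: "cut (q n) \<in> borel_measurable (lebesgue_on {0..1})" for n
    proof -
      have "q n \<in> borel_measurable lebesgue" using qm[of n] by (simp add: measurable_completion)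
      then have "cut (q n) \<in> borel_measurable lebesgue"
        unfolding cut_def[abs_def] using N2s by (intro measurable_If_set) auto
      then show ?thesis by (rule measurable_restrict_space1)
    qed
    show ?thesis
    proof (rule borel_measurable_LIMSEQ_metric[OF cutm])
      fix \<alpha> :: real assume "\<alpha> \<in> space (lebesgue_on {0..1})"
      then have \<alpha>: "\<alpha> \<in> {0..1}" by simp
      show "(\<lambda>n. cut (q n) \<alpha>) \<longlonglongrightarrow> cut F \<alpha>"
      proof (cases "\<alpha> \<in> N2")
        case False
        then have \<alpha>': "\<alpha> \<in> {0..1} - N2" using \<alpha> by simp
        have \<alpha>01: "0 < \<alpha>" "\<alpha> < 1" and d\<gamma>: "(\<gamma> has_vector_derivative ?v \<alpha>) (at \<alpha>)"
          using N0(2)[of \<alpha>] \<alpha>' by (auto simp: N2_def)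
        show ?thesis
        proof (cases "N (\<gamma> \<alpha>) = 0")
          case True
          then have "F \<alpha> = 0" using F_crit[of \<alpha>] \<alpha> by (simp add: Z_def)
          moreover have "q n \<alpha> = 0" for n using True by (simp add: q_def s_def O'_def)
          ultimately show ?thesis by (simp add: cut_def)
        next
          case N0': False
          then have \<alpha>O: "\<alpha> \<in> O'" using \<alpha>01 by (simp add: O'_def)
          obtain T where T: "is_period (\<gamma> \<alpha>) T" using bound[OF \<alpha> N0'] by blast
          define G where "G = (- shear (\<gamma> \<alpha>) T / T) *\<^sub>R N (\<gamma> \<alpha>)"
          obtain d0 r where "r > 0" "\<And>d. d \<in> ball d0 r \<Longrightarrow> \<exists>s0>0. \<forall>s. 0 < s \<and> s < s0 \<longrightarrow> \<gamma> \<alpha> + s *\<^sub>R d \<in> X"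
            using cone[OF \<gamma>X[OF \<alpha>]] by blast
          from ln_period_gradient(1)[OF \<gamma>X[OF \<alpha>] T this]
          have dln: "(ln_period \<Phi> has_derivative (\<lambda>h. G \<bullet> h)) (at (\<gamma> \<alpha>) within \<gamma> ` O')"
            unfolding G_def by (rule has_derivative_subset[OF _ periodicO])
          have "((\<lambda>\<alpha>. ln_period \<Phi> (\<gamma> \<alpha>)) has_derivative (\<lambda>h. G \<bullet> (h *\<^sub>R ?v \<alpha>))) (at \<alpha> within O')"
            by (rule has_derivative_in_compose[OF _ dln])
               (use d\<gamma> in \<open>auto simp: has_vector_derivative_def intro: has_derivative_at_withinI\<close>)
          then have "((\<lambda>\<alpha>. ln_period \<Phi> (\<gamma> \<alpha>)) has_vector_derivative G \<bullet> ?v \<alpha>) (at \<alpha>)"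
            using at_within_open[OF \<alpha>O openO] by (simp add: has_vector_derivative_def)
          then have df: "(f has_vector_derivative G \<bullet> ?v \<alpha>) (at \<alpha>)"
            by (rule has_vector_derivative_transform_within_open[OF _ openO \<alpha>O]) (simp add: f_def)
          have "(\<lambda>n. real (Suc n) *\<^sub>R (f (\<alpha> + 1 / real (Suc n)) - f \<alpha>)) \<longlonglongrightarrow> G \<bullet> ?v \<alpha>"
            using vector_derivative_dq_tendsto[OF differentiableI_vector[OF df]] vector_derivative_at[OF df] by simp
          then have "(\<lambda>n. q n \<alpha>) \<longlonglongrightarrow> \<bar>G \<bullet> ?v \<alpha>\<bar> * s \<alpha>"
            unfolding q_def by (intro tendsto_mult tendsto_rabs tendsto_const) simp
          moreover have "F \<alpha> = \<bar>G \<bullet> ?v \<alpha>\<bar> * s \<alpha>"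
            using F_grad[OF \<alpha> T] \<alpha>O \<gamma>c[OF \<alpha>] by (simp add: G_def s_def inner_commute)
          ultimately show ?thesis using False by (simp add: cut_def)
        qed
      qed (simp add: cut_def)
    qed
  qed
  have cuti: "(cut f has_integral I) {0..1} \<longleftrightarrow> (f has_integral I) {0..1}" for f I
    by (rule has_integral_spike_eq[OF N2]) (simp add: cut_def)
  then have cuti': "integral {0..1} (cut f) = integral {0..1} f"
    and cuti'': "cut f integrable_on {0..1} \<longleftrightarrow> f integrable_on {0..1}" for f
    by (simp_all add: integral_def integrable_on_def)
  have int_v: "cut (\<lambda>\<alpha>. norm (?v \<alpha>)) integrable_on {0..1}" using N0(3) by (simp add: cuti'')
  have int_vt: "cut (\<lambda>\<alpha>. norm (?vt \<alpha>)) integrable_on {0..1}" using N1(3) by (simp add: cuti'')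
  have "cut F absolutely_integrable_on {0..1}"
  proof (rule measurable_bounded_by_integrable_imp_absolutely_integrable[OF Fmeas])
    show "(\<lambda>\<alpha>. K * cut (\<lambda>\<alpha>. norm (?v \<alpha>)) \<alpha>) integrable_on {0..1}" using int_v by (rule integrable_on_mult_right)
    show "norm (cut F \<alpha>) \<le> K * cut (\<lambda>\<alpha>. norm (?v \<alpha>)) \<alpha>" if "\<alpha> \<in> {0..1}" for \<alpha>
      using growth[of \<alpha>] F0[of \<alpha>] that by (auto simp: cut_def)
  qed auto
  then show Fabs: "F absolutely_integrable_on {0..1}"
    by (rule absolutely_integrable_spike[OF _ N2]) (simp add: cut_def)
  have intF: "cut F integrable_on {0..1}" using Fabs by (simp add: cuti'' absolutely_integrable_on_def)
  have len: "curve_length \<gamma> = ereal (integral {0..1} (cut (\<lambda>\<alpha>. norm (?v \<alpha>))))"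
    "curve_length \<gamma>t = ereal (integral {0..1} (cut (\<lambda>\<alpha>. norm (?vt \<alpha>))))"
    using N0(4) N1(4) by (simp_all add: cuti')
  have "norm (integral {0..1} (\<lambda>\<alpha>. cut (\<lambda>\<alpha>. norm (?vt \<alpha>)) \<alpha> - t * cut F \<alpha>))
      \<le> integral {0..1} (\<lambda>\<alpha>. K * cut (\<lambda>\<alpha>. norm (?v \<alpha>)) \<alpha>)"
  proof (rule integral_norm_bound_integral)
    show "(\<lambda>\<alpha>. cut (\<lambda>\<alpha>. norm (?vt \<alpha>)) \<alpha> - t * cut F \<alpha>) integrable_on {0..1}"
      using int_vt intF by (intro Henstock_Kurzweil_Integration.integrable_diff integrable_on_mult_right)
    show "(\<lambda>\<alpha>. K * cut (\<lambda>\<alpha>. norm (?v \<alpha>)) \<alpha>) integrable_on {0..1}" using int_v by (rule integrable_on_mult_right)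
    show "norm (cut (\<lambda>\<alpha>. norm (?vt \<alpha>)) \<alpha> - t * cut F \<alpha>) \<le> K * cut (\<lambda>\<alpha>. norm (?v \<alpha>)) \<alpha>" if "\<alpha> \<in> {0..1}" for \<alpha>
      using growth[of \<alpha>] that by (auto simp: cut_def)
  qed
  moreover have "integral {0..1} (\<lambda>\<alpha>. cut (\<lambda>\<alpha>. norm (?vt \<alpha>)) \<alpha> - t * cut F \<alpha>)
      = integral {0..1} (cut (\<lambda>\<alpha>. norm (?vt \<alpha>))) - t * integral {0..1} F"
    using int_vt intF
    by (subst Henstock_Kurzweil_Integration.integral_diff) (auto intro: integrable_on_mult_right simp: cuti' integral_mult_right)
  ultimately have "\<bar>integral {0..1} (cut (\<lambda>\<alpha>. norm (?vt \<alpha>))) - t * integral {0..1} F\<bar>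
      \<le> K * integral {0..1} (cut (\<lambda>\<alpha>. norm (?v \<alpha>)))"
    by simp
  then show "\<bar>curve_length (\<lambda>\<alpha>. \<Phi> t (\<gamma> \<alpha>)) - ereal (t * integral {0..1} F)\<bar> \<le> ereal K * curve_length \<gamma>"
    using len by (simp add: \<gamma>t_def[abs_def])
  have "integral {0..1} (cut F) \<le> integral {0..1} (\<lambda>\<alpha>. K * cut (\<lambda>\<alpha>. norm (?v \<alpha>)) \<alpha>)"
  proof (rule integral_le[OF intF])
    show "(\<lambda>\<alpha>. K * cut (\<lambda>\<alpha>. norm (?v \<alpha>)) \<alpha>) integrable_on {0..1}" using int_v by (rule integrable_on_mult_right)
    show "cut F \<alpha> \<le> K * cut (\<lambda>\<alpha>. norm (?v \<alpha>)) \<alpha>" if "\<alpha> \<in> {0..1}" for \<alpha>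
      using growth[of \<alpha>] that by (auto simp: cut_def)
  qed
  then show "ereal (integral {0..1} F) \<le> ereal K * curve_length \<gamma>"
    using len by (simp add: cuti')
qed

end


section \<open>Neighbourhoods of critical points\<close>

text \<open>The Riesz identification of linear forms with vectors. As a bounded linear map it
  transports derivatives and continuity from \<open>fderiv\<close> to gradients.\<close>

definition grad_map :: "((real^2) \<Rightarrow>\<^sub>L real) \<Rightarrow>\<^sub>L (real^2)" where
  "grad_map = Blinfun (\<lambda>\<phi>. \<Sum>i\<in>UNIV. blinfun_apply \<phi> (axis i 1) *\<^sub>R axis i 1)"

lemma grad_map_inner: "blinfun_apply grad_map \<phi> \<bullet> h = blinfun_apply \<phi> h"
proof -
  have "bounded_linear (\<lambda>\<phi>::(real^2) \<Rightarrow>\<^sub>L real. \<Sum>i\<in>(UNIV::2 set). blinfun_apply \<phi> (axis i 1) *\<^sub>R (axis i 1 :: real^2))"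
    by (intro bounded_linear_sum bounded_linear_scaleR_const blinfun.bounded_linear_left)
  then have "blinfun_apply grad_map \<phi> \<bullet> h = (\<Sum>i\<in>UNIV. blinfun_apply \<phi> (axis i 1) * h $ i)"
    by (simp add: grad_map_def bounded_linear_Blinfun_apply inner_sum_left inner_axis')
  also have "\<dots> = blinfun_apply \<phi> (\<Sum>i\<in>UNIV. (h $ i) *\<^sub>R axis i 1)"
    by (simp add: blinfun.sum_right blinfun.scaleR_right mult.commute)
  also have "(\<Sum>i\<in>UNIV. (h $ i) *\<^sub>R axis i 1) = h"
    by (simp add: vec2_eq_iff sum_2 axis_def)
  finally show ?thesis .
qed

definition grad :: "(real^2 \<Rightarrow> real) \<Rightarrow> real^2 \<Rightarrow> real^2" where
  "grad f x = blinfun_apply grad_map (fderiv f x)"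

definition hess :: "(real^2 \<Rightarrow> real) \<Rightarrow> real^2 \<Rightarrow> (real^2) \<Rightarrow>\<^sub>L (real^2)" where
  "hess f x = grad_map o\<^sub>L fderiv (fderiv f) x"

lemma fderiv_works:
  assumes "f differentiable (at x)"
  shows "(f has_derivative blinfun_apply (fderiv f x)) (at x)"
proof -
  have "(f has_derivative frechet_derivative f (at x)) (at x)" using assms frechet_derivative_works by blast
  then show ?thesis
    unfolding fderiv_def by (simp add: bounded_linear_Blinfun_apply has_derivative_bounded_linear)
qed

lemma grad_has_derivative:
  assumes "C2_on f UNIV"
  shows "(f has_derivative (\<lambda>h. grad f x \<bullet> h)) (at x)"
    and "(grad f has_derivative blinfun_apply (hess f x)) (at x)"
    and "continuous_on UNIV (hess f)"
proof -
  have d: "f differentiable (at x)" "fderiv f differentiable (at x)" and c: "continuous_on UNIV (fderiv (fderiv f))"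
    using assms by (auto simp: C2_on_def C1_on_def)
  show "(f has_derivative (\<lambda>h. grad f x \<bullet> h)) (at x)"
    using fderiv_works[OF d(1)] by (simp add: grad_def grad_map_inner)
  show "(grad f has_derivative blinfun_apply (hess f x)) (at x)"
    unfolding grad_def[abs_def] hess_def
    using bounded_linear.has_derivative[OF blinfun.bounded_linear_right fderiv_works[OF d(2)], of grad_map]
    by (simp add: blinfun_compose.rep_eq o_def)
  show "continuous_on UNIV (hess f)"
    unfolding hess_def[abs_def]
    by (intro bounded_bilinear.continuous_on[OF bounded_bilinear_blinfun_compose] continuous_intros c)
qed

section \<open>The homogeneous model of \<open>H\<close> at a critical point\<close>

lemma norm_powr_has_derivative:
  fixes y :: "'a::real_inner"
  assumes "y \<noteq> 0"
  shows "((\<lambda>y. norm y powr a) has_derivative (\<lambda>h. a * norm y powr (a - 2) * (y \<bullet> h))) (at y)"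
proof -
  have n: "norm y > 0" using assms by simp
  have "((\<lambda>y. norm y powr a) has_derivative (\<lambda>h. (a * norm y powr (a - 1)) * (sgn y \<bullet> h))) (at y)"
    by (rule has_derivative_eq_rhs[OF DERIV_compose_FDERIV[OF has_real_derivative_powr[OF n, of a] has_derivative_norm[OF assms]]])
       (simp add: fun_eq_iff inner_commute mult.commute)
  moreover have "(a * norm y powr (a - 1)) * (sgn y \<bullet> h) = a * norm y powr (a - 2) * (y \<bullet> h)" for h
  proof -
    have "norm y powr (a - 1) = norm y powr (a - 2) * norm y"
      using n powr_add[of "norm y" "a - 2" 1] by simp
    then show ?thesis using n by (simp add: sgn_div_norm field_simps)
  qed
  ultimately show ?thesis by simp
qed

text \<open>Gradient of the leading term of the expansion, away from the origin.\<close>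

definition hom_grad :: "real \<Rightarrow> real^2^2 \<Rightarrow> real^2 \<Rightarrow> real^2" where
  "hom_grad m S y = norm y powr (m - 1) *\<^sub>R (S *v y)
     + (1/2 * (m - 1) * norm y powr (m - 3) * (y \<bullet> (S *v y))) *\<^sub>R y"

lemma matrix_has_derivative: "((\<lambda>y. S *v y) has_derivative (\<lambda>h. S *v h)) (at (y::real^2))"
  by (intro bounded_linear_imp_has_derivative matrix_vector_mul_bounded_linear)

lemma sym_matrix_inner:
  assumes "transpose S = (S::real^2^2)"
  shows "(S *v u) \<bullet> w = u \<bullet> (S *v w)"
  using dot_lmul_matrix[of u S w] assms by (metis inner_commute transpose_matrix_vector)

lemma quadratic_has_derivative:
  assumes "transpose S = (S::real^2^2)"
  shows "((\<lambda>y. y \<bullet> (S *v y)) has_derivative (\<lambda>h. 2 * ((S *v y) \<bullet> h))) (at y)"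
  using has_derivative_inner[OF has_derivative_ident matrix_has_derivative[of S y]]
  by (simp add: sym_matrix_inner[OF assms] inner_commute[of "S *v y"] inner_commute[of _ "S *v y"])

lemma hom_has_derivative:
  assumes S: "transpose S = (S::real^2^2)" and y: "y \<noteq> 0"
  shows "((\<lambda>y. 1/2 * norm y powr (m - 1) * (y \<bullet> (S *v y))) has_derivative (\<lambda>h. hom_grad m S y \<bullet> h)) (at y)"
proof -
  have "((\<lambda>y. 1/2 * norm y powr (m - 1) * (y \<bullet> (S *v y))) has_derivative
     (\<lambda>h. (1/2 * norm y powr (m - 1)) * (2 * ((S *v y) \<bullet> h))
        + (1/2 * ((m - 1) * norm y powr ((m - 1) - 2) * (y \<bullet> h))) * (y \<bullet> (S *v y)))) (at y)"
    by (rule has_derivative_mult[OF has_derivative_mult_right[OF norm_powr_has_derivative[OF y]] quadratic_has_derivative[OF S]])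
  then show ?thesis
    by (rule has_derivative_eq_rhs) (simp add: hom_grad_def fun_eq_iff inner_add_left algebra_simps add_divide_distrib diff_divide_distrib)
qed

lemma hom_grad_has_derivative:
  assumes S: "transpose S = (S::real^2^2)" and y: "y \<noteq> 0"
  shows "(hom_grad m S has_derivative
    (\<lambda>h. norm y powr (m - 1) *\<^sub>R (S *v h) + ((m - 1) * norm y powr (m - 1 - 2) * (y \<bullet> h)) *\<^sub>R (S *v y)
      + ((1/2 * (m - 1) * norm y powr (m - 3) * (y \<bullet> (S *v y))) *\<^sub>R h
         + (1/2 * (m - 1) * norm y powr (m - 3) * (2 * ((S *v y) \<bullet> h))
            + (1/2 * (m - 1) * ((m - 3) * norm y powr (m - 3 - 2) * (y \<bullet> h))) * (y \<bullet> (S *v y))) *\<^sub>R y))) (at y)"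
  unfolding hom_grad_def[abs_def]
  by (intro has_derivative_add has_derivative_scaleR has_derivative_mult has_derivative_mult_right
        norm_powr_has_derivative[OF y] quadratic_has_derivative[OF S] matrix_has_derivative has_derivative_ident)

text \<open>Each of the five summands is homogeneous of degree \<open>m - 1\<close> in
  \<open>y\<close>. One carries the coefficient 1, three at most \<open>m - 1\<close>, and the last
  at most \<open>(m - 1) * \<bar>m - 3\<bar>\<close>.\<close>

lemma hom_hess_bound:
  fixes S :: "real^2^2"
  assumes m: "m \<ge> 1" and \<sigma>: "\<And>y. norm (S *v y) \<le> \<sigma> * norm y" "\<sigma> \<ge> 0" and y: "y \<noteq> 0"
  shows "norm (norm y powr (m - 1) *\<^sub>R (S *v h) + ((m - 1) * norm y powr (m - 1 - 2) * (y \<bullet> h)) *\<^sub>R (S *v y)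
      + ((1/2 * (m - 1) * norm y powr (m - 3) * (y \<bullet> (S *v y))) *\<^sub>R h
         + (1/2 * (m - 1) * norm y powr (m - 3) * (2 * ((S *v y) \<bullet> h))
            + (1/2 * (m - 1) * ((m - 3) * norm y powr (m - 3 - 2) * (y \<bullet> h))) * (y \<bullet> (S *v y))) *\<^sub>R y))
    \<le> \<sigma> * (1 + 3 * (m - 1) + (m - 1) * \<bar>m - 3\<bar>) * norm y powr (m - 1) * norm h"
proof -
  let ?r = "norm y"
  have r: "?r > 0" using y by simp
  define k where "k = m - 1"
  have k: "k \<ge> 0" using m by (simp add: k_def)
  define P where "P = ?r powr (m - 1)"
  have P: "P \<ge> 0" by (simp add: P_def)
  have P3: "?r powr (m - 3) * ?r * ?r = P" "?r powr (m - 1 - 2) * ?r * ?r = P"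
    "?r powr (m - 3 - 2) * ?r * ?r * ?r * ?r = P"
    using r powr_add[of ?r "m - 3" 2] powr_add[of ?r "m - 5" 4]
    by (simp_all add: P_def powr_numeral power2_eq_square power4_eq_xxxx mult.assoc)
  have Sy: "norm (S *v y) \<le> \<sigma> * ?r" "norm (S *v h) \<le> \<sigma> * norm h" using \<sigma> by auto
  have yh: "\<bar>y \<bullet> h\<bar> \<le> ?r * norm h" by (rule Cauchy_Schwarz_ineq2)
  have "\<bar>y \<bullet> (S *v y)\<bar> \<le> ?r * norm (S *v y)" by (rule Cauchy_Schwarz_ineq2)
  also have "\<dots> \<le> ?r * (\<sigma> * ?r)" using Sy(1) by (intro mult_left_mono) auto
  finally have Q: "\<bar>y \<bullet> (S *v y)\<bar> \<le> \<sigma> * ?r * ?r" by (simp add: mult_ac)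
  have "\<bar>(S *v y) \<bullet> h\<bar> \<le> norm (S *v y) * norm h" by (rule Cauchy_Schwarz_ineq2)
  also have "\<dots> \<le> (\<sigma> * ?r) * norm h" using Sy(1) by (intro mult_right_mono) auto
  finally have Syh: "\<bar>(S *v y) \<bullet> h\<bar> \<le> \<sigma> * ?r * norm h" .
  have 1: "norm (?r powr (m - 1) *\<^sub>R (S *v h)) \<le> \<sigma> * P * norm h"
  proof -
    have "P * norm (S *v h) \<le> P * (\<sigma> * norm h)" using Sy(2) P by (rule mult_left_mono)
    then show ?thesis using P by (simp add: P_def[symmetric] mult_ac)
  qed
  have 2: "norm ((k * ?r powr (m - 1 - 2) * (y \<bullet> h)) *\<^sub>R (S *v y)) \<le> \<sigma> * k * P * norm h"
  proof -
    have "norm ((k * ?r powr (m - 1 - 2) * (y \<bullet> h)) *\<^sub>R (S *v y))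
        = k * ?r powr (m - 1 - 2) * (\<bar>y \<bullet> h\<bar> * norm (S *v y))" using k by (simp add: abs_mult)
    also have "\<dots> \<le> k * ?r powr (m - 1 - 2) * ((?r * norm h) * (\<sigma> * ?r))"
      by (rule mult_left_mono[OF mult_mono[OF yh Sy(1)]]) (use k in auto)
    also have "\<dots> = \<sigma> * k * (?r powr (m - 1 - 2) * ?r * ?r) * norm h" by (simp only: mult_ac)
    finally show ?thesis by (simp only: P3)
  qed
  have 3: "norm ((1/2 * k * ?r powr (m - 3) * (y \<bullet> (S *v y))) *\<^sub>R h) \<le> \<sigma> * k * P * norm h"
  proof -
    have "norm ((1/2 * k * ?r powr (m - 3) * (y \<bullet> (S *v y))) *\<^sub>R h)
        = k * ?r powr (m - 3) * norm h * (\<bar>y \<bullet> (S *v y)\<bar> * (1/2))" using k by (simp add: abs_mult)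
    also have "\<dots> \<le> k * ?r powr (m - 3) * norm h * ((\<sigma> * ?r * ?r) * 1)"
      by (rule mult_left_mono[OF mult_mono[OF Q]]) (use k \<sigma> in auto)
    also have "\<dots> = \<sigma> * k * (?r powr (m - 3) * ?r * ?r) * norm h" by (simp only: mult_ac mult_1_right)
    finally show ?thesis by (simp only: P3)
  qed
  have 4: "norm ((1/2 * k * ?r powr (m - 3) * (2 * ((S *v y) \<bullet> h))) *\<^sub>R y) \<le> \<sigma> * k * P * norm h"
  proof -
    have "norm ((1/2 * k * ?r powr (m - 3) * (2 * ((S *v y) \<bullet> h))) *\<^sub>R y)
        = k * ?r powr (m - 3) * ?r * \<bar>(S *v y) \<bullet> h\<bar>" using k by (simp add: abs_mult)
    also have "\<dots> \<le> k * ?r powr (m - 3) * ?r * (\<sigma> * ?r * norm h)"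
      by (rule mult_left_mono[OF Syh]) (use k in auto)
    also have "\<dots> = \<sigma> * k * (?r powr (m - 3) * ?r * ?r) * norm h" by (simp only: mult_ac)
    finally show ?thesis by (simp only: P3)
  qed
  have 5: "norm (((1/2 * k * ((m - 3) * ?r powr (m - 3 - 2) * (y \<bullet> h))) * (y \<bullet> (S *v y))) *\<^sub>R y)
      \<le> \<sigma> * (k * \<bar>m - 3\<bar>) * P * norm h"
  proof -
    have "norm (((1/2 * k * ((m - 3) * ?r powr (m - 3 - 2) * (y \<bullet> h))) * (y \<bullet> (S *v y))) *\<^sub>R y)
        = k * \<bar>m - 3\<bar> * ?r powr (m - 3 - 2) * ?r * (\<bar>y \<bullet> h\<bar> * (\<bar>y \<bullet> (S *v y)\<bar> * (1/2)))"
      using k by (simp add: abs_mult)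
    also have "\<dots> \<le> k * \<bar>m - 3\<bar> * ?r powr (m - 3 - 2) * ?r * ((?r * norm h) * ((\<sigma> * ?r * ?r) * 1))"
      by (rule mult_left_mono[OF mult_mono[OF yh mult_mono[OF Q]]]) (use k \<sigma> in auto)
    also have "\<dots> = \<sigma> * (k * \<bar>m - 3\<bar>) * (?r powr (m - 3 - 2) * ?r * ?r * ?r * ?r) * norm h"
      by (simp only: mult_ac mult_1_right)
    finally show ?thesis by (simp only: P3)
  qed
  have "norm (?r powr (m - 1) *\<^sub>R (S *v h) + (k * ?r powr (m - 1 - 2) * (y \<bullet> h)) *\<^sub>R (S *v y)
      + ((1/2 * k * ?r powr (m - 3) * (y \<bullet> (S *v y))) *\<^sub>R h
         + (1/2 * k * ?r powr (m - 3) * (2 * ((S *v y) \<bullet> h))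
            + (1/2 * k * ((m - 3) * ?r powr (m - 3 - 2) * (y \<bullet> h))) * (y \<bullet> (S *v y))) *\<^sub>R y))
    \<le> \<sigma> * P * norm h + \<sigma> * k * P * norm h + (\<sigma> * k * P * norm h + (\<sigma> * k * P * norm h + \<sigma> * (k * \<bar>m - 3\<bar>) * P * norm h))"
    unfolding scaleR_add_left by (intro norm_triangle_mono 1 2 3 4 5)
  also have "\<dots> = \<sigma> * (1 + 3 * k + k * \<bar>m - 3\<bar>) * P * norm h" by (simp add: algebra_simps)
  finally show ?thesis by (simp only: k_def P_def)
qed

text \<open>The expansion is differentiated on a punctured ball where it holds, and little-o turns
  into explicit radii. For the Hessian only an upper bound is kept: \<open>C0\<close> from the model
  and 1 for the remainder.\<close>

theorem critical_expansion:
  fixes H :: "real^2 \<Rightarrow> real"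
  assumes H: "C2_on H UNIV" and hom: "homogeneous_expansion_at H p"
  obtains m S C where "m \<ge> 1" "transpose S = S" "invertible S" "C \<ge> 0"
    "\<And>\<epsilon>. \<epsilon> > 0 \<Longrightarrow> \<exists>\<rho>>0. \<forall>y. 0 < norm y \<and> norm y < \<rho> \<longrightarrow>
       \<bar>H (p + y) - H p - 1/2 * norm y powr (m - 1) * (y \<bullet> (S *v y))\<bar> \<le> \<epsilon> * norm y powr (m + 1)"
    "\<And>\<epsilon>. \<epsilon> > 0 \<Longrightarrow> \<exists>\<rho>>0. \<forall>y. 0 < norm y \<and> norm y < \<rho> \<longrightarrow>
       norm (grad H (p + y) - hom_grad m S y) \<le> \<epsilon> * norm y powr m"
    "\<exists>\<rho>>0. \<forall>y. 0 < norm y \<and> norm y < \<rho> \<longrightarrow> norm (hess H (p + y)) \<le> C * norm y powr (m - 1)"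
proof -
  obtain m S R where m: "m \<ge> 1" and S: "transpose S = S" "invertible S" and R: "C2_on R UNIV"
    and ex: "\<forall>\<^sub>F y in nhds 0. H (p + y) - H p = 1/2 * norm y powr (m - 1) * (y \<bullet> (S *v y)) + R y"
    and o0: "(\<lambda>y. norm (R y)) \<in> o[at 0](\<lambda>y. norm y powr (m + 1))"
    and o1: "(\<lambda>y. norm (fderiv R y)) \<in> o[at 0](\<lambda>y. norm y powr m)"
    and o2: "(\<lambda>y. norm (fderiv (fderiv R) y)) \<in> o[at 0](\<lambda>y. norm y powr (m - 1))"
    using hom unfolding homogeneous_expansion_at_def by blast
  obtain \<rho>0 where \<rho>0: "\<rho>0 > 0" "\<And>y. norm y < \<rho>0 \<Longrightarrow>
      H (p + y) - H p = 1/2 * norm y powr (m - 1) * (y \<bullet> (S *v y)) + R y"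
    using ex by (auto simp: eventually_nhds_metric)
  \<comment> \<open>The factor \<open>c\<close> takes up the norm of \<open>grad_map\<close> when
    derivatives of \<open>R\<close> are replaced by its gradient and Hessian.\<close>
  have small: "\<exists>\<rho>>0. \<forall>y. 0 < norm y \<and> norm y < \<rho> \<longrightarrow> f y \<le> \<epsilon> * norm y powr a"
    if g: "(\<lambda>y. norm (g y)) \<in> o[at 0](\<lambda>y. norm y powr a)" and "\<epsilon> > 0" "c \<ge> 0" "\<And>y. f y \<le> c * norm (g y)"
    for f :: "real^2 \<Rightarrow> real" and g :: "real^2 \<Rightarrow> 'b::real_normed_vector" and a c \<epsilon> :: real
  proof -
    have pos: "\<epsilon> / (c + 1) > 0" using that by simp
    obtain \<rho> where \<rho>: "\<rho> > 0" "\<And>y. y \<noteq> 0 \<Longrightarrow> norm y < \<rho> \<Longrightarrow> norm (g y) \<le> \<epsilon> / (c + 1) * norm y powr a"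
      using landau_o.smallD[OF g pos] by (auto simp: eventually_at)
    have "f y \<le> \<epsilon> * norm y powr a" if y: "0 < norm y" "norm y < \<rho>" for y
    proof -
      have "f y \<le> (c + 1) * norm (g y)" using \<open>\<And>y. f y \<le> c * norm (g y)\<close>[of y] by (simp add: distrib_right add_increasing2)
      also have "\<dots> \<le> (c + 1) * (\<epsilon> / (c + 1) * norm y powr a)"
        using \<rho>(2)[of y] y \<open>c \<ge> 0\<close> by (intro mult_left_mono) auto
      also have "\<dots> = \<epsilon> * norm y powr a" using \<open>c \<ge> 0\<close> by simp
      finally show ?thesis .
    qed
    with \<rho>(1) show ?thesis by blast
  qed
  have g: "grad H (p + y) = hom_grad m S y + grad R y" if y: "y \<noteq> 0" "norm y < \<rho>0" for y
  proof -
    have "((\<lambda>y. p + y) has_derivative (\<lambda>h. h)) (at y)" by (auto intro!: derivative_eq_intros)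
    from has_derivative_compose[OF this grad_has_derivative(1)[OF H]]
    have D1: "((\<lambda>y. H (p + y)) has_derivative (\<lambda>h. grad H (p + y) \<bullet> h)) (at y)" .
    have "((\<lambda>y. H p + (1/2 * norm y powr (m - 1) * (y \<bullet> (S *v y)) + R y)) has_derivative
        (\<lambda>h. 0 + (hom_grad m S y \<bullet> h + grad R y \<bullet> h))) (at y)"
      by (intro has_derivative_add has_derivative_const hom_has_derivative[OF S(1) y(1)] grad_has_derivative(1)[OF R])
    then have D2: "((\<lambda>y. H (p + y)) has_derivative (\<lambda>h. 0 + (hom_grad m S y \<bullet> h + grad R y \<bullet> h))) (at y)"
    proof (rule has_derivative_transform_within_open[of _ _ _ _ "ball 0 \<rho>0"])
      show "H p + (1/2 * norm z powr (m - 1) * (z \<bullet> (S *v z)) + R z) = H (p + z)" if "z \<in> ball 0 \<rho>0" for z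
        using \<rho>0(2)[of z] that by simp
    qed (use y in auto)
    have "grad H (p + y) \<bullet> h = (hom_grad m S y + grad R y) \<bullet> h" for h
      using fun_cong[OF has_derivative_unique[OF D1 D2], of h] by (simp add: inner_add_left)
    then show ?thesis using vector_eq_rdot by blast
  qed
  obtain \<sigma> where \<sigma>: "\<And>y. norm (S *v y) \<le> \<sigma> * norm y" "\<sigma> \<ge> 0"
  proof -
    obtain K where "0 \<le> K" "\<And>y. norm (S *v y) \<le> norm y * K"
      using bounded_linear.nonneg_bounded[OF matrix_vector_mul_bounded_linear[of S]] by blast
    then show thesis by (intro that[of K]) (simp_all add: mult.commute)
  qed
  define C0 where "C0 = \<sigma> * (1 + 3 * (m - 1) + (m - 1) * \<bar>m - 3\<bar>)"
  have C0: "C0 \<ge> 0" using \<sigma> m by (simp add: C0_def)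
  have h: "norm (hess H (p + y)) \<le> C0 * norm y powr (m - 1) + norm (hess R y)" if y: "y \<noteq> 0" "norm y < \<rho>0" for y
  proof (rule norm_blinfun_bound)
    show "0 \<le> C0 * norm y powr (m - 1) + norm (hess R y)" using C0 by simp
    fix k :: "real^2"
    have "((\<lambda>y. p + y) has_derivative (\<lambda>h. h)) (at y)" by (auto intro!: derivative_eq_intros)
    from has_derivative_compose[OF this grad_has_derivative(2)[OF H]]
    have D1: "((\<lambda>y. grad H (p + y)) has_derivative blinfun_apply (hess H (p + y))) (at y)" .
    note D = has_derivative_add[OF hom_grad_has_derivative[OF S(1) y(1), of m] grad_has_derivative(2)[OF R, of y]]
    have D2: "((\<lambda>y. grad H (p + y)) has_derivative (\<lambda>h. (norm y powr (m - 1) *\<^sub>R (S *v h) + ((m - 1) * norm y powr (m - 1 - 2) * (y \<bullet> h)) *\<^sub>R (S *v y)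
      + ((1/2 * (m - 1) * norm y powr (m - 3) * (y \<bullet> (S *v y))) *\<^sub>R h
         + (1/2 * (m - 1) * norm y powr (m - 3) * (2 * ((S *v y) \<bullet> h))
            + (1/2 * (m - 1) * ((m - 3) * norm y powr (m - 3 - 2) * (y \<bullet> h))) * (y \<bullet> (S *v y))) *\<^sub>R y))
       + hess R y h)) (at y)"
      by (rule has_derivative_transform_within_open[OF D, of "ball 0 \<rho>0 - {0}"])
         (use y g in \<open>auto simp: open_Diff\<close>)
    have "norm (hess H (p + y) k) \<le> C0 * norm y powr (m - 1) * norm k + norm (hess R y) * norm k"
      unfolding fun_cong[OF has_derivative_unique[OF D1 D2], of k] C0_def
      by (rule norm_triangle_mono[OF hom_hess_bound[OF m \<sigma> y(1)] norm_blinfun])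
    then show "norm (hess H (p + y) k) \<le> (C0 * norm y powr (m - 1) + norm (hess R y)) * norm k"
      by (simp only: distrib_right)
  qed
  show thesis
  proof (rule that[of m S "C0 + 1", OF m S])
    show "C0 + 1 \<ge> 0" using C0 by simp
  next
    fix \<epsilon> :: real assume "\<epsilon> > 0"
    then obtain \<rho> where \<rho>: "\<rho> > 0" "\<And>y. 0 < norm y \<Longrightarrow> norm y < \<rho> \<Longrightarrow> \<bar>R y\<bar> \<le> \<epsilon> * norm y powr (m + 1)"
      using small[OF o0, of \<epsilon> 1 "\<lambda>y. \<bar>R y\<bar>"] by auto
    show "\<exists>\<rho>>0. \<forall>y. 0 < norm y \<and> norm y < \<rho> \<longrightarrow>
       \<bar>H (p + y) - H p - 1/2 * norm y powr (m - 1) * (y \<bullet> (S *v y))\<bar> \<le> \<epsilon> * norm y powr (m + 1)"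
      using \<rho> \<rho>0 by (intro exI[of _ "min \<rho> \<rho>0"]) auto
  next
    fix \<epsilon> :: real assume "\<epsilon> > 0"
    then obtain \<rho> where \<rho>: "\<rho> > 0" "\<And>y. 0 < norm y \<Longrightarrow> norm y < \<rho> \<Longrightarrow> norm (grad R y) \<le> \<epsilon> * norm y powr m"
      using small[OF o1, of \<epsilon> "norm grad_map" "\<lambda>y. norm (grad R y)"] norm_blinfun[of grad_map]
      by (auto simp: grad_def)
    show "\<exists>\<rho>>0. \<forall>y. 0 < norm y \<and> norm y < \<rho> \<longrightarrow> norm (grad H (p + y) - hom_grad m S y) \<le> \<epsilon> * norm y powr m"
      using \<rho> \<rho>0 g by (intro exI[of _ "min \<rho> \<rho>0"]) auto
  next
    obtain \<rho> where \<rho>: "\<rho> > 0" "\<And>y. 0 < norm y \<Longrightarrow> norm y < \<rho> \<Longrightarrow> norm (hess R y) \<le> 1 * norm y powr (m - 1)"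
      using small[OF o2, of 1 "norm grad_map" "\<lambda>y. norm (hess R y)"] norm_blinfun_compose[of grad_map]
      by (auto simp: hess_def)
    have "norm (hess H (p + y)) \<le> (C0 + 1) * norm y powr (m - 1)" if "0 < norm y" "norm y < min \<rho> \<rho>0" for y
      using h[of y] \<rho>(2)[of y] that by (simp add: distrib_right)
    then show "\<exists>\<rho>>0. \<forall>y. 0 < norm y \<and> norm y < \<rho> \<longrightarrow> norm (hess H (p + y)) \<le> (C0 + 1) * norm y powr (m - 1)"
      using \<rho>(1) \<rho>0(1) by (intro exI[of _ "min \<rho> \<rho>0"]) auto
  qed
qed

lemma invertible_lower_bound:
  assumes "invertible (S::real^2^2)"
  obtains s where "s > 0" "\<And>y. s * norm y \<le> norm (S *v y)"
proof -
  obtain S' where S': "S' ** S = mat 1" using assms by (auto simp: invertible_def)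
  obtain K where K: "K > 0" "\<And>y. norm (S' *v y) \<le> norm y * K"
    using bounded_linear.pos_bounded[OF matrix_vector_mul_bounded_linear[of S']] by blast
  have "1 / K * norm y \<le> norm (S *v y)" for y
  proof -
    have "y = S' *v (S *v y)" by (simp add: matrix_vector_mul_assoc S')
    then have "norm y \<le> norm (S *v y) * K" using K(2)[of "S *v y"] by simp
    then show ?thesis using K(1) by (simp add: divide_le_eq)
  qed
  then show thesis using that[of "1 / K"] K(1) by simp
qed

lemma rot_pythagoras: "(n \<bullet> w)\<^sup>2 + (rot n \<bullet> w)\<^sup>2 = (norm n)\<^sup>2 * (norm w)\<^sup>2"
  by (simp add: inner_vec2 power2_norm_eq_inner) (simp add: power2_eq_square algebra_simps)

lemma powr_shift_norm:
  fixes r :: real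
  assumes "r > 0"
  shows "r powr m = r powr (m - 1) * r" "r powr (m + 1) = r powr (m - 1) * r\<^sup>2" "r powr (m - 3) * r\<^sup>2 = r powr (m - 1)"
proof -
  show "r powr m = r powr (m - 1) * r" using assms powr_add[of r "m - 1" 1] by simp
  show "r powr (m + 1) = r powr (m - 1) * r\<^sup>2" using assms powr_add[of r "m - 1" 2] by (simp add: powr_numeral add.commute)
  show "r powr (m - 3) * r\<^sup>2 = r powr (m - 1)" using assms powr_add[of r "m - 3" 2] by (simp add: powr_numeral)
qed

section \<open>Level sets and definiteness at a critical point\<close>

context planar_hamiltonian_flow
begin

definition expands_at :: "real^2 \<Rightarrow> real \<Rightarrow> real^2^2 \<Rightarrow> real \<Rightarrow> bool" where
  "expands_at p m S C \<longleftrightarrow> m \<ge> 1 \<and> transpose S = S \<and> invertible S \<and> C \<ge> 0 \<and>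
    (\<forall>\<epsilon>>0. \<exists>\<rho>>0. \<forall>y. 0 < norm y \<and> norm y < \<rho> \<longrightarrow>
       \<bar>H (p + y) - H p - 1/2 * norm y powr (m - 1) * (y \<bullet> (S *v y))\<bar> \<le> \<epsilon> * norm y powr (m + 1)) \<and>
    (\<forall>\<epsilon>>0. \<exists>\<rho>>0. \<forall>y. 0 < norm y \<and> norm y < \<rho> \<longrightarrow>
       norm (N (p + y) - hom_grad m S y) \<le> \<epsilon> * norm y powr m) \<and>
    (\<exists>\<rho>>0. \<forall>y. 0 < norm y \<and> norm y < \<rho> \<longrightarrow> norm (A (p + y)) \<le> C * norm y powr (m - 1))"

lemma expands_atE:
  assumes "expands_at p m S C" and e: "\<epsilon> > 0"
  obtains \<rho> where "\<rho> > 0"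
    "\<And>y. 0 < norm y \<Longrightarrow> norm y < \<rho> \<Longrightarrow>
       \<bar>H (p + y) - H p - 1/2 * norm y powr (m - 1) * (y \<bullet> (S *v y))\<bar> \<le> \<epsilon> * (norm y powr (m - 1) * (norm y)\<^sup>2)"
    "\<And>y. 0 < norm y \<Longrightarrow> norm y < \<rho> \<Longrightarrow>
       norm (N (p + y) - hom_grad m S y) \<le> \<epsilon> * (norm y powr (m - 1) * norm y)"
    "\<And>y. 0 < norm y \<Longrightarrow> norm y < \<rho> \<Longrightarrow> norm (A (p + y)) \<le> C * norm y powr (m - 1)"
proof -
  obtain \<rho>1 where 1: "\<rho>1 > 0" "\<And>y. 0 < norm y \<Longrightarrow> norm y < \<rho>1 \<Longrightarrow>
       \<bar>H (p + y) - H p - 1/2 * norm y powr (m - 1) * (y \<bullet> (S *v y))\<bar> \<le> \<epsilon> * norm y powr (m + 1)"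
    using assms unfolding expands_at_def by meson
  obtain \<rho>2 where 2: "\<rho>2 > 0" "\<And>y. 0 < norm y \<Longrightarrow> norm y < \<rho>2 \<Longrightarrow>
       norm (N (p + y) - hom_grad m S y) \<le> \<epsilon> * norm y powr m"
    using assms unfolding expands_at_def by meson
  obtain \<rho>3 where 3: "\<rho>3 > 0" "\<And>y. 0 < norm y \<Longrightarrow> norm y < \<rho>3 \<Longrightarrow> norm (A (p + y)) \<le> C * norm y powr (m - 1)"
    using assms unfolding expands_at_def by meson
  show thesis
  proof (rule that[of "min (min \<rho>1 \<rho>2) \<rho>3"])
    fix y :: "real^2" assume y: "0 < norm y" "norm y < min (min \<rho>1 \<rho>2) \<rho>3"
    show "\<bar>H (p + y) - H p - 1/2 * norm y powr (m - 1) * (y \<bullet> (S *v y))\<bar> \<le> \<epsilon> * (norm y powr (m - 1) * (norm y)\<^sup>2)"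
      using 1(2)[of y] y unfolding powr_shift_norm(2)[OF y(1)] by simp
    show "norm (N (p + y) - hom_grad m S y) \<le> \<epsilon> * (norm y powr (m - 1) * norm y)"
      using 2(2)[of y] y unfolding powr_shift_norm(1)[OF y(1), of m] by simp
    show "norm (A (p + y)) \<le> C * norm y powr (m - 1)" using 3(2)[of y] y by simp
  qed (use 1 2 3 in auto)
qed

text \<open>For \<open>H (p + y) = H p\<close> the vectors \<open>y\<close> and \<open>S *v y\<close> are almost orthogonal, so that the velocity,
  almost a multiple of \<open>rot (S *v y)\<close>, is almost radial.\<close>

lemma radial_velocity_on_level:
  assumes ex: "expands_at p m S C"
  obtains \<rho> where "\<rho> > 0" "\<And>y. 0 < norm y \<Longrightarrow> norm y < \<rho> \<Longrightarrow> H (p + y) = H p \<Longrightarrow> W (p + y) \<bullet> y \<noteq> 0"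
proof -
  have S: "invertible S" using ex by (simp add: expands_at_def)
  obtain s where s: "s > 0" "\<And>y. s * norm y \<le> norm (S *v y)" using invertible_lower_bound[OF S] by metis
  \<comment> \<open>With error \<open>s / 4\<close>, on the level of \<open>p\<close> the radial
    product \<open>?Q\<close> is at most \<open>s / 2\<close> times the squared radius. By
    Pythagoras \<open>?Z\<close> is then at least as large, which beats the gradient error
    \<open>s / 4\<close>.\<close>
  obtain \<rho> where \<rho>: "\<rho> > 0"
    "\<And>y. 0 < norm y \<Longrightarrow> norm y < \<rho> \<Longrightarrow>
       \<bar>H (p + y) - H p - 1/2 * norm y powr (m - 1) * (y \<bullet> (S *v y))\<bar> \<le> s / 4 * (norm y powr (m - 1) * (norm y)\<^sup>2)"
    "\<And>y. 0 < norm y \<Longrightarrow> norm y < \<rho> \<Longrightarrow>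
       norm (N (p + y) - hom_grad m S y) \<le> s / 4 * (norm y powr (m - 1) * norm y)"
    using expands_atE[OF ex, of "s / 4"] s(1) by (metis divide_pos_pos zero_less_numeral)
  show thesis
  proof (rule that[OF \<rho>(1)])
    fix y assume y: "0 < norm y" "norm y < \<rho>" "H (p + y) = H p"
    let ?r = "norm y" and ?Q = "y \<bullet> (S *v y)" and ?Z = "rot y \<bullet> (S *v y)"
    define P where "P = ?r powr (m - 1)"
    have P: "P > 0" using y by (simp add: P_def)
    have "P * (\<bar>?Q\<bar> / 2) \<le> P * (s / 4 * ?r\<^sup>2)"
      using \<rho>(2)[OF y(1,2)] y(3) P by (simp add: P_def[symmetric] abs_mult mult_ac)
    then have Q: "\<bar>?Q\<bar> \<le> s / 2 * ?r\<^sup>2" using P by simp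
    then have Q2: "?Q\<^sup>2 \<le> (s / 2 * ?r\<^sup>2)\<^sup>2" by (metis abs_ge_zero power2_abs power_mono)
    have "(s * ?r)\<^sup>2 \<le> (norm (S *v y))\<^sup>2" using s by (intro power_mono) auto
    then have "?r\<^sup>2 * (s * ?r)\<^sup>2 \<le> ?Q\<^sup>2 + ?Z\<^sup>2" unfolding rot_pythagoras by (intro mult_left_mono) auto
    moreover have "?r\<^sup>2 * (s * ?r)\<^sup>2 = 4 * (s / 2 * ?r\<^sup>2)\<^sup>2" by (simp add: power2_eq_square)
    ultimately have "4 * (s / 2 * ?r\<^sup>2)\<^sup>2 \<le> (s / 2 * ?r\<^sup>2)\<^sup>2 + ?Z\<^sup>2" using Q2 by linarith
    moreover have "0 \<le> (s / 2 * ?r\<^sup>2)\<^sup>2" by simp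
    ultimately have "(s / 2 * ?r\<^sup>2)\<^sup>2 \<le> \<bar>?Z\<bar>\<^sup>2" unfolding power2_abs by linarith
    then have Z: "s / 2 * ?r\<^sup>2 \<le> \<bar>?Z\<bar>" by (rule power2_le_imp_le) simp
    define e where "e = N (p + y) - hom_grad m S y"
    have "N (p + y) \<bullet> rot y = P * ?Z + e \<bullet> rot y"
    proof -
      have "N (p + y) = hom_grad m S y + e" by (simp add: e_def)
      moreover have "hom_grad m S y \<bullet> rot y = P * ?Z"
        by (simp add: hom_grad_def inner_add_right P_def inner_commute[of _ "rot y"])
      ultimately show ?thesis by (simp add: inner_add_left)
    qed
    moreover have "\<bar>e \<bullet> rot y\<bar> \<le> s / 4 * (P * ?r\<^sup>2)"
    proof -
      have "\<bar>e \<bullet> rot y\<bar> \<le> norm e * ?r" using Cauchy_Schwarz_ineq2[of e "rot y"] by simp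
      also have "\<dots> \<le> s / 4 * (P * ?r) * ?r" using \<rho>(3)[OF y(1,2)] by (intro mult_right_mono) (auto simp: e_def P_def)
      finally show ?thesis by (simp add: power2_eq_square mult_ac)
    qed
    moreover have "\<bar>P * ?Z\<bar> \<ge> P * (s / 2 * ?r\<^sup>2)" using mult_left_mono[OF Z, of P] P by (simp add: abs_mult)
    moreover have "s / 4 * (P * ?r\<^sup>2) < P * (s / 2 * ?r\<^sup>2)" using s(1) P y by simp
    ultimately have "N (p + y) \<bullet> rot y \<noteq> 0" by linarith
    then show "W (p + y) \<bullet> y \<noteq> 0" by (simp add: W_def rot_inner)
  qed
qed

text \<open>On a periodic orbit the distance to \<open>p\<close> attains a minimum, where the velocity has no radial part.\<close>

lemma critical_level_not_periodic:
  assumes x: "x \<in> X" and p: "N p = 0"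
    and \<rho>: "\<And>y. 0 < norm y \<Longrightarrow> norm y < \<rho> \<Longrightarrow> H (p + y) = H p \<Longrightarrow> W (p + y) \<bullet> y \<noteq> 0"
    and near: "norm (x - p) < \<rho>" and level: "H x = H p"
  shows "\<not> is_period x T"
proof
  assume T: "is_period x T"
  have T0: "T > 0" using T by (simp add: is_period_def)
  have Nx: "N x \<noteq> 0" using is_period_noncritical[OF x T] .
  define u where "u s = (norm (\<Phi> s x - p))\<^sup>2" for s
  have "continuous_on {0..T} u" unfolding u_def using flow_continuous[OF x] by (intro continuous_intros)
  then obtain s1 where s1: "s1 \<in> {0..T}" "\<And>s. s \<in> {0..T} \<Longrightarrow> u s1 \<le> u s"
    using continuous_attains_inf[of "{0..T}" u] T0 by auto
  \<comment> \<open>A minimum at time 0 is moved by one period, so that a two-sided neighbourhood of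
    positive times is available.\<close>
  define s2 where "s2 = (if s1 = 0 then T else s1)"
  have uper: "u (s + T) = u s" if "0 \<le> s" for s
    using flow_period_shift[OF x T that, of 1] by (simp add: u_def add.commute)
  have s2: "0 < s2" "s2 \<le> T" "u s2 = u s1" using s1(1) T0 uper[of 0] by (auto simp: s2_def)
  have d: "(u has_real_derivative 2 * ((\<Phi> s2 x - p) \<bullet> W (\<Phi> s2 x))) (at s2)"
  proof -
    have dy: "((\<lambda>s. \<Phi> s x - p) has_derivative (\<lambda>h. h *\<^sub>R W (\<Phi> s2 x))) (at s2)"
      using flow_deriv_W[OF x, of s2] unfolding has_vector_derivative_def by (auto intro!: derivative_eq_intros)
    show ?thesis
      unfolding u_def power2_norm_eq_inner has_field_derivative_def
      by (rule has_derivative_eq_rhs[OF has_derivative_inner[OF dy dy]]) (simp add: fun_eq_iff inner_commute)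
  qed
  have "2 * ((\<Phi> s2 x - p) \<bullet> W (\<Phi> s2 x)) = 0"
  proof (rule DERIV_local_min[OF d s2(1)], intro allI impI)
    fix s assume s: "\<bar>s2 - s\<bar> < s2"
    show "u s2 \<le> u s"
    proof (cases "s \<le> T")
      case True
      then show ?thesis using s s1(2) s2(3) by auto
    next
      case False
      then have "u s = u (s - T)" "s - T \<in> {0..T}" using uper[of "s - T"] s s2 by auto
      then show ?thesis using s1(2) s2(3) by auto
    qed
  qed
  moreover have "0 < norm (\<Phi> s2 x - p)"
  proof -
    have "N (\<Phi> s2 x) \<noteq> 0" using flow_noncritical[OF x Nx] .
    then show ?thesis using p by auto
  qed
  moreover have "norm (\<Phi> s2 x - p) < \<rho>"
  proof -
    have "u s2 \<le> u 0" using s1(2)[of 0] s2(3) T0 by simp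
    then have "norm (\<Phi> s2 x - p) \<le> norm (x - p)" by (simp add: u_def flow_0[OF x] power2_le_iff_abs_le)
    with near show ?thesis by simp
  qed
  moreover have "H (p + (\<Phi> s2 x - p)) = H p" using H_flow[OF x] level by simp
  ultimately show False using \<rho>[of "\<Phi> s2 x - p"] by (simp add: inner_commute)
qed

text \<open>A punctured disc is connected, so \<open>H - H p\<close> has one sign
  \<open>\<sigma>\<close> there. The leading term then makes \<open>\<sigma> S\<close> semidefinite,
  nonsingularity makes it definite, and \<open>c\<close> is the minimum of the form on the unit
  circle.\<close>

lemma expands_at_definite:
  assumes ex: "expands_at p m S C" and \<rho>0: "\<rho>0 > 0" "\<And>y. 0 < norm y \<Longrightarrow> norm y < \<rho>0 \<Longrightarrow> H (p + y) \<noteq> H p"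
  obtains \<sigma> c where "\<sigma> = 1 \<or> \<sigma> = - 1" "c > 0" "\<And>y. c * (norm y)\<^sup>2 \<le> \<sigma> * (y \<bullet> (S *v y))"
proof -
  have m: "m \<ge> 1" and St: "transpose S = S" and Si: "invertible S" using ex by (auto simp: expands_at_def)
  obtain s where s: "s > 0" "\<And>y. s * norm y \<le> norm (S *v y)" using invertible_lower_bound[OF Si] by metis
  let ?B = "ball p \<rho>0 - {p}"
  have "connected ?B" by (rule connected_punctured_ball) simp
  then have conn: "connected ((\<lambda>x. H x - H p) ` ?B)"
    by (intro connected_continuous_image continuous_intros H_continuous)
  have nz: "H x - H p \<noteq> 0" if "x \<in> ?B" for x
    using \<rho>0(2)[of "x - p"] that by (auto simp: dist_norm norm_minus_commute)
  obtain \<sigma> :: real where \<sigma>: "\<sigma> = 1 \<or> \<sigma> = - 1" "\<And>x. x \<in> ?B \<Longrightarrow> \<sigma> * (H x - H p) > 0"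
  proof (cases "\<exists>x\<in>?B. H x - H p > 0")
    case True
    then obtain x1 where x1: "x1 \<in> ?B" "H x1 - H p > 0" by blast
    have pos: "H x - H p > 0" if x: "x \<in> ?B" for x
    proof (rule ccontr)
      assume "\<not> H x - H p > 0"
      then have "0 \<in> (\<lambda>x. H x - H p) ` ?B"
        by (intro connectedD_interval[OF conn imageI[OF x] imageI[OF x1(1)]]) (use x1(2) in auto)
      then obtain z where "z \<in> ?B" "0 = H z - H p" by (rule imageE)
      then show False using nz[of z] by simp
    qed
    show thesis by (rule that[of 1]) (use pos in \<open>simp_all only: mult_1_left simp_thms\<close>)
  next
    case False
    have neg: "- 1 * (H x - H p) > 0" if "x \<in> ?B" for x
    proof -
      have "\<not> H x - H p > 0" using False that by blast
      then show ?thesis using nz[OF that] by simp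
    qed
    show thesis by (rule that[of "-1"]) (use neg in \<open>simp_all only: simp_thms\<close>)
  qed
  have psd: "\<sigma> * (y \<bullet> (S *v y)) \<ge> 0" for y
  proof (rule ccontr)
    assume neg: "\<not> ?thesis"
    then have y0: "norm y > 0" by auto
    define q where "q = - (\<sigma> * (y \<bullet> (S *v y)))"
    have q: "q > 0" using neg by (simp add: q_def)
    \<comment> \<open>At this size the error at most cancels a negative leading term, contradicting
      the strict sign of \<open>H - H p\<close>.\<close>
    define \<epsilon> where "\<epsilon> = q / (2 * (norm y)\<^sup>2)"
    have \<epsilon>: "\<epsilon> > 0" using q y0 by (simp add: \<epsilon>_def)
    obtain \<rho> where \<rho>: "\<rho> > 0" "\<And>y. 0 < norm y \<Longrightarrow> norm y < \<rho> \<Longrightarrow>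
       \<bar>H (p + y) - H p - 1/2 * norm y powr (m - 1) * (y \<bullet> (S *v y))\<bar> \<le> \<epsilon> * (norm y powr (m - 1) * (norm y)\<^sup>2)"
      using expands_atE[OF ex \<epsilon>] by metis
    define t where "t = min \<rho> \<rho>0 / (2 * norm y)"
    have t: "t > 0" using \<rho>(1) \<rho>0(1) y0 by (simp add: t_def)
    let ?y = "t *\<^sub>R y"
    have "norm ?y = min \<rho> \<rho>0 / 2" using \<rho>(1) \<rho>0(1) y0 by (simp add: t_def abs_of_pos)
    then have ny': "0 < norm ?y" "norm ?y < \<rho>" "norm ?y < \<rho>0" using \<rho>(1) \<rho>0(1) by auto
    define P where "P = norm ?y powr (m - 1)"
    have P: "P > 0" unfolding P_def using t y0 by simp
    have "\<sigma> * (H (p + ?y) - H p) > 0" using ny'(3) t y0 by (intro \<sigma>(2)) (auto simp: dist_norm)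
    moreover have "\<bar>\<sigma> * (H (p + ?y) - H p) - \<sigma> * (1/2 * P * (?y \<bullet> (S *v ?y)))\<bar> \<le> \<epsilon> * (P * (norm ?y)\<^sup>2)"
      using \<rho>(2)[OF ny'(1,2)] \<sigma>(1) unfolding P_def[symmetric] by auto
    moreover have "\<sigma> * (1/2 * P * (?y \<bullet> (S *v ?y))) = - (1/2 * P * t\<^sup>2 * q)"
      by (simp add: q_def matrix_vector_mult_scaleR power2_eq_square)
    moreover have "\<epsilon> * (P * (norm ?y)\<^sup>2) = 1/2 * P * t\<^sup>2 * q"
      using y0 by (simp add: \<epsilon>_def power_mult_distrib)
    ultimately show False by linarith
  qed
  have pd: "\<sigma> * (y \<bullet> (S *v y)) > 0" if y: "y \<noteq> 0" for y
  proof (rule ccontr)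
    assume "\<not> ?thesis"
    then have Q0: "y \<bullet> (S *v y) = 0" using psd[of y] \<sigma>(1) by auto
    \<comment> \<open>If the semidefinite form vanished at \<open>y\<close>, then
      \<open>w = S y\<close> would be nonzero and moving \<open>y\<close> slightly along
      \<open>- \<sigma> w\<close> would make the form negative.\<close>
    define w where "w = S *v y"
    have w: "w \<noteq> 0" using s(2)[of y] s(1) y by (auto simp: w_def mult_le_0_iff)
    define k where "k = \<bar>w \<bullet> (S *v w)\<bar> + 1"
    have k: "k > 0" by (simp add: k_def add_nonneg_pos)
    \<comment> \<open>As \<open>k\<close> exceeds the size of the form at \<open>w\<close>, the
      quadratic term cancels at most half of the linear gain.\<close>
    define t where "t = - \<sigma> * (w \<bullet> w) / k"
    have sw: "y \<bullet> (S *v w) = w \<bullet> w" "w \<bullet> (S *v y) = w \<bullet> w"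
      using sym_matrix_inner[OF St, of y w] by (simp_all add: w_def)
    have "(y + t *\<^sub>R w) \<bullet> (S *v (y + t *\<^sub>R w)) = 2 * t * (w \<bullet> w) + t\<^sup>2 * (w \<bullet> (S *v w))"
      by (simp add: matrix_vector_right_distrib matrix_vector_mult_scaleR inner_add_left inner_add_right Q0 sw power2_eq_square algebra_simps)
    then have "0 \<le> \<sigma> * (2 * t * (w \<bullet> w) + t\<^sup>2 * (w \<bullet> (S *v w)))" using psd[of "y + t *\<^sub>R w"] by simp
    also have "\<dots> = - 2 * (w \<bullet> w)\<^sup>2 / k + (\<sigma> * (w \<bullet> (S *v w))) * (w \<bullet> w)\<^sup>2 / k\<^sup>2"
      using \<sigma>(1) by (auto simp: t_def power2_eq_square algebra_simps)
    also have "(\<sigma> * (w \<bullet> (S *v w))) * (w \<bullet> w)\<^sup>2 / k\<^sup>2 \<le> k * (w \<bullet> w)\<^sup>2 / k\<^sup>2"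
      using \<sigma>(1) by (intro divide_right_mono mult_right_mono) (auto simp: k_def)
    also have "k * (w \<bullet> w)\<^sup>2 / k\<^sup>2 = (w \<bullet> w)\<^sup>2 / k" using k by (simp add: power2_eq_square)
    finally have "0 \<le> - ((w \<bullet> w)\<^sup>2 / k)" by simp
    moreover have "(w \<bullet> w)\<^sup>2 / k > 0" using w k by simp
    ultimately show False by simp
  qed
  have "continuous_on (sphere 0 1) (\<lambda>y. \<sigma> * (y \<bullet> (S *v y)))"
    by (intro continuous_intros linear_continuous_on matrix_vector_mul_bounded_linear)
  from continuous_attains_inf[OF _ _ this]
  obtain y0 where y0: "y0 \<in> sphere 0 1" "\<And>y. y \<in> sphere 0 1 \<Longrightarrow> \<sigma> * (y0 \<bullet> (S *v y0)) \<le> \<sigma> * (y \<bullet> (S *v y))"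
    by auto
  define c where "c = \<sigma> * (y0 \<bullet> (S *v y0))"
  show thesis
  proof (rule that[OF \<sigma>(1), of c])
    show "c > 0" unfolding c_def using y0(1) by (intro pd) auto
    show "c * (norm y)\<^sup>2 \<le> \<sigma> * (y \<bullet> (S *v y))" for y
    proof (cases "y = 0")
      case False
      let ?u = "(1 / norm y) *\<^sub>R y"
      have "c \<le> \<sigma> * (?u \<bullet> (S *v ?u))" unfolding c_def using False by (intro y0(2)) simp
      also have "\<dots> = \<sigma> * (y \<bullet> (S *v y)) / (norm y)\<^sup>2"
        by (simp add: matrix_vector_mult_scaleR power2_eq_square)
      finally show ?thesis using False by (simp add: pos_le_divide_eq)
    qed simp
  qed
qed

end

lemma powr_compare:
  fixes a b q c1 c2 :: real
  assumes "0 < a" "0 < b" "0 < q" "0 < c1" "0 < c2" "c1 * a powr q \<le> c2 * b powr q"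
  shows "a \<le> (c2 / c1) powr (1 / q) * b"
proof (rule ccontr)
  let ?k = "(c2 / c1) powr (1 / q)"
  assume "\<not> a \<le> ?k * b"
  then have "(?k * b) powr q < a powr q" using assms by (intro powr_less_mono2) auto
  also have "(?k * b) powr q = c2 / c1 * b powr q"
    using assms by (simp add: powr_mult powr_powr)
  finally have "c2 * b powr q < c1 * a powr q" using assms by (simp add: field_simps)
  with assms show False by simp
qed

section \<open>Periods around a centre, and the uniform bound\<close>

context planar_hamiltonian_flow
begin

text \<open>\<open>\<omega>\<close> is the angular velocity around \<open>p\<close>, with the sign
  for which it is positive near a centre. No branch of an angle is chosen: the unit vector
  \<open>c\<close> turns with angular velocity \<open>\<omega>\<close>, and its cosine with the
  position stays 1.\<close>

lemma polar_representation:
  assumes x: "x \<in> X" and \<sigma>: "\<sigma> = 1 \<or> \<sigma> = - 1" and t: "0 < t"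
    and nz: "\<And>s. \<Phi> s x \<noteq> p"
  defines "\<omega> \<equiv> \<lambda>s. \<sigma> * ((N (\<Phi> s x) \<bullet> (\<Phi> s x - p)) / (norm (\<Phi> s x - p))\<^sup>2)"
  defines "u \<equiv> (1 / norm (x - p)) *\<^sub>R (x - p)"
  shows "\<Phi> t x - p = norm (\<Phi> t x - p) *\<^sub>R
    (cos (integral {0..t} \<omega>) *\<^sub>R u + (\<sigma> * sin (integral {0..t} \<omega>)) *\<^sub>R rot u)"
proof -
  define y where "y s = \<Phi> s x - p" for s
  define \<theta> where "\<theta> s = integral {0..s} \<omega>" for s
  define c where "c s = cos (\<theta> s) *\<^sub>R u + (\<sigma> * sin (\<theta> s)) *\<^sub>R rot u" for s
  have ynz: "y s \<noteq> 0" "norm (y s) > 0" for s using nz by (auto simp: y_def)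
  have xp: "norm (x - p) > 0" using nz[of 0] flow_0[OF x] by simp
  have contw: "continuous_on S \<omega>" for S
  proof -
    have "continuous_on S (\<lambda>s. N (\<Phi> s x))"
      by (rule continuous_on_compose2[OF N_continuous flow_continuous[OF x]]) auto
    then show ?thesis unfolding \<omega>_def using nz flow_continuous[OF x] by (intro continuous_intros) auto
  qed
  have cont\<theta>: "continuous_on {0..t} \<theta>"
    unfolding \<theta>_def[abs_def] by (intro indefinite_integral_continuous_1 integrable_continuous_real contw)
  have d\<theta>: "(\<theta> has_real_derivative \<omega> s) (at s)" if "0 < s" for s
  proof -
    have "((\<lambda>u. integral {0..u} \<omega>) has_vector_derivative \<omega> s) (at s within {0..s + 1})"
      using that by (intro integral_has_vector_derivative contw) auto
    moreover have "at s within {0..s + 1} = at s" using that by (simp add: at_within_Icc_at)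
    ultimately show ?thesis by (simp add: \<theta>_def[abs_def] has_real_derivative_iff_has_vector_derivative)
  qed
  have uu: "u \<bullet> u = 1"
    using xp by (auto simp: u_def dot_square_norm power2_eq_square)
  have cc: "c s \<bullet> c s = 1" for s
    using \<sigma> by (auto simp: c_def inner_add_left inner_add_right uu power2_eq_square[symmetric] rot_inner_rot)
  \<comment> \<open>The cosine of the angle between the position and \<open>c\<close>. Its
    derivative vanishes by the planar identity \<open>key\<close>.\<close>
  define g where "g s = (y s \<bullet> c s) / norm (y s)" for s
  have "g t = g 0"
  proof (rule DERIV_isconst_end[OF t])
    have "continuous_on {0..t} y" unfolding y_def using flow_continuous[OF x] by (intro continuous_intros)
    moreover have "continuous_on {0..t} c" unfolding c_def using cont\<theta> by (intro continuous_intros)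
    ultimately show "continuous_on {0..t} g" unfolding g_def using ynz by (intro continuous_intros) auto
  next
    fix s assume s: "0 < s" "s < t"
    let ?W = "W (\<Phi> s x)" and ?c' = "\<omega> s *\<^sub>R ((- sin (\<theta> s)) *\<^sub>R u + (\<sigma> * cos (\<theta> s)) *\<^sub>R rot u)"
    have dy: "(y has_derivative (\<lambda>h. h *\<^sub>R ?W)) (at s)"
      unfolding y_def using flow_deriv_W[OF x, of s]
      by (auto simp: has_vector_derivative_def intro!: derivative_eq_intros)
    have d\<theta>s: "(\<theta> has_derivative (\<lambda>h. h * \<omega> s)) (at s)"
      using d\<theta>[OF s(1)] by (simp add: has_field_derivative_def mult.commute[of _ "\<omega> s"])
    have dc: "(c has_derivative (\<lambda>h. h *\<^sub>R ?c')) (at s)"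
      unfolding c_def
      by (auto intro!: derivative_eq_intros d\<theta>s simp: fun_eq_iff scaleR_add_right scaleR_diff_right mult_ac)
    have dn: "((\<lambda>s. norm (y s)) has_derivative (\<lambda>h. h *\<^sub>R ?W \<bullet> sgn (y s))) (at s)"
      using has_derivative_compose[OF dy has_derivative_norm[OF ynz(1)]] by simp
    have "?c' = (\<sigma> * \<omega> s) *\<^sub>R rot (c s)"
      using \<sigma> by (auto simp: c_def algebra_simps)
    also have "\<sigma> * \<omega> s = (N (\<Phi> s x) \<bullet> y s) / (norm (y s))\<^sup>2" using \<sigma> by (auto simp: \<omega>_def y_def)
    finally have c': "?c' = ((N (\<Phi> s x) \<bullet> y s) / (norm (y s))\<^sup>2) *\<^sub>R rot (c s)" .
    have key: "(norm (y s))\<^sup>2 * (?W \<bullet> c s) + (N (\<Phi> s x) \<bullet> y s) * (y s \<bullet> rot (c s)) = (y s \<bullet> c s) * (?W \<bullet> y s)"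
      unfolding W_def power2_norm_eq_inner by (simp add: inner_vec2 algebra_simps)
    have "(g has_derivative (\<lambda>h. ((h *\<^sub>R ?W \<bullet> c s + y s \<bullet> h *\<^sub>R ?c') * norm (y s)
        - (y s \<bullet> c s) * (h *\<^sub>R ?W \<bullet> sgn (y s))) / (norm (y s) * norm (y s)))) (at s)"
      unfolding g_def using ynz
      by (auto intro!: derivative_eq_intros dy dc dn simp: fun_eq_iff field_simps)
    moreover have "((h *\<^sub>R ?W \<bullet> c s + y s \<bullet> h *\<^sub>R ?c') * norm (y s)
        - (y s \<bullet> c s) * (h *\<^sub>R ?W \<bullet> sgn (y s))) = 0" for h
    proof -
      have "(?W \<bullet> c s + y s \<bullet> ?c') * (norm (y s))\<^sup>2 = (y s \<bullet> c s) * (?W \<bullet> y s)"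
      proof -
        have "(w + b / q * e) * q = q * w + b * e" if "q > 0" for w b q e :: real
          using that by (simp add: field_simps)
        from this[of "(norm (y s))\<^sup>2"] show ?thesis
          using key ynz(2)[of s] unfolding c' by (simp add: inner_scaleR_right)
      qed
      then have "(?W \<bullet> c s + y s \<bullet> ?c') * norm (y s) = (y s \<bullet> c s) * (?W \<bullet> sgn (y s))"
        using ynz(2)[of s] by (simp add: sgn_div_norm power2_eq_square field_simps)
      then have "h * ((?W \<bullet> c s + y s \<bullet> ?c') * norm (y s)) = h * ((y s \<bullet> c s) * (?W \<bullet> sgn (y s)))" by simp
      then show ?thesis by (simp only: inner_scaleR_left inner_scaleR_right) (simp add: algebra_simps)
    qed
    ultimately show "(g has_real_derivative 0) (at s)" by (simp add: has_field_derivative_def lambda_zero)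
  qed
  moreover have "g 0 = 1"
    using xp by (simp add: g_def c_def \<theta>_def y_def flow_0[OF x] u_def dot_square_norm power2_eq_square)
  ultimately have "g t = 1" by (rule trans)
  then have yc: "y t \<bullet> c t = norm (y t)" unfolding g_def using ynz(1)[of t] by simp
  \<comment> \<open>The equality case of Cauchy-Schwarz: a vector whose product with a unit vector
    equals its norm is that multiple of it.\<close>
  have "(v - k *\<^sub>R w) \<bullet> (v - k *\<^sub>R w) = v \<bullet> v - 2 * k * (v \<bullet> w) + k * k * (w \<bullet> w)" for v w :: "real^2" and k
    by (simp add: inner_vec2 algebra_simps)
  from this[of "y t" "norm (y t)" "c t"]
  have "(y t - norm (y t) *\<^sub>R c t) \<bullet> (y t - norm (y t) *\<^sub>R c t) = 0"
    unfolding cc yc dot_square_norm[of "y t"] by (simp only: power2_eq_square)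
  then have "y t - norm (y t) *\<^sub>R c t = 0" by (simp only: inner_eq_zero_iff)
  then have "y t = norm (y t) *\<^sub>R c t" by (simp only: right_minus_eq)
  then show ?thesis unfolding y_def c_def \<theta>_def .
qed

text \<open>Conservation of \<open>H\<close> keeps the radius comparable to its initial value
  \<open>r0\<close>, so angular velocity and Hessian are both controlled by
  \<open>r0 powr (m - 1)\<close>. After the angle \<open>2 * pi\<close> the orbit is back on the ray
  of \<open>x\<close>, where \<open>H\<close> is strictly monotone, hence back at \<open>x\<close>.
  In the product \<open>M * T\<close> the power of \<open>r0\<close> cancels.\<close>

theorem center_period_bound:
  assumes ex: "expands_at p m S C" and p: "N p = 0"
    and \<sigma>: "\<sigma> = 1 \<or> \<sigma> = - 1" and c: "c > 0" "\<And>y. c * (norm y)\<^sup>2 \<le> \<sigma> * (y \<bullet> (S *v y))"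
  shows "\<exists>\<delta>>0. \<exists>B. \<forall>x\<in>X. 0 < norm (x - p) \<and> norm (x - p) < \<delta> \<longrightarrow>
    (\<exists>T M. is_period x T \<and> (\<forall>s\<in>{0..T}. norm (A (\<Phi> s x)) \<le> M) \<and> M * T \<le> B)"
proof -
  have m: "m \<ge> 1" and C: "C \<ge> 0" using ex by (auto simp: expands_at_def)
  obtain KS where KS: "KS > 0" "\<And>y. norm (S *v y) \<le> norm y * KS"
    using bounded_linear.pos_bounded[OF matrix_vector_mul_bounded_linear[of S]] by blast
  have Qle: "\<sigma> * (y \<bullet> (S *v y)) \<le> KS * (norm y)\<^sup>2" for y
  proof -
    have "\<sigma> * (y \<bullet> (S *v y)) \<le> \<bar>y \<bullet> (S *v y)\<bar>" using \<sigma> by auto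
    also have "\<dots> \<le> norm y * norm (S *v y)" by (rule Cauchy_Schwarz_ineq2)
    also have "\<dots> \<le> norm y * (norm y * KS)" by (intro mult_left_mono KS) auto
    finally show ?thesis by (simp add: power2_eq_square mult_ac)
  qed
  obtain \<rho> where \<rho>: "\<rho> > 0"
    "\<And>y. 0 < norm y \<Longrightarrow> norm y < \<rho> \<Longrightarrow>
       \<bar>H (p + y) - H p - 1/2 * norm y powr (m - 1) * (y \<bullet> (S *v y))\<bar> \<le> c / 4 * (norm y powr (m - 1) * (norm y)\<^sup>2)"
    "\<And>y. 0 < norm y \<Longrightarrow> norm y < \<rho> \<Longrightarrow>
       norm (N (p + y) - hom_grad m S y) \<le> c / 4 * (norm y powr (m - 1) * norm y)"
    "\<And>y. 0 < norm y \<Longrightarrow> norm y < \<rho> \<Longrightarrow> norm (A (p + y)) \<le> C * norm y powr (m - 1)"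
    using expands_atE[OF ex, of "c / 4"] c(1) by (metis divide_pos_pos zero_less_numeral)
  \<comment> \<open>Leading constants \<open>c / 2\<close> and \<open>KS / 2\<close> for the energy
    and at least \<open>c\<close> for the radial derivative, each corrected by the error
    \<open>c / 4\<close>; \<open>c3\<close> is rounded down.\<close>
  define c1 c2 c3 where "c1 = c / 4" and "c2 = KS / 2 + c / 4" and "c3 = c / 2"
  have cpos: "c1 > 0" "c2 > 0" "c3 > 0" using c KS by (auto simp: c1_def c2_def c3_def)
  have energy: "c1 * norm y powr (m + 1) \<le> \<sigma> * (H (p + y) - H p) \<and> \<sigma> * (H (p + y) - H p) \<le> c2 * norm y powr (m + 1)"
    if y: "0 < norm y" "norm y < \<rho>" for y
  proof -
    define P where "P = norm y powr (m - 1)"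
    have P: "P > 0" unfolding P_def using y(1) by simp
    let ?Q = "y \<bullet> (S *v y)"
    have "\<bar>H (p + y) - H p - 1/2 * P * ?Q\<bar> \<le> c / 4 * (P * (norm y)\<^sup>2)" using \<rho>(2)[OF y] by (simp add: P_def)
    then have "\<bar>\<sigma> * (H (p + y) - H p) - 1/2 * (P * (\<sigma> * ?Q))\<bar> \<le> c / 4 * (P * (norm y)\<^sup>2)"
    proof -
      have "\<sigma> * (H (p + y) - H p) - 1/2 * (P * (\<sigma> * ?Q)) = \<sigma> * (H (p + y) - H p - 1/2 * P * ?Q)"
        by (simp add: algebra_simps)
      moreover have "\<bar>\<sigma>\<bar> = 1" using \<sigma> by auto
      ultimately show "\<bar>H (p + y) - H p - 1/2 * P * ?Q\<bar> \<le> c / 4 * (P * (norm y)\<^sup>2) \<Longrightarrow> ?thesis"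
        by (simp only: abs_mult mult_1_left)
    qed
    moreover have "P * (c * (norm y)\<^sup>2) \<le> P * (\<sigma> * ?Q)" using c(2)[of y] P by (intro mult_left_mono) auto
    moreover have "P * (\<sigma> * ?Q) \<le> P * (KS * (norm y)\<^sup>2)" using Qle[of y] P by (intro mult_left_mono) auto
    moreover have "P * (c * (norm y)\<^sup>2) = c * (P * (norm y)\<^sup>2)" "P * (KS * (norm y)\<^sup>2) = KS * (P * (norm y)\<^sup>2)"
      by (simp_all only: mult_ac)
    moreover have "c / 4 * Z \<le> U \<and> U \<le> (KS / 2 + c / 4) * Z"
      if "\<bar>U - 1/2 * Y\<bar> \<le> c / 4 * Z" "c * Z \<le> Y" "Y \<le> KS * Z" for U Y Z :: real
    proof -
      have "c / 4 * Z = c * Z / 4" "(KS / 2 + c / 4) * Z = KS * Z / 2 + c * Z / 4" by (simp_all add: field_simps)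
      with that show ?thesis by linarith
    qed
    ultimately show ?thesis
      unfolding powr_shift_norm(2)[OF y(1)] P_def[symmetric] c1_def c2_def
      by (simp only:)
  qed
  have radial: "c3 * (norm y powr (m - 1) * (norm y)\<^sup>2) \<le> \<sigma> * (N (p + y) \<bullet> y)"
    if y: "0 < norm y" "norm y < \<rho>" for y
  proof -
    define P where "P = norm y powr (m - 1)"
    have P: "P > 0" unfolding P_def using y(1) by simp
    let ?Q = "y \<bullet> (S *v y)"
    define e where "e = N (p + y) - hom_grad m S y"
    have "\<bar>e \<bullet> y\<bar> \<le> norm e * norm y" by (rule Cauchy_Schwarz_ineq2)
    also have "\<dots> \<le> c / 4 * (P * norm y) * norm y" using \<rho>(3)[OF y] by (intro mult_right_mono) (auto simp: e_def P_def)
    also have "\<dots> = c / 4 * (P * (norm y)\<^sup>2)" by (simp add: power2_eq_square)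
    finally have "\<bar>\<sigma> * (e \<bullet> y)\<bar> \<le> c / 4 * (P * (norm y)\<^sup>2)" using \<sigma> by auto
    moreover have "hom_grad m S y \<bullet> y = (m + 1) / 2 * (P * ?Q)"
    proof -
      have "hom_grad m S y \<bullet> y = P * ?Q + 1/2 * (m - 1) * (norm y powr (m - 3) * (norm y)\<^sup>2) * ?Q"
        by (simp add: hom_grad_def inner_add_left P_def inner_commute[of "S *v y"] dot_square_norm)
      also have "\<dots> = (m + 1) / 2 * (P * ?Q)"
        unfolding powr_shift_norm(3)[OF y(1)] P_def[symmetric] by (simp add: field_simps)
      finally show ?thesis .
    qed
    moreover have "1 * (P * (c * (norm y)\<^sup>2)) \<le> (m + 1) / 2 * (P * (\<sigma> * ?Q))"
    proof (rule mult_mono)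
      show "P * (c * (norm y)\<^sup>2) \<le> P * (\<sigma> * ?Q)" using c(2)[of y] P by (intro mult_left_mono) auto
    qed (use m P c in auto)
    moreover have "N (p + y) \<bullet> y = hom_grad m S y \<bullet> y + e \<bullet> y" by (simp add: e_def inner_diff_left)
    moreover have "P * (c * (norm y)\<^sup>2) = c * (P * (norm y)\<^sup>2)" by (simp only: mult_ac)
    moreover have "\<sigma> * ((m + 1) / 2 * (P * ?Q)) = (m + 1) / 2 * (P * (\<sigma> * ?Q))" by (simp only: mult_ac)
    moreover have "0 \<le> P * (norm y)\<^sup>2" using P by simp
    ultimately have "\<sigma> * (N (p + y) \<bullet> y) \<ge> c * (P * (norm y)\<^sup>2) - c / 4 * (P * (norm y)\<^sup>2)"
      by (simp only: distrib_left)
    moreover have "c / 4 * (P * (norm y)\<^sup>2) + c / 2 * (P * (norm y)\<^sup>2) \<le> c * (P * (norm y)\<^sup>2)"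
      using c(1) P by (simp add: field_simps)
    ultimately show ?thesis by (simp only: c3_def P_def)
  qed
  \<comment> \<open>The largest ratio of two radii on one level that the energy bounds
    permit.\<close>
  define \<kappa> where "\<kappa> = (c2 / c1) powr (1 / (m + 1))"
  have "c1 \<le> c2" using KS by (simp add: c1_def c2_def)
  then have \<kappa>: "\<kappa> \<ge> 1" unfolding \<kappa>_def using cpos m by (intro ge_one_powr_ge_zero) auto
  define a where "a = \<kappa> powr (m - 1)"
  have a: "a > 0" using \<kappa> by (simp add: a_def)
  \<comment> \<open>The product of the Hessian bound \<open>C * (a * b)\<close> and the time
    \<open>2 * pi / \<omega>0\<close>, where \<open>\<omega>0 = c3 * (b / a)\<close>; the power
    \<open>b\<close> of \<open>r0\<close> drops out.\<close>
  define B where "B = 2 * pi * C * a * a / c3"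
  show ?thesis
  proof (rule exI[of _ "\<rho> / \<kappa>"], rule conjI[OF _ exI[of _ B]], use \<rho>(1) \<kappa> in simp, intro ballI impI)
    fix x assume x: "x \<in> X" and near: "0 < norm (x - p) \<and> norm (x - p) < \<rho> / \<kappa>"
    define r0 where "r0 = norm (x - p)"
    have r0: "r0 > 0" "\<kappa> * r0 < \<rho>" using near \<kappa> by (auto simp: r0_def pos_less_divide_eq mult.commute)
    have r0\<kappa>: "r0 \<le> \<kappa> * r0" using \<kappa> r0(1) mult_right_mono[of 1 \<kappa> r0] by simp
    with r0(2) have r0\<rho>: "r0 < \<rho>" by linarith
    have Nx: "N x \<noteq> 0"
    proof
      assume "N x = 0"
      moreover have "0 < c3 * (r0 powr (m - 1) * r0\<^sup>2)" using cpos r0 by simp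
      ultimately show False using radial[of "x - p"] r0(1) r0\<rho> by (simp add: r0_def)
    qed
    define r where "r s = norm (\<Phi> s x - p)" for s
    have nz: "\<Phi> s x \<noteq> p" for s using flow_noncritical[OF x Nx, of s] p by auto
    have rpos: "r s > 0" for s using nz by (simp add: r_def)
    have rcont: "continuous_on I r" for I unfolding r_def using flow_continuous[OF x] by (intro continuous_intros)
    have comp: "r s \<le> \<kappa> * r0 \<and> r0 \<le> \<kappa> * r s" if s: "r s < \<rho>" for s
    proof -
      have e0: "c1 * r0 powr (m + 1) \<le> \<sigma> * (H x - H p)" "\<sigma> * (H x - H p) \<le> c2 * r0 powr (m + 1)"
        using energy[of "x - p"] r0 r0\<rho> by (auto simp: r0_def)
      have es: "c1 * r s powr (m + 1) \<le> \<sigma> * (H x - H p)" "\<sigma> * (H x - H p) \<le> c2 * r s powr (m + 1)"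
        using energy[of "\<Phi> s x - p"] rpos[of s] s H_flow[OF x, of s] by (auto simp: r_def)
      show ?thesis
        unfolding \<kappa>_def using e0 es rpos[of s] r0(1) cpos m
        by (intro conjI powr_compare) auto
    qed
    \<comment> \<open>\<open>comp\<close> is available only below \<open>\<rho>\<close>. An orbit
      leaving the smaller disc would, by continuity, take a radius strictly between
      \<open>\<kappa> * r0\<close> and \<open>\<rho>\<close>, which \<open>comp\<close>
      excludes.\<close>
    have conf: "r s \<le> \<kappa> * r0" if s: "0 \<le> s" for s
    proof (rule ccontr)
      assume "\<not> r s \<le> \<kappa> * r0"
      then have gt: "\<kappa> * r0 < r s" by simp
      define v where "v = min (r s) ((\<kappa> * r0 + \<rho>) / 2)"
      have v: "\<kappa> * r0 < v" "v < \<rho>" "v \<le> r s" using gt r0(2) by (auto simp: v_def min_def)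
      have "r 0 \<le> v" using v r0\<kappa> by (simp add: r_def flow_0[OF x] r0_def[symmetric])
      then have "\<exists>u\<ge>0. u \<le> s \<and> r u = v" using v s rcont by (intro IVT') auto
      then obtain u where "r u = v" by blast
      with comp[of u] v show False by simp
    qed
    have r\<rho>: "r s < \<rho>" if "0 \<le> s" for s using conf[OF that] r0(2) by simp
    define \<omega> where "\<omega> = (\<lambda>s. \<sigma> * ((N (\<Phi> s x) \<bullet> (\<Phi> s x - p)) / (norm (\<Phi> s x - p))\<^sup>2))"
    define b where "b = r0 powr (m - 1)"
    have b: "b > 0" using r0 by (simp add: b_def)
    define \<omega>0 where "\<omega>0 = c3 * (b / a)"
    have \<omega>0: "\<omega>0 > 0" using cpos a b by (simp add: \<omega>0_def)
    have \<omega>_ge: "\<omega>0 \<le> \<omega> s" if s: "0 \<le> s" for s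
    proof -
      have rs: "0 < r s" "r s < \<rho>" using rpos r\<rho>[OF s] by auto
      have "c3 * (r s powr (m - 1) * (r s)\<^sup>2) \<le> \<sigma> * (N (\<Phi> s x) \<bullet> (\<Phi> s x - p))"
        using radial[of "\<Phi> s x - p"] rs by (simp add: r_def)
      then have "c3 * r s powr (m - 1) \<le> \<omega> s" using rs(1) by (simp add: \<omega>_def r_def[symmetric] pos_le_divide_eq mult.assoc)
      moreover have "b / a \<le> r s powr (m - 1)"
      proof -
        have "r0 / \<kappa> \<le> r s" using comp[OF rs(2)] \<kappa> by (simp add: divide_le_eq mult.commute)
        then have "(r0 / \<kappa>) powr (m - 1) \<le> r s powr (m - 1)" using m r0 \<kappa> by (intro powr_mono2) auto
        then show ?thesis using r0 \<kappa> by (simp add: powr_divide a_def b_def)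
      qed
      then have "\<omega>0 \<le> c3 * r s powr (m - 1)" unfolding \<omega>0_def using cpos by (intro mult_left_mono) auto
      ultimately show ?thesis by simp
    qed
    have contw: "continuous_on I \<omega>" for I
    proof -
      have "continuous_on I (\<lambda>s. N (\<Phi> s x))"
        by (rule continuous_on_compose2[OF N_continuous flow_continuous[OF x]]) auto
      then show ?thesis unfolding \<omega>_def using nz flow_continuous[OF x] by (intro continuous_intros) auto
    qed
    \<comment> \<open>By this time the angle has reached \<open>2 * pi\<close> even at the minimal
      angular velocity.\<close>
    define t1 where "t1 = 2 * pi / \<omega>0"
    have t1: "t1 > 0" "\<omega>0 * t1 = 2 * pi" using \<omega>0 by (auto simp: t1_def)
    have "integral {0..t1} (\<lambda>_. \<omega>0) \<le> integral {0..t1} \<omega>"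
      using \<omega>_ge by (intro integral_le integrable_continuous_real contw) auto
    then have "2 * pi \<le> integral {0..t1} \<omega>" using t1 by (simp add: mult.commute)
    moreover have "continuous_on {0..t1} (\<lambda>s. integral {0..s} \<omega>)"
      by (intro indefinite_integral_continuous_1 integrable_continuous_real contw)
    ultimately have "\<exists>t\<ge>0. t \<le> t1 \<and> integral {0..t} \<omega> = 2 * pi"
      using t1 by (intro IVT') auto
    then obtain t where t: "0 \<le> t" "t \<le> t1" "integral {0..t} \<omega> = 2 * pi" by blast
    have "t \<noteq> 0" using t(3) by (cases "t = 0") auto
    then have t0: "t > 0" using t by simp
    define u where "u = (1 / norm (x - p)) *\<^sub>R (x - p)"
    have u: "norm u = 1" "x = p + r0 *\<^sub>R u" using r0 by (auto simp: u_def r0_def)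
    have "\<Phi> t x - p = r t *\<^sub>R u"
      using polar_representation[OF x \<sigma> t0 nz, folded \<omega>_def u_def] unfolding t(3) r_def by simp
    then have \<Phi>t: "\<Phi> t x = p + r t *\<^sub>R u" by (simp add: algebra_simps)
    \<comment> \<open>Makes the point of a given level on the ray unique, so a full turn closes the
      orbit.\<close>
    have mono: "\<sigma> * H (p + l1 *\<^sub>R u) < \<sigma> * H (p + l2 *\<^sub>R u)" if l: "0 < l1" "l1 < l2" "l2 < \<rho>" for l1 l2
    proof (rule DERIV_pos_imp_increasing[OF l(2)])
      fix l assume "l1 \<le> l" "l \<le> l2"
      then have l': "0 < l" "l < \<rho>" using l by auto
      have "((\<lambda>l. p + l *\<^sub>R u) has_derivative (\<lambda>h. h *\<^sub>R u)) (at l)" by (auto intro!: derivative_eq_intros)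
      from has_derivative_mult_right[OF has_derivative_compose[OF this H_deriv], of \<sigma>]
      have "((\<lambda>l. \<sigma> * H (p + l *\<^sub>R u)) has_real_derivative \<sigma> * (N (p + l *\<^sub>R u) \<bullet> u)) (at l)"
        unfolding has_field_derivative_def by (rule has_derivative_eq_rhs) (simp add: fun_eq_iff)
      moreover have "\<sigma> * (N (p + l *\<^sub>R u) \<bullet> u) > 0"
      proof -
        have "0 < c3 * (l powr (m - 1) * l\<^sup>2)" using cpos l' by simp
        also have "\<dots> \<le> \<sigma> * (N (p + l *\<^sub>R u) \<bullet> (l *\<^sub>R u))" using radial[of "l *\<^sub>R u"] l' u(1) by simp
        finally have "0 < l * (\<sigma> * (N (p + l *\<^sub>R u) \<bullet> u))" by (simp add: mult_ac)
        then show ?thesis using l'(1) by (simp add: zero_less_mult_iff)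
      qed
      ultimately show "\<exists>d. ((\<lambda>l. \<sigma> * H (p + l *\<^sub>R u)) has_real_derivative d) (at l) \<and> d > 0" by blast
    qed
    have "r t = r0"
      using mono[of "r t" r0] mono[of r0 "r t"] rpos[of t] r0(1) r0\<rho> r\<rho>[OF t(1)] H_flow[OF x, of t] \<Phi>t u(2)
      by (metis less_irrefl linorder_neqE_linordered_idom)
    then have "\<Phi> t x = x" using \<Phi>t u(2) by simp
    then obtain T where T: "is_period x T" "T \<le> t" using is_period_exists[OF x Nx t0] by metis
    have "norm (A (\<Phi> s x)) \<le> C * (a * b)" if s: "s \<in> {0..T}" for s
    proof -
      have rs: "0 < r s" "r s < \<rho>" "r s \<le> \<kappa> * r0" using rpos r\<rho> conf s by auto
      have "norm (A (\<Phi> s x)) \<le> C * r s powr (m - 1)" using \<rho>(4)[of "\<Phi> s x - p"] rs by (simp add: r_def)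
      also have "\<dots> \<le> C * (\<kappa> * r0) powr (m - 1)" using rs m C by (intro mult_left_mono powr_mono2) auto
      also have "(\<kappa> * r0) powr (m - 1) = a * b" using \<kappa> r0 by (simp add: powr_mult a_def b_def)
      finally show ?thesis .
    qed
    moreover have "C * (a * b) * T \<le> B"
    proof -
      have "C * (a * b) * T \<le> C * (a * b) * t1" using T t C a b by (intro mult_left_mono) auto
      also have "\<dots> = B" using a b cpos by (simp add: B_def t1_def \<omega>0_def field_simps)
      finally show ?thesis .
    qed
    ultimately show "\<exists>T M. is_period x T \<and> (\<forall>s\<in>{0..T}. norm (A (\<Phi> s x)) \<le> M) \<and> M * T \<le> B" using T(1) by blast
  qed
qed

text \<open>Points at distance at least \<open>D\<close> from all non-periodic points form a compact
  set, covered by finitely many balls with local bounds. The last hypothesis is where the geometry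
  of the boundary enters: a critical point isolated in its level must be interior.\<close>

theorem uniform_period_bound:
  assumes D: "D > 0"
    and ex: "\<And>p. p \<in> X \<Longrightarrow> N p = 0 \<Longrightarrow> \<exists>m S C. expands_at p m S C"
    and int: "\<And>p \<rho>. p \<in> X \<Longrightarrow> N p = 0 \<Longrightarrow> \<rho> > 0 \<Longrightarrow>
      (\<And>x. x \<in> X \<Longrightarrow> 0 < norm (x - p) \<Longrightarrow> norm (x - p) < \<rho> \<Longrightarrow> H x \<noteq> H p) \<Longrightarrow> p \<in> interior X"
  shows "\<exists>B. \<forall>x\<in>X. N x \<noteq> 0 \<and> (\<forall>z\<in>X. orbit_period \<Phi> z = \<infinity> \<longrightarrow> D \<le> dist x z) \<longrightarrow>
    (\<exists>T M. is_period x T \<and> (\<forall>s\<in>{0..T}. norm (A (\<Phi> s x)) \<le> M) \<and> M * T \<le> B)"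
proof -
  define K where "K = {x\<in>X. \<forall>z\<in>X. orbit_period \<Phi> z = \<infinity> \<longrightarrow> D \<le> dist x z}"
  have "K = X \<inter> (\<Inter>z\<in>{z\<in>X. orbit_period \<Phi> z = \<infinity>}. {x. D \<le> dist x z})" by (auto simp: K_def)
  also have "compact \<dots>"
    by (intro compact_Int_closed[OF compact_X] closed_INT ballI closed_Collect_le continuous_intros)
  finally have K: "compact K" .
  have loc: "\<exists>\<delta>>0. \<exists>B. \<forall>x\<in>X. norm (x - p) < \<delta> \<and> N x \<noteq> 0 \<longrightarrow>
      (\<exists>T M. is_period x T \<and> (\<forall>s\<in>{0..T}. norm (A (\<Phi> s x)) \<le> M) \<and> M * T \<le> B)" if p: "p \<in> K" for p
  proof (cases "N p = 0")
    case False
    have pX: "p \<in> X" and "orbit_period \<Phi> p = \<infinity> \<Longrightarrow> D \<le> dist p p" using p by (auto simp: K_def)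
    \<comment> \<open>A non-periodic \<open>p\<close> would have distance at least \<open>D\<close>
      from itself.\<close>
    then have "orbit_period \<Phi> p \<noteq> \<infinity>" using D by auto
    then obtain T0 where T0: "is_period p T0" using orbit_period_finite_cases[OF pX _ False] by metis
    obtain \<delta> where \<delta>: "\<delta> > 0" "\<And>y. y \<in> X \<Longrightarrow> norm (y - p) < \<delta> \<Longrightarrow> \<exists>T'. is_period y T' \<and> \<bar>T' - T0\<bar> < 1"
      using period_near[OF pX T0, of 1] by (metis zero_less_one)
    have "\<exists>T M. is_period x T \<and> (\<forall>s\<in>{0..T}. norm (A (\<Phi> s x)) \<le> M) \<and> M * T \<le> L * (T0 + 1)"
      if x: "x \<in> X" "norm (x - p) < \<delta>" for x
    proof -
      obtain T where T: "is_period x T" "\<bar>T - T0\<bar> < 1" using \<delta>(2)[OF x] by blast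
      have "L * T \<le> L * (T0 + 1)" using T(2) L_pos by (intro mult_left_mono) auto
      with T(1) show ?thesis using norm_A_le flow_in[OF x(1)] by blast
    qed
    with \<delta>(1) show ?thesis by blast
  next
    case True
    have pX: "p \<in> X" using p by (simp add: K_def)
    obtain m S C where e: "expands_at p m S C" using ex[OF pX True] by blast
    obtain \<rho>1 where \<rho>1: "\<rho>1 > 0" "\<And>y. 0 < norm y \<Longrightarrow> norm y < \<rho>1 \<Longrightarrow> H (p + y) = H p \<Longrightarrow> W (p + y) \<bullet> y \<noteq> 0"
      using radial_velocity_on_level[OF e] by metis
    \<comment> \<open>Within \<open>\<rho>1\<close> the level of \<open>p\<close> contains no
      periodic point, and within \<open>D\<close> of \<open>p\<close> there is no non-periodic one,
      so \<open>p\<close> is alone on its level.\<close>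
    define \<rho> where "\<rho> = min \<rho>1 D"
    have \<rho>: "\<rho> > 0" using \<rho>1 D by (simp add: \<rho>_def)
    have lev: "H x \<noteq> H p" if x: "x \<in> X" "0 < norm (x - p)" "norm (x - p) < \<rho>" for x
    proof
      assume eq: "H x = H p"
      have near: "norm (x - p) < \<rho>1" using x by (simp add: \<rho>_def)
      have "W x \<bullet> (x - p) \<noteq> 0" using \<rho>1(2)[of "x - p"] x near eq by simp
      then have Nx: "N x \<noteq> 0" by (auto simp: W_def)
      have "orbit_period \<Phi> x = \<infinity>"
        using orbit_period_finite_cases[OF x(1) _ Nx] critical_level_not_periodic[OF x(1) True \<rho>1(2) near eq] by metis
      then have "D \<le> dist p x" using p x(1) by (simp add: K_def)
      then show False using x by (simp add: \<rho>_def dist_norm norm_minus_commute)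
    qed
    have "p \<in> interior X" by (rule int[OF pX True \<rho> lev])
    then obtain \<rho>2 where \<rho>2: "\<rho>2 > 0" "ball p \<rho>2 \<subseteq> X" by (auto simp: mem_interior)
    have "H (p + y) \<noteq> H p" if "0 < norm y" "norm y < min \<rho> \<rho>2" for y
      using lev[of "p + y"] \<rho>2(2) that by (auto simp: subset_iff dist_norm)
    then obtain \<sigma> c where "\<sigma> = 1 \<or> \<sigma> = - 1" "c > 0" "\<And>y. c * (norm y)\<^sup>2 \<le> \<sigma> * (y \<bullet> (S *v y))"
      using expands_at_definite[OF e, of "min \<rho> \<rho>2"] \<rho> \<rho>2(1) by (metis min_less_iff_conj)
    from center_period_bound[OF e True this]
    obtain \<delta> B where \<delta>: "\<delta> > 0" "\<And>x. x \<in> X \<Longrightarrow> 0 < norm (x - p) \<Longrightarrow> norm (x - p) < \<delta> \<Longrightarrow>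
      \<exists>T M. is_period x T \<and> (\<forall>s\<in>{0..T}. norm (A (\<Phi> s x)) \<le> M) \<and> M * T \<le> B" by blast
    have "\<exists>T M. is_period x T \<and> (\<forall>s\<in>{0..T}. norm (A (\<Phi> s x)) \<le> M) \<and> M * T \<le> B"
      if "x \<in> X" "norm (x - p) < \<delta>" "N x \<noteq> 0" for x
      using \<delta>(2)[of x] that True by (cases "x = p") auto
    with \<delta>(1) show ?thesis by blast
  qed
  obtain \<delta> B where \<delta>B: "\<And>p. p \<in> K \<Longrightarrow> \<delta> p > 0 \<and> (\<forall>x\<in>X. norm (x - p) < \<delta> p \<and> N x \<noteq> 0 \<longrightarrow>
      (\<exists>T M. is_period x T \<and> (\<forall>s\<in>{0..T}. norm (A (\<Phi> s x)) \<le> M) \<and> M * T \<le> B p))"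
    using loc by metis
  have "K \<subseteq> (\<Union>p\<in>K. ball p (\<delta> p))" using \<delta>B by force
  then obtain K' where K': "K' \<subseteq> K" "finite K'" "K \<subseteq> (\<Union>p\<in>K'. ball p (\<delta> p))"
    using compactE_image[OF K, of K "\<lambda>p. ball p (\<delta> p)"] by (metis open_ball)
  show ?thesis
  proof (rule exI[of _ "Max (B ` K')"], intro ballI impI)
    fix x assume x: "x \<in> X" "N x \<noteq> 0 \<and> (\<forall>z\<in>X. orbit_period \<Phi> z = \<infinity> \<longrightarrow> D \<le> dist x z)"
    then have "x \<in> K" by (simp add: K_def)
    then obtain p where p: "p \<in> K'" "x \<in> ball p (\<delta> p)" using K'(3) by blast
    then have "norm (x - p) < \<delta> p" by (simp add: dist_norm norm_minus_commute)
    then obtain T M where TM: "is_period x T" "\<forall>s\<in>{0..T}. norm (A (\<Phi> s x)) \<le> M" "M * T \<le> B p"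
      using \<delta>B[of p] p(1) K'(1) x by blast
    have "B p \<le> Max (B ` K')" using p(1) K'(2) by (intro Max_ge) auto
    with TM show "\<exists>T M. is_period x T \<and> (\<forall>s\<in>{0..T}. norm (A (\<Phi> s x)) \<le> M) \<and> M * T \<le> Max (B ` K')"
      by (meson order_trans)
  qed
qed

end


section \<open>Lipschitz domains and the growth of transported curves\<close>

lemma partial_deriv_grad:
  assumes "C2_on H UNIV"
  shows "partial_deriv i H x = grad H x $ i"
proof -
  have "frechet_derivative H (at x) = (\<lambda>h. grad H x \<bullet> h)"
    using frechet_derivative_at[OF grad_has_derivative(1)[OF assms]] by simp
  then show ?thesis by (simp add: partial_deriv_def inner_axis)
qed

lemma fderiv_eq_0_iff_grad:
  assumes "C2_on H UNIV"
  shows "fderiv H x = 0 \<longleftrightarrow> grad H x = 0"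
proof
  assume 0: "grad H x = 0"
  show "fderiv H x = 0"
  proof (rule blinfun_eqI)
    show "blinfun_apply (fderiv H x) h = blinfun_apply 0 h" for h
      using 0 grad_map_inner[of "fderiv H x" h] by (simp add: grad_def)
  qed
qed (simp add: grad_def)

text \<open>The divergence of \<open>rot (grad H)\<close> is the difference of the two mixed second
  derivatives. It vanishes in \<open>\<Omega>\<close>, hence by continuity on the closure.\<close>

lemma hess_symmetric:
  assumes H: "C2_on H UNIV" and "open \<Omega>" and V: "\<And>x. x \<in> \<Omega> \<Longrightarrow> V x = rot (grad H x)"
    and div: "\<And>x. x \<in> \<Omega> \<Longrightarrow> divergence V x = 0" and x: "x \<in> closure \<Omega>"
  shows "blinfun_apply (hess H x) u \<bullet> w = u \<bullet> blinfun_apply (hess H x) w"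
proof -
  let ?e1 = "axis 1 1 :: real^2" and ?e2 = "axis 2 1 :: real^2"
  define f where "f x = blinfun_apply (hess H x) ?e1 $ 2 - blinfun_apply (hess H x) ?e2 $ 1" for x
  have f0: "f x = 0" if x: "x \<in> \<Omega>" for x
  proof -
    have part: "partial_deriv i (\<lambda>y. V y $ i) x = rot (hess H x (axis i 1)) $ i" for i :: 2
    proof -
      have "((\<lambda>y. rot (grad H y) $ i) has_derivative (\<lambda>h. rot (hess H x h) $ i)) (at x)"
        by (intro bounded_linear.has_derivative[OF bounded_linear_vec_nth]
            bounded_linear.has_derivative[OF bounded_linear_rot] grad_has_derivative(2)[OF H])
      then have "((\<lambda>y. V y $ i) has_derivative (\<lambda>h. rot (hess H x h) $ i)) (at x)"
        by (rule has_derivative_transform_within_open[OF _ \<open>open \<Omega>\<close> x]) (simp add: V)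
      then show ?thesis unfolding partial_deriv_def using frechet_derivative_at by metis
    qed
    show ?thesis using div[OF x] by (simp add: divergence_def sum_2 part f_def)
  qed
  have "continuous_on UNIV f"
    unfolding f_def
    by (intro continuous_intros blinfun.continuous_on grad_has_derivative(3)[OF H])
  then have "closed {x. f x = 0}" by (intro closed_Collect_eq continuous_on_const)
  then have "closure \<Omega> \<subseteq> {x. f x = 0}" using f0 by (intro closure_minimal) auto
  then have fx: "blinfun_apply (hess H x) ?e1 $ 2 = blinfun_apply (hess H x) ?e2 $ 1" using x by (auto simp: f_def)
  have expand: "blinfun_apply (hess H x) u = u $ 1 *\<^sub>R hess H x ?e1 + u $ 2 *\<^sub>R hess H x ?e2" for u
  proof -
    have "u = u $ 1 *\<^sub>R ?e1 + u $ 2 *\<^sub>R ?e2" by (simp add: vec2_eq_iff axis_def)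
    then show ?thesis by (metis blinfun.add_right blinfun.scaleR_right)
  qed
  show ?thesis
    unfolding expand[of u] expand[of w] using fx by (simp add: inner_vec2 algebra_simps)
qed

lemma orthonormal_frame_decomp:
  assumes "norm e1 = 1" "norm e2 = 1" "e1 \<bullet> e2 = 0"
  shows "d = (d \<bullet> e1) *\<^sub>R e1 + (d \<bullet> e2) *\<^sub>R (e2::real^2)"
proof -
  define k where "k = rot e1 \<bullet> e2"
  have e2: "e2 = k *\<^sub>R rot e1" using rot_decomp[of e1 e2] assms by (simp add: k_def)
  have "norm e2 = \<bar>k\<bar>" using assms(1) by (subst e2) simp
  then have k: "k * k = 1" using assms(2) by (metis abs_mult_self_eq mult_1)
  have "(d \<bullet> e2) *\<^sub>R e2 = (k * k) *\<^sub>R ((rot e1 \<bullet> d) *\<^sub>R rot e1)"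
    by (simp add: e2 inner_commute mult_ac)
  then show ?thesis using rot_decomp[of e1 d] assms(1) k by (simp add: inner_commute)
qed

lemma lipschitz_chartE:
  assumes "lipschitz_chart \<Omega> x e1 e2 g"
  obtains L r h where "norm e1 = 1" "norm e2 = 1" "e1 \<bullet> e2 = 0" "L \<ge> 0" "\<And>s. \<bar>g s\<bar> \<le> L * \<bar>s\<bar>"
    "r > 0" "h > 0" "\<And>s \<tau>. \<bar>s\<bar> < r \<Longrightarrow> \<bar>\<tau>\<bar> < h \<Longrightarrow> x + s *\<^sub>R e1 + \<tau> *\<^sub>R e2 \<in> \<Omega> \<longleftrightarrow> g s < \<tau>"
proof -
  from assms obtain L where L: "L-lipschitz_on UNIV g" and g0: "g 0 = 0" by (auto simp: lipschitz_chart_def)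
  have "\<bar>g s\<bar> \<le> L * \<bar>s\<bar>" for s using lipschitz_onD[OF L, of s 0] g0 by (simp add: dist_real_def)
  then show thesis
    using assms lipschitz_on_nonneg[OF L] that[of L] unfolding lipschitz_chart_def by blast
qed

text \<open>At a boundary point, directions close to the chart vector \<open>e2\<close> rise faster
  than the Lipschitz graph and so enter the domain.\<close>

lemma lipschitz_domain_cone:
  assumes \<Omega>: "bounded_lipschitz_domain \<Omega>" and x: "x \<in> closure \<Omega>"
  shows "\<exists>d0 r. r > 0 \<and> (\<forall>d\<in>ball d0 r. \<exists>s0>0. \<forall>s. 0 < s \<and> s < s0 \<longrightarrow> x + s *\<^sub>R d \<in> closure \<Omega>)"
proof (cases "x \<in> \<Omega>")
  case True
  then obtain e where e: "e > 0" "ball x e \<subseteq> \<Omega>"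
    using \<Omega> open_contains_ball unfolding bounded_lipschitz_domain_def by metis
  have "x + s *\<^sub>R d \<in> closure \<Omega>" if "d \<in> ball 0 1" "0 < s" "s < e" for s d
  proof -
    have "s * norm d \<le> s * 1" using that by (intro mult_left_mono) auto
    then have "s * norm d < e" using that by linarith
    then have "x + s *\<^sub>R d \<in> ball x e" using that by (simp add: dist_norm)
    then show ?thesis using e closure_subset by blast
  qed
  then show ?thesis using e(1) by (intro exI[of _ 0] exI[of _ 1]) (auto intro!: exI[of _ e])
next
  case False
  have "open \<Omega>" using \<Omega> by (simp add: bounded_lipschitz_domain_def)
  then have "x \<in> frontier \<Omega>" using False x by (simp add: frontier_def interior_open)
  then obtain e1 e2 g where "lipschitz_chart \<Omega> x e1 e2 g" using \<Omega> unfolding bounded_lipschitz_domain_def by blast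
  then obtain L r h where ch: "norm e1 = 1" "norm e2 = 1" "e1 \<bullet> e2 = 0" "L \<ge> 0" "\<And>s. \<bar>g s\<bar> \<le> L * \<bar>s\<bar>"
    "r > 0" "h > 0" "\<And>s \<tau>. \<bar>s\<bar> < r \<Longrightarrow> \<bar>\<tau>\<bar> < h \<Longrightarrow> x + s *\<^sub>R e1 + \<tau> *\<^sub>R e2 \<in> \<Omega> \<longleftrightarrow> g s < \<tau>"
    using lipschitz_chartE by metis
  \<comment> \<open>Directions this close to \<open>e2\<close> have a vertical part above
    \<open>1 / 2\<close>, while \<open>L\<close> times the horizontal part is at most
    \<open>1 / 2\<close>.\<close>
  define \<rho> where "\<rho> = 1 / (2 * (L + 1))"
  have \<rho>: "\<rho> > 0" "\<rho> \<le> 1 / 2" "L * \<rho> \<le> 1 / 2" using ch(4) by (auto simp: \<rho>_def field_simps)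
  have "\<exists>s0>0. \<forall>s. 0 < s \<and> s < s0 \<longrightarrow> x + s *\<^sub>R d \<in> closure \<Omega>" if d: "d \<in> ball e2 \<rho>" for d
  proof -
    define a b where "a = d \<bullet> e1" and "b = d \<bullet> e2"
    have nd: "norm (d - e2) < \<rho>" using d by (simp add: dist_norm norm_minus_commute)
    have a: "\<bar>a\<bar> < \<rho>"
    proof -
      have "a = (d - e2) \<bullet> e1" using ch(3) by (simp add: a_def inner_diff_left inner_commute[of e2])
      then show ?thesis using Cauchy_Schwarz_ineq2[of "d - e2" e1] ch(1) nd by simp
    qed
    have b: "\<bar>b - 1\<bar> < \<rho>"
    proof -
      have "b - 1 = (d - e2) \<bullet> e2" using ch(2) by (simp add: b_def inner_diff_left dot_square_norm)
      then show ?thesis using Cauchy_Schwarz_ineq2[of "d - e2" e2] ch(2) nd by simp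
    qed
    have ab: "L * \<bar>a\<bar> < b" 
    proof -
      have "L * \<bar>a\<bar> \<le> L * \<rho>" using a ch(4) by (intro mult_left_mono) auto
      then show ?thesis using \<rho> b by linarith
    qed
    have b2: "0 < b" "b < 2" using b \<rho> by auto
    show ?thesis
    proof (rule exI[of _ "min r (h / 2)"], intro conjI allI impI)
      show "min r (h / 2) > 0" using ch by simp
      fix s assume s: "0 < s \<and> s < min r (h / 2)"
      have "\<bar>s * a\<bar> < r"
      proof -
        have "s * \<bar>a\<bar> \<le> s * 1" using s a \<rho> by (intro mult_left_mono) auto
        then have "s * \<bar>a\<bar> < r" using s by linarith
        then show ?thesis using s by (simp add: abs_mult)
      qed
      moreover have "\<bar>s * b\<bar> < h"
      proof -
        have "s * b \<le> s * 2" using s b2 by (intro mult_left_mono) auto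
        then have "s * b < h" using s by linarith
        then show ?thesis using s b2 by (simp add: abs_mult)
      qed
      moreover have "g (s * a) < s * b"
      proof -
        have "g (s * a) \<le> L * \<bar>s * a\<bar>" using ch(5)[of "s * a"] by simp
        also have "\<dots> = s * (L * \<bar>a\<bar>)" using s by (simp add: abs_mult)
        also have "\<dots> < s * b" using ab s by simp
        finally show ?thesis .
      qed
      ultimately have "x + (s * a) *\<^sub>R e1 + (s * b) *\<^sub>R e2 \<in> \<Omega>" using ch(8) by simp
      moreover have "x + s *\<^sub>R d = x + (s * a) *\<^sub>R e1 + (s * b) *\<^sub>R e2"
      proof -
        have "s *\<^sub>R d = s *\<^sub>R (a *\<^sub>R e1 + b *\<^sub>R e2)"
          using orthonormal_frame_decomp[OF ch(1-3), of d] by (simp only: a_def b_def)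
        then show ?thesis by (simp add: scaleR_add_right add.assoc)
      qed
      ultimately have "x + s *\<^sub>R d \<in> \<Omega>" by (simp only:)
      then show "x + s *\<^sub>R d \<in> closure \<Omega>" using closure_subset by blast
    qed
  qed
  then show ?thesis using \<rho>(1) by blast
qed

text \<open>The boundary is locally a graph, so it contains nearby points over other parameters.
  Since \<open>H\<close> vanishes on the boundary, no boundary point is isolated in its
  level.\<close>

lemma frontier_not_isolated:
  assumes \<Omega>: "bounded_lipschitz_domain \<Omega>" and p: "p \<in> frontier \<Omega>" and \<rho>: "\<rho> > 0"
  obtains z where "z \<in> frontier \<Omega>" "0 < norm (z - p)" "norm (z - p) < \<rho>"
proof -
  have op: "open \<Omega>" using \<Omega> by (simp add: bounded_lipschitz_domain_def)
  obtain e1 e2 g where "lipschitz_chart \<Omega> p e1 e2 g" using \<Omega> p unfolding bounded_lipschitz_domain_def by blast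
  then obtain L r h where ch: "norm e1 = 1" "norm e2 = 1" "e1 \<bullet> e2 = 0" "L \<ge> 0" "\<And>s. \<bar>g s\<bar> \<le> L * \<bar>s\<bar>"
    "r > 0" "h > 0" "\<And>s \<tau>. \<bar>s\<bar> < r \<Longrightarrow> \<bar>\<tau>\<bar> < h \<Longrightarrow> p + s *\<^sub>R e1 + \<tau> *\<^sub>R e2 \<in> \<Omega> \<longleftrightarrow> g s < \<tau>"
    using lipschitz_chartE by metis
  \<comment> \<open>For \<open>s < k\<close> the quantity \<open>s * (L + 1)\<close> bounds both the
    height \<open>\<bar>g s\<bar>\<close> and the distance from \<open>p\<close>, and is below
    \<open>h\<close> and \<open>\<rho>\<close>.\<close>
  define k where "k = min h \<rho> / (L + 1)"
  define s where "s = min r k / 2"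
  have L1: "L + 1 > 0" using ch(4) by simp
  then have k: "k > 0" using ch \<rho> by (simp add: k_def)
  have "min r k \<le> r" "min r k \<le> k" by auto
  then have s: "s > 0" "s < r" and "s < k" using ch(6) k by (auto simp: s_def)
  then have sL: "s * (L + 1) < min h \<rho>" using L1 by (simp only: k_def pos_less_divide_eq)
  have gs: "\<bar>g s\<bar> \<le> L * s" using ch(5)[of s] s by simp
  have gs_h: "\<bar>g s\<bar> < h" using gs sL s by (simp add: algebra_simps)
  define z where "z = p + s *\<^sub>R e1 + g s *\<^sub>R e2"
  have "z \<notin> \<Omega>" using ch(8)[of s "g s"] s gs_h by (simp add: z_def)
  moreover have "z \<in> closure \<Omega>"
    unfolding closure_approachable
  proof (intro allI impI)
    fix e :: real assume e: "e > 0"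
    define \<epsilon> where "\<epsilon> = min (e / 2) ((h - \<bar>g s\<bar>) / 2)"
    have \<epsilon>: "\<epsilon> > 0" "\<epsilon> < e" "\<bar>g s + \<epsilon>\<bar> < h"
    proof -
      show "\<epsilon> > 0" using e gs_h by (simp add: \<epsilon>_def)
      have "\<epsilon> \<le> e / 2" "\<epsilon> \<le> (h - \<bar>g s\<bar>) / 2" unfolding \<epsilon>_def by (rule min.cobounded1, rule min.cobounded2)
      moreover have "(h - \<bar>g s\<bar>) / 2 < h - \<bar>g s\<bar>" using gs_h by simp
      ultimately show "\<epsilon> < e" "\<bar>g s + \<epsilon>\<bar> < h" using \<open>\<epsilon> > 0\<close> e by linarith+
    qed
    have "p + s *\<^sub>R e1 + (g s + \<epsilon>) *\<^sub>R e2 \<in> \<Omega>" using ch(8)[of s "g s + \<epsilon>"] s \<epsilon> by simp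
    moreover have "dist (p + s *\<^sub>R e1 + (g s + \<epsilon>) *\<^sub>R e2) z < e"
      using \<epsilon> ch(2) by (simp add: z_def dist_norm algebra_simps)
    ultimately show "\<exists>y\<in>\<Omega>. dist y z < e" by blast
  qed
  ultimately have "z \<in> frontier \<Omega>" using op by (simp add: frontier_def interior_open)
  moreover have "0 < norm (z - p)"
  proof -
    have "(z - p) \<bullet> e1 = s"
      using ch(1,3) by (simp add: z_def inner_add_left dot_square_norm inner_commute[of e2])
    then show ?thesis using s(1) by auto
  qed
  moreover have "norm (z - p) < \<rho>"
  proof -
    have "norm (z - p) \<le> norm (s *\<^sub>R e1) + norm (g s *\<^sub>R e2)" unfolding z_def using norm_triangle_ineq[of "s *\<^sub>R e1" "g s *\<^sub>R e2"] by (simp add: add.assoc)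
    also have "\<dots> \<le> s + L * s" using ch(1,2) s gs by simp
    finally show ?thesis using sL by (simp add: algebra_simps)
  qed
  ultimately show thesis by (rule that)
qed

theorem theorem1p7:
  fixes \<Omega> :: "(real^2) set" and V :: "real^2 \<Rightarrow> real^2" and Dstar :: real
  assumes "bounded_lipschitz_domain \<Omega>"
    and "C1_closure V \<Omega>"
    and "\<forall>x\<in>\<Omega>. divergence V x = 0"
    and "\<forall>x\<in>frontier \<Omega>. \<forall>n. outward_unit_normal \<Omega> x n \<longrightarrow> V x \<bullet> n = 0"
    and "\<exists>H. assumption_A1 \<Omega> V H \<and> assumption_A2 \<Omega> H"
  shows "\<exists>C::real. C > 0 \<and>
    (\<forall>(\<Phi>::real \<Rightarrow> real^2 \<Rightarrow> real^2) (\<gamma>0::real \<Rightarrow> real^2).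
       flow_of \<Omega> V \<Phi> \<longrightarrow>
       \<gamma>0 ` {0..1} \<subseteq> closure \<Omega> \<longrightarrow>
       (\<exists>L. L-lipschitz_on {0..1} \<gamma>0) \<longrightarrow>
       set_edist (\<gamma>0 ` {0..1}) (nonperiodic_points \<Omega> \<Phi>) > 0 \<longrightarrow>
       ereal Dstar = min 1 (set_edist (\<gamma>0 ` {0..1}) (nonperiodic_points \<Omega> \<Phi>)) \<longrightarrow>
       (\<forall>t\<ge>0. (\<lambda>\<alpha>. growth_density \<Omega> V \<Phi> \<gamma>0 \<alpha> t) absolutely_integrable_on {0..1}) \<and>
       (SUP t\<in>{0..}. \<bar>curve_length (transported_curve \<Phi> \<gamma>0 t) -
            ereal (t * integral {0..1} (\<lambda>\<alpha>. growth_density \<Omega> V \<Phi> \<gamma>0 \<alpha> t))\<bar>)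
         \<le> ereal C * curve_length \<gamma>0 \<and>
       (SUP t\<in>{0..}. ereal (integral {0..1} (\<lambda>\<alpha>. growth_density \<Omega> V \<Phi> \<gamma>0 \<alpha> t)))
         \<le> ereal C * curve_length \<gamma>0)"
proof (cases "Dstar > 0 \<and> (\<exists>\<Phi>. flow_of \<Omega> V \<Phi>)")
  case False
  \<comment> \<open>No flow and curve then satisfy the hypotheses, so any positive constant will
    do.\<close>
  show ?thesis
  proof (rule exI[of _ 1], rule conjI, simp, intro allI impI, goal_cases)
    case (1 \<Phi> \<gamma>0)
    then have "0 < min 1 (set_edist (\<gamma>0 ` {0..1}) (nonperiodic_points \<Omega> \<Phi>))" by simp
    with 1(5) have "0 < ereal Dstar" by (simp only:)
    with 1(1) False have False by auto
    then show ?case ..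
  qed
next
  case True
  then obtain \<Phi>0 where \<Phi>0: "flow_of \<Omega> V \<Phi>0" and D: "Dstar > 0" by blast
  obtain H where A1: "assumption_A1 \<Omega> V H" and A2: "assumption_A2 \<Omega> H" using assms(5) by blast
  have H: "C2_on H UNIV" and H0: "\<And>x. x \<in> frontier \<Omega> \<Longrightarrow> H x = 0" using A1 by (auto simp: assumption_A1_def)
  have op: "open \<Omega>" and bd: "bounded \<Omega>" using assms(1) by (auto simp: bounded_lipschitz_domain_def)
  have V: "V x = rot (grad H x)" if "x \<in> closure \<Omega>" for x
    using A1 that by (simp add: assumption_A1_def partial_deriv_grad[OF H] rot_def)
  have flow: "planar_hamiltonian_flow (closure \<Omega>) H (grad H) (hess H) \<Phi>" if "flow_of \<Omega> V \<Phi>" for \<Phi>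
  proof
    show "compact (closure \<Omega>)" using bd by simp
    show "(H has_derivative (\<lambda>h. grad H x \<bullet> h)) (at x)" "(grad H has_derivative blinfun_apply (hess H x)) (at x)" for x
      by (rule grad_has_derivative[OF H])+
    show "continuous_on UNIV (hess H)" by (rule grad_has_derivative[OF H])
    show "blinfun_apply (hess H x) u \<bullet> w = u \<bullet> blinfun_apply (hess H x) w" if "x \<in> closure \<Omega>" for x u w
      by (rule hess_symmetric[where V = V, OF H op _ _ that]) (use V closure_subset assms(3) in auto)
    fix x t assume x: "x \<in> closure \<Omega>"
    show "\<Phi> 0 x = x" and in_closure: "\<Phi> t x \<in> closure \<Omega>" using that x by (auto simp: flow_of_def)
    have "((\<lambda>s. \<Phi> s x) has_vector_derivative V (\<Phi> t x)) (at t)"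
      using that x by (simp add: flow_of_def)
    then show "((\<lambda>s. \<Phi> s x) has_vector_derivative rot (grad H (\<Phi> t x))) (at t)"
      by (simp only: V[OF in_closure])
  qed
  \<comment> \<open>One flow is fixed to state the period bound, because the constant has to precede
    the quantifier over flows.\<close>
  interpret F0: planar_hamiltonian_flow "closure \<Omega>" H "grad H" "hess H" \<Phi>0 by (rule flow[OF \<Phi>0])
  have "\<exists>B. \<forall>x\<in>closure \<Omega>. grad H x \<noteq> 0 \<and> (\<forall>z\<in>closure \<Omega>. orbit_period \<Phi>0 z = \<infinity> \<longrightarrow> Dstar \<le> dist x z) \<longrightarrow>
    (\<exists>T M. F0.is_period x T \<and> (\<forall>s\<in>{0..T}. norm (hess H (\<Phi>0 s x)) \<le> M) \<and> M * T \<le> B)"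
  proof (rule F0.uniform_period_bound[OF D])
    fix p assume p: "p \<in> closure \<Omega>" "grad H p = 0"
    then have "p \<in> critical_points \<Omega> H" by (simp add: critical_points_def fderiv_eq_0_iff_grad[OF H])
    then have "homogeneous_expansion_at H p" using A2 by (simp add: assumption_A2_def)
    from critical_expansion[OF H this] show "\<exists>m S C. F0.expands_at p m S C"
      unfolding F0.expands_at_def by metis
  next
    fix p \<rho> assume p: "p \<in> closure \<Omega>" "grad H p = 0" "\<rho> > 0"
      and lev: "\<And>x. x \<in> closure \<Omega> \<Longrightarrow> 0 < norm (x - p) \<Longrightarrow> norm (x - p) < \<rho> \<Longrightarrow> H x \<noteq> H p"
    have "p \<in> \<Omega>"
    proof (rule ccontr)
      assume "p \<notin> \<Omega>"
      then have pf: "p \<in> frontier \<Omega>" using p op by (simp add: frontier_def interior_open)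
      obtain z where z: "z \<in> frontier \<Omega>" "0 < norm (z - p)" "norm (z - p) < \<rho>"
        using frontier_not_isolated[OF assms(1) pf p(3)] by metis
      \<comment> \<open>Both boundary points lie on the level 0, contrary to the isolation of
        \<open>p\<close> in its level.\<close>
      then show False using lev[of z] H0[OF z(1)] H0[OF pf] by (simp add: frontier_def)
    qed
    then show "p \<in> interior (closure \<Omega>)"
      using interior_maximal[OF closure_subset op] by blast
  qed
  then obtain B where B: "\<And>x. x \<in> closure \<Omega> \<Longrightarrow> grad H x \<noteq> 0 \<Longrightarrow>
      (\<And>z. z \<in> closure \<Omega> \<Longrightarrow> orbit_period \<Phi>0 z = \<infinity> \<Longrightarrow> Dstar \<le> dist x z) \<Longrightarrow>
      \<exists>T M. F0.is_period x T \<and> (\<forall>s\<in>{0..T}. norm (hess H (\<Phi>0 s x)) \<le> M) \<and> M * T \<le> B"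
    by blast
  define E where "E = exp B"
  \<comment> \<open>The constant of \<open>curve_growth\<close>; \<open>F0.L\<close> does not
    involve the flow, so it is also the \<open>L\<close> of every other flow.\<close>
  define K where "K = 1 + (E + E * (1 + E)) + F0.L * (E * (1 + E))"
  have "E > 0" by (simp add: E_def)
  then have "K > 0" using F0.L_pos unfolding K_def by (intro add_pos_pos mult_pos_pos) auto
  show ?thesis
  proof (rule exI[of _ K], rule conjI[OF \<open>K > 0\<close>], intro allI impI conjI)
    fix \<Phi> :: "real \<Rightarrow> real^2 \<Rightarrow> real^2" and \<gamma>0 :: "real \<Rightarrow> real^2"
    assume \<Phi>: "flow_of \<Omega> V \<Phi>" and img: "\<gamma>0 ` {0..1} \<subseteq> closure \<Omega>" and "\<exists>L. L-lipschitz_on {0..1} \<gamma>0"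
      and Ds: "ereal Dstar = min 1 (set_edist (\<gamma>0 ` {0..1}) (nonperiodic_points \<Omega> \<Phi>))"
    then obtain L\<gamma> where lip: "L\<gamma>-lipschitz_on {0..1} \<gamma>0" by blast
    interpret F: planar_hamiltonian_flow "closure \<Omega>" H "grad H" "hess H" \<Phi> by (rule flow[OF \<Phi>])
    \<comment> \<open>Agreement for nonnegative times is enough, as periods and the bounds on
      \<open>{0..T}\<close> look forward only.\<close>
    have eq: "\<Phi>0 t x = \<Phi> t x" if "x \<in> closure \<Omega>" "0 \<le> t" for x t
      by (rule F.solution_unique) (use that F0.flow_0 F0.flow_in F0.flow_deriv_W in \<open>auto simp: F.W_def\<close>)
    have per: "F.is_period x T" if "F0.is_period x T" "x \<in> closure \<Omega>" for x T
      using that eq[OF that(2)] unfolding F.is_period_def F0.is_period_def by (metis less_imp_le)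
    have orb: "orbit_period \<Phi>0 x = orbit_period \<Phi> x" if "x \<in> closure \<Omega>" for x
    proof -
      have "{t. t > 0 \<and> \<Phi>0 t x = x} = {t. t > 0 \<and> \<Phi> t x = x}" using eq[OF that] by auto
      then show ?thesis by (simp add: orbit_period_def)
    qed
    have bound: "\<exists>T M. F.is_period (\<gamma>0 \<alpha>) T \<and> (\<forall>s\<in>{0..T}. norm (hess H (\<Phi> s (\<gamma>0 \<alpha>))) \<le> M) \<and> M * T \<le> B"
      if \<alpha>: "\<alpha> \<in> {0..1}" "grad H (\<gamma>0 \<alpha>) \<noteq> 0" for \<alpha>
    proof -
      have x: "\<gamma>0 \<alpha> \<in> closure \<Omega>" using img \<alpha>(1) by blast
      have "Dstar \<le> dist (\<gamma>0 \<alpha>) z" if z: "z \<in> closure \<Omega>" "orbit_period \<Phi>0 z = \<infinity>" for z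
      proof -
        have "z \<in> nonperiodic_points \<Omega> \<Phi>" using z orb by (simp add: nonperiodic_points_def)
        then have "set_edist (\<gamma>0 ` {0..1}) (nonperiodic_points \<Omega> \<Phi>) \<le> ereal (dist (\<gamma>0 \<alpha>) z)"
          unfolding set_edist_def using \<alpha>(1) by (intro INF_lower2[of "(\<gamma>0 \<alpha>, z)"]) auto
        then have "ereal Dstar \<le> ereal (dist (\<gamma>0 \<alpha>) z)" unfolding Ds by (rule min.coboundedI2)
        then show ?thesis by simp
      qed
      from B[OF x \<alpha>(2) this] obtain T M where TM: "F0.is_period (\<gamma>0 \<alpha>) T"
        "\<forall>s\<in>{0..T}. norm (hess H (\<Phi>0 s (\<gamma>0 \<alpha>))) \<le> M" "M * T \<le> B" by blast
      then show ?thesis using per[OF TM(1) x] eq[OF x] by (intro exI[of _ T] exI[of _ M]) auto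
    qed
    have periodic: "periodic_points \<Omega> \<Phi> = F.periodic"
      using F.orbit_period_pos_finite_iff by (auto simp: periodic_points_def F.periodic_def)
    define G where "G t \<alpha> = (if 0 < orbit_period \<Phi> (\<gamma>0 \<alpha>) \<and> orbit_period \<Phi> (\<gamma>0 \<alpha>) < \<infinity>
      then \<bar>vector_derivative \<gamma>0 (at \<alpha> within {0..1}) \<bullet> gradient_within (ln_period \<Phi>) F.periodic (\<gamma>0 \<alpha>)\<bar>
           * norm (F.W (\<Phi> t (\<gamma>0 \<alpha>)))
      else 0)" for t \<alpha>
    have G: "growth_density \<Omega> V \<Phi> \<gamma>0 \<alpha> t = G t \<alpha>" if "\<alpha> \<in> {0..1}" for \<alpha> t
    proof -
      have "\<Phi> t (\<gamma>0 \<alpha>) \<in> closure \<Omega>" using img that by (intro F.flow_in) blast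
      then show ?thesis by (simp add: growth_density_def G_def periodic transported_curve_def V F.W_def)
    qed
    note growth = F.curve_growth[OF lip img _ lipschitz_domain_cone[OF assms(1)] bound,
        folded G_def E_def, folded K_def]
    have len: "transported_curve \<Phi> \<gamma>0 t = (\<lambda>\<alpha>. \<Phi> t (\<gamma>0 \<alpha>))" for t by (simp add: transported_curve_def fun_eq_iff)
    have intG: "integral {0..1} (\<lambda>\<alpha>. growth_density \<Omega> V \<Phi> \<gamma>0 \<alpha> t) = integral {0..1} (G t)" for t
      by (rule Henstock_Kurzweil_Integration.integral_cong) (rule G)
    show "(\<lambda>\<alpha>. growth_density \<Omega> V \<Phi> \<gamma>0 \<alpha> t) absolutely_integrable_on {0..1}" if "0 \<le> t" for t
    proof -
      have "G t absolutely_integrable_on {0..1}" by (rule growth(1)[OF that])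
      then show ?thesis by (rule absolutely_integrable_spike[OF _ negligible_empty]) (use G in auto)
    qed
    show "(SUP t\<in>{0..}. \<bar>curve_length (transported_curve \<Phi> \<gamma>0 t) -
            ereal (t * integral {0..1} (\<lambda>\<alpha>. growth_density \<Omega> V \<Phi> \<gamma>0 \<alpha> t))\<bar>) \<le> ereal K * curve_length \<gamma>0"
    proof (rule SUP_least)
      fix t :: real assume "t \<in> {0..}"
      then have t: "0 \<le> t" by simp
      show "\<bar>curve_length (transported_curve \<Phi> \<gamma>0 t) -
            ereal (t * integral {0..1} (\<lambda>\<alpha>. growth_density \<Omega> V \<Phi> \<gamma>0 \<alpha> t))\<bar> \<le> ereal K * curve_length \<gamma>0"
        unfolding intG len by (rule growth(2)[OF t])
    qed
    show "(SUP t\<in>{0..}. ereal (integral {0..1} (\<lambda>\<alpha>. growth_density \<Omega> V \<Phi> \<gamma>0 \<alpha> t))) \<le> ereal K * curve_length \<gamma>0"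
    proof (rule SUP_least)
      fix t :: real assume "t \<in> {0..}"
      then have t: "0 \<le> t" by simp
      show "ereal (integral {0..1} (\<lambda>\<alpha>. growth_density \<Omega> V \<Phi> \<gamma>0 \<alpha> t)) \<le> ereal K * curve_length \<gamma>0"
        unfolding intG by (rule growth(3)[OF t])
    qed
  qed
qed

end
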